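(* Let $E\to M$ be a vector bundle, $n\ge 1$ an integer, $\mathcal{E}=\mathfrak{D}E\oplus\mathfrak{J}_nE$ the higher omni-Lie algebroid of $E$, and let $\mu\in\Omega^{n+1}_{\mathfrak{J}E}$. Let $B_\mu:\mathfrak{D}E\to\mathfrak{J}_nE$ be the vector bundle map $\mathfrak{d}\mapsto\iota_{\mathfrak{d}}\mu$. Then the graph $$L=\operatorname{graph}B_\mu=\{\mathfrak{d}+B_\mu(\mathfrak{d}):\mathfrak{d}\in\mathfrak{D}E\}\subset\mathcal{E}$$ is a maximal isotropic subbundle, and every isotropic subbundle of $\mathcal{E}$ projecting isomorphically onto $\mathfrak{D}E$ arises in this way (i.e. equals $\operatorname{graph}B_{\mu'}$ for some $\mu'\in\Omega^{n+1}_{\mathfrak{J}E}$). Additionally, $L$ is involutive, hence a higher Dirac-Jacobi structure, if and only if $\mu$ is closed ($d_{\mathfrak D}\mu=0$), hence exact ($\mu=d_{\mathfrak D}\mu''$ for some $\mu''\in\Omega^{n}_{\mathfrak{J}E}$).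
   Context: Let $E\to M$ be a (smooth, real) vector bundle. A derivation of $E$ is an $\mathbb{R}$-linear operator $\mathfrak{d}:\Gamma(E)\to\Gamma(E)$ with $\mathfrak{d}(fu)=\sigma(\mathfrak{d})(f)\,u+f\,\mathfrak{d}u$ for all $f\in C^\infty(M)$, $u\in\Gamma(E)$, for some (unique) vector field $\sigma(\mathfrak{d})$, its symbol. Derivations are the sections of a vector bundle $\mathfrak{D}E\to M$, a Lie algebroid (the gauge algebroid) with bracket the commutator $[-,-]_{\mathfrak{D}}$ and surjective anchor $\sigma:\mathfrak{D}E\to TM$, whose kernel is $\mathfrak{gl}(E)$, the bundle of endomorphisms of $E$. Let $\Omega^k(\mathfrak{D}E,E)=\Gamma(\operatorname{Hom}(\wedge^k\mathfrak{D}E,E))$, with differential $$d_{\mathfrak D}\mu(\mathfrak{d}_0,\dots,\mathfrak{d}_k)=\sum_i(-1)^i\mathfrak{d}_i\big(\mu(\mathfrak{d}_0,\dots,\widehat{\mathfrak{d}_i},\dots,\mathfrak{d}_k)\big)+\sum_{i<j}(-1)^{i+j}\mu([\mathfrak{d}_i,\mathfrak{d}_j]_{\mathfrak D},\dots,\widehat{\mathfrak{d}_i},\dots,\widehat{\mathfrak{d}_j},\dots,\mathfrak{d}_k).$$ $\iota_{\mathfrak d}$ is contraction (insertion in the first slot) and $\mathcal{L}_{\mathfrak d}=\iota_{\mathfrak d}d_{\mathfrak D}+d_{\mathfrak D}\iota_{\mathfrak d}$ is the Lie derivative. For $\lambda\in\operatorname{Hom}(\wedge^kTM,E)$ put $\sigma^*\lambda=\lambda(\sigma-,\dots,\sigma-)$.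 $\mathfrak{J}_kE\subset\operatorname{Hom}(\wedge^k\mathfrak{D}E,E)$ is the subbundle of those $\mu$ for which there is $\lambda_\mu\in\operatorname{Hom}(\wedge^{k-1}TM,E)$ with $\iota_\Phi\mu=\Phi\circ\sigma^*\lambda_\mu$ for all $\Phi\in\mathfrak{gl}(E)$ (so $\mathfrak{J}_0E=E$). Put $\Omega^k_{\mathfrak{J}E}=\Gamma(\mathfrak{J}_kE)$; these spaces are preserved by $d_{\mathfrak D}$, $\iota_{\mathfrak d}$ and $\mathcal{L}_{\mathfrak d}$. For a positive integer $n$, the higher omni-Lie algebroid is $\mathcal{E}=\mathfrak{D}E\oplus\mathfrak{J}_nE$ with the bracket on sections $$\{\mathfrak{d}+\mu,\mathfrak{r}+\nu\}=[\mathfrak{d},\mathfrak{r}]_{\mathfrak D}+\mathcal{L}_{\mathfrak d}\nu-\iota_{\mathfrak r}d_{\mathfrak D}\mu$$ and the $\mathfrak{J}_{n-1}E$-valued symmetric bilinear pairing $(\mathfrak{d}+\mu,\mathfrak{r}+\nu)_+=\tfrac12(\iota_{\mathfrak d}\nu+\iota_{\mathfrak r}\mu)$. A subbundle $L\subset\mathcal{E}$ is isotropic if $(e_1,e_2)_+=0$ for all $e_1,e_2\in L$; involutive if $\{e_1,e_2\}\in\Gamma(L)$ for all $e_1,e_2\in\Gamma(L)$. A maximal isotropic (with respect to inclusion among isotropic subbundles) and involutive subbundle is a higher Dirac-Jacobi structure. "Projecting isomorphically onto $\mathfrak{D}E$" means that the restriction to $L$ of the projection $\mathcal{E}\to\mathfrak{D}E$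 is a vector bundle isomorphism. *)

theory Defs
  imports "HOL-Analysis.Analysis" "HOL-Library.Function_Algebras"
begin

text \<open>Functions into a real vector space carry the pointwise structure, so that the library's
  \<open>subspace\<close>, \<open>independent\<close> and \<open>span\<close> apply to spaces of sections, derivations and forms.\<close>

instantiation "fun" :: (type, real_vector) real_vector
begin

definition scaleR_fun :: "real \<Rightarrow> ('a \<Rightarrow> 'b) \<Rightarrow> 'a \<Rightarrow> 'b" where
  "scaleR_fun c f = (\<lambda>x. c *\<^sub>R f x)"

instance
  by standard (simp_all add: scaleR_fun_def plus_fun_def fun_eq_iff scaleR_add_right scaleR_add_left)

end

definition lin_on :: "'b::real_vector set \<Rightarrow> ('b \<Rightarrow> 'c::real_vector) \<Rightarrow> bool" where
  "lin_on V f \<longleftrightarrow> (\<forall>x\<in>V. \<forall>y\<in>V. f (x + y) = f x + f y) \<and> (\<forall>c. \<forall>x\<in>V. f (c *\<^sub>R x) = c *\<^sub>R f x)"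

text \<open>\<open>Hom(\<And>\<^sup>k V, W)\<close> for subspaces \<open>V\<close> and \<open>W\<close>: a \<open>k\<close>-form takes the list of its arguments and is
  \<open>0\<close> on every other list, so that equality of forms is equality of functions.\<close>

definition alt_forms :: "nat \<Rightarrow> 'b::real_vector set \<Rightarrow> 'c::real_vector set \<Rightarrow> ('b list \<Rightarrow> 'c) set" where
  "alt_forms k V W = {\<alpha>.
     (\<forall>xs. length xs = k \<and> set xs \<subseteq> V \<longrightarrow> \<alpha> xs \<in> W) \<and>
     (\<forall>xs i. length xs = k \<and> set xs \<subseteq> V \<and> i < k \<longrightarrow> lin_on V (\<lambda>v. \<alpha> (xs[i := v]))) \<and>
     (\<forall>xs. length xs = k \<and> set xs \<subseteq> V \<and> \<not> distinct xs \<longrightarrow> \<alpha> xs = 0) \<and>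
     (\<forall>xs. \<not> (length xs = k \<and> set xs \<subseteq> V) \<longrightarrow> \<alpha> xs = 0)}"

definition ins :: "'b \<Rightarrow> ('b list \<Rightarrow> 'c) \<Rightarrow> 'b list \<Rightarrow> 'c" where
  "ins v \<alpha> = (\<lambda>xs. \<alpha> (v # xs))"

definition del :: "nat \<Rightarrow> 'b list \<Rightarrow> 'b list" where
  "del i xs = take i xs @ drop (Suc i) xs"


section \<open>Smooth manifolds and vector bundles\<close>

text \<open>\<open>Ck_on k T f\<close> is only meant for open \<open>T\<close>.\<close>

fun Ck_on :: "nat \<Rightarrow> 'm::euclidean_space set \<Rightarrow> ('m \<Rightarrow> 'b::real_normed_vector) \<Rightarrow> bool" where
  "Ck_on 0 T f \<longleftrightarrow> continuous_on T f"
| "Ck_on (Suc k) T f \<longleftrightarrow> f differentiable_on T \<and>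
     (\<forall>b\<in>Basis. Ck_on k T (\<lambda>x. frechet_derivative f (at x) b))"

text \<open>Smoothness on an arbitrary subset means local extendability to a smooth function on an open
  set; for (relatively) open subsets of a linear subspace this is the usual smoothness.\<close>

definition smooth_on :: "'m::euclidean_space set \<Rightarrow> ('m \<Rightarrow> 'b::real_normed_vector) \<Rightarrow> bool" where
  "smooth_on S f \<longleftrightarrow> (\<forall>x\<in>S. \<exists>T g. open T \<and> x \<in> T \<and> (\<forall>k. Ck_on k T g) \<and> (\<forall>y\<in>S \<inter> T. f y = g y))"

text \<open>The base manifold is the whole type \<open>'a\<close>. Its charts take values in a linear subspace
  \<open>model\<close> of \<open>'m\<close>, rather than in \<open>'m\<close> itself, because a Euclidean space type has positive
  dimension, while manifolds of dimension 0 should be included.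

  The fibre over \<open>x\<close> is a linear subspace \<open>fib x\<close> of \<open>'v\<close>. There is no loss of generality, since any
  family of vector spaces embeds in its direct sum; \<open>'v\<close> carries no topology, and the smooth structure
  of the total space is the one given by the local trivialisations \<open>trivs\<close>, with typical fibre \<open>'f\<close>.
  The rank is therefore positive, as it has to be for the symbol of a derivation to be unique.\<close>

record ('a, 'm, 'v, 'f) vbundle =
  model  :: "'m set"
  charts :: "('a set \<times> ('a \<Rightarrow> 'm)) set"
  fib    :: "'a \<Rightarrow> 'v set"
  trivs  :: "('a set \<times> ('a \<Rightarrow> 'v \<Rightarrow> 'f)) set"

definition smooth_manifold ::
  "('a::{t2_space,second_countable_topology}, 'm::euclidean_space, 'v, 'f) vbundle \<Rightarrow> bool" where
  "smooth_manifold E \<longleftrightarrow>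
     subspace (model E) \<and>
     (\<Union>(U, \<phi>)\<in>charts E. U) = UNIV \<and>
     (\<forall>(U, \<phi>)\<in>charts E. open U \<and> openin (top_of_set (model E)) (\<phi> ` U) \<and>
        homeomorphism U (\<phi> ` U) \<phi> (inv_into U \<phi>)) \<and>
     (\<forall>(U, \<phi>)\<in>charts E. \<forall>(U', \<phi>')\<in>charts E. smooth_on (\<phi> ` (U \<inter> U')) (\<phi>' \<circ> inv_into U \<phi>))"

definition smooth_map_on ::
  "('a, 'm::euclidean_space, 'v, 'f) vbundle \<Rightarrow> 'a set \<Rightarrow> ('a \<Rightarrow> 'b::real_normed_vector) \<Rightarrow> bool" where
  "smooth_map_on E W f \<longleftrightarrow> (\<forall>(U, \<phi>)\<in>charts E. smooth_on (\<phi> ` (U \<inter> W)) (f \<circ> inv_into U \<phi>))"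

definition vector_bundle ::
  "('a::{t2_space,second_countable_topology}, 'm::euclidean_space, 'v::real_vector,
    'f::euclidean_space) vbundle \<Rightarrow> bool" where
  "vector_bundle E \<longleftrightarrow>
     smooth_manifold E \<and>
     (\<forall>x. subspace (fib E x)) \<and>
     (\<Union>(U, \<tau>)\<in>trivs E. U) = UNIV \<and>
     (\<forall>(U, \<tau>)\<in>trivs E. open U \<and> (\<forall>x\<in>U. lin_on (fib E x) (\<tau> x) \<and> bij_betw (\<tau> x) (fib E x) UNIV)) \<and>
     (\<forall>(U, \<tau>)\<in>trivs E. \<forall>(U', \<tau>')\<in>trivs E. \<forall>w.
        smooth_map_on E (U \<inter> U') (\<lambda>x. \<tau>' x (inv_into (fib E x) (\<tau> x) w)))"

definition Cinf :: "('a, 'm::euclidean_space, 'v, 'f) vbundle \<Rightarrow> ('a \<Rightarrow> real) set" where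
  "Cinf E = {f. smooth_map_on E UNIV f}"

definition sections ::
  "('a, 'm::euclidean_space, 'v, 'f::euclidean_space) vbundle \<Rightarrow> ('a \<Rightarrow> 'v) set" where
  "sections E = {u. (\<forall>x. u x \<in> fib E x) \<and> (\<forall>(U, \<tau>)\<in>trivs E. smooth_map_on E U (\<lambda>x. \<tau> x (u x)))}"

definition tangent_space ::
  "('a, 'm::euclidean_space, 'v, 'f) vbundle \<Rightarrow> 'a \<Rightarrow> (('a \<Rightarrow> real) \<Rightarrow> real) set" where
  "tangent_space E x = {v. lin_on (Cinf E) v \<and> (\<forall>f. f \<notin> Cinf E \<longrightarrow> v f = 0) \<and>
     (\<forall>f\<in>Cinf E. \<forall>g\<in>Cinf E. v (\<lambda>y. f y * g y) = v f * g x + f x * v g)}"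

definition vector_field ::
  "('a, 'm::euclidean_space, 'v, 'f) vbundle \<Rightarrow> (('a \<Rightarrow> real) \<Rightarrow> 'a \<Rightarrow> real) \<Rightarrow> bool" where
  "vector_field E X \<longleftrightarrow> (\<forall>x. (\<lambda>f. X f x) \<in> tangent_space E x) \<and> (\<forall>f\<in>Cinf E. X f \<in> Cinf E)"


section \<open>The gauge algebroid\<close>

text \<open>An operator on \<open>\<Gamma>(E)\<close> is extended by \<open>0\<close> to all functions \<open>'a \<Rightarrow> 'v\<close>.\<close>

definition derivations ::
  "('a, 'm::euclidean_space, 'v::real_vector, 'f::euclidean_space) vbundle \<Rightarrow>
   (('a \<Rightarrow> 'v) \<Rightarrow> 'a \<Rightarrow> 'v) set" where
  "derivations E = {D. lin_on (sections E) D \<and> D ` sections E \<subseteq> sections E \<and>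
     (\<forall>u. u \<notin> sections E \<longrightarrow> D u = 0) \<and>
     (\<exists>X. vector_field E X \<and> (\<forall>f\<in>Cinf E. \<forall>u\<in>sections E.
        D (\<lambda>x. f x *\<^sub>R u x) = (\<lambda>x. X f x *\<^sub>R u x + f x *\<^sub>R D u x)))}"

text \<open>The bundle \<open>\<D>E\<close> is the one whose sections are the derivations: its fibre at \<open>x\<close> consists of the
  values \<open>u \<mapsto> (D u) x\<close> of derivations \<open>D\<close>, and its smooth structure is fixed by saying that the
  smooth sections are the derivations.\<close>

definition value_at :: "'a \<Rightarrow> (('a \<Rightarrow> 'v) \<Rightarrow> 'a \<Rightarrow> 'v) \<Rightarrow> ('a \<Rightarrow> 'v) \<Rightarrow> 'v" where
  "value_at x D = (\<lambda>u. D u x)"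

definition gauge_fib ::
  "('a, 'm::euclidean_space, 'v::real_vector, 'f::euclidean_space) vbundle \<Rightarrow> 'a \<Rightarrow>
   (('a \<Rightarrow> 'v) \<Rightarrow> 'v) set" where
  "gauge_fib E x = value_at x ` derivations E"

definition commutator ::
  "(('a \<Rightarrow> 'v) \<Rightarrow> 'a \<Rightarrow> 'v) \<Rightarrow> (('a \<Rightarrow> 'v) \<Rightarrow> 'a \<Rightarrow> 'v) \<Rightarrow> ('a \<Rightarrow> 'v::real_vector) \<Rightarrow> 'a \<Rightarrow> 'v" where
  "commutator D R = (\<lambda>u. D (R u) - R (D u))"

definition symbol ::
  "('a, 'm::euclidean_space, 'v::real_vector, 'f::euclidean_space) vbundle \<Rightarrow> 'a \<Rightarrow>
   (('a \<Rightarrow> 'v) \<Rightarrow> 'v) \<Rightarrow> ('a \<Rightarrow> real) \<Rightarrow> real" where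
  "symbol E x \<delta> = (THE v. v \<in> tangent_space E x \<and> (\<forall>f\<in>Cinf E. \<forall>u\<in>sections E.
     \<delta> (\<lambda>y. f y *\<^sub>R u y) = v f *\<^sub>R u x + f x *\<^sub>R \<delta> u))"

definition endos :: "('a, 'm, 'v::real_vector, 'f) vbundle \<Rightarrow> 'a \<Rightarrow> ('v \<Rightarrow> 'v) set" where
  "endos E x = {\<Phi>. lin_on (fib E x) \<Phi> \<and> \<Phi> ` fib E x \<subseteq> fib E x}"

text \<open>The inclusion \<open>gl(E) \<subseteq> \<D>E\<close>.\<close>

definition endo_der ::
  "('a, 'm::euclidean_space, 'v::real_vector, 'f::euclidean_space) vbundle \<Rightarrow> 'a \<Rightarrow>
   ('v \<Rightarrow> 'v) \<Rightarrow> ('a \<Rightarrow> 'v) \<Rightarrow> 'v" where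
  "endo_der E x \<Phi> = (\<lambda>u. if u \<in> sections E then \<Phi> (u x) else 0)"


section \<open>Forms on the gauge algebroid with values in the bundle\<close>

type_synonym ('a, 'v) der = "('a \<Rightarrow> 'v) \<Rightarrow> 'a \<Rightarrow> 'v"
type_synonym ('a, 'v) der_at = "('a \<Rightarrow> 'v) \<Rightarrow> 'v"
type_synonym ('a, 'v) form_at = "('a, 'v) der_at list \<Rightarrow> 'v"

definition Omega ::
  "('a, 'm::euclidean_space, 'v::real_vector, 'f::euclidean_space) vbundle \<Rightarrow> nat \<Rightarrow>
   ('a \<Rightarrow> ('a, 'v) form_at) set" where
  "Omega E k = {\<mu>. (\<forall>x. \<mu> x \<in> alt_forms k (gauge_fib E x) (fib E x)) \<and>
     (\<forall>Ds. length Ds = k \<and> set Ds \<subseteq> derivations E \<longrightarrow>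
        (\<lambda>x. \<mu> x (map (value_at x) Ds)) \<in> sections E)}"

definition d_formula ::
  "('a \<Rightarrow> ('a, 'v::real_vector) form_at) \<Rightarrow> ('a, 'v) der list \<Rightarrow> 'a \<Rightarrow> 'v" where
  "d_formula \<mu> Ds x =
     (\<Sum>i<length Ds. (-1) ^ i *\<^sub>R (Ds ! i) (\<lambda>y. \<mu> y (map (value_at y) (del i Ds))) x) +
     (\<Sum>j<length Ds. \<Sum>i<j. (-1) ^ (i + j) *\<^sub>R
        \<mu> x (map (value_at x) (commutator (Ds ! i) (Ds ! j) # del i (del j Ds))))"

text \<open>\<open>dD E k\<close> is the differential on \<open>k\<close>-forms: the form given on derivations by the formula above.\<close>

definition dD ::
  "('a, 'm::euclidean_space, 'v::real_vector, 'f::euclidean_space) vbundle \<Rightarrow> nat \<Rightarrow>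
   ('a \<Rightarrow> ('a, 'v) form_at) \<Rightarrow> 'a \<Rightarrow> ('a, 'v) form_at" where
  "dD E k \<mu> = (THE \<omega>. \<omega> \<in> Omega E (Suc k) \<and>
     (\<forall>Ds. length Ds = Suc k \<and> set Ds \<subseteq> derivations E \<longrightarrow>
        (\<forall>x. \<omega> x (map (value_at x) Ds) = d_formula \<mu> Ds x)))"

definition contr ::
  "('a, 'v) der \<Rightarrow> ('a \<Rightarrow> ('a, 'v) form_at) \<Rightarrow> 'a \<Rightarrow> ('a, 'v) form_at" where
  "contr D \<mu> = (\<lambda>x. ins (value_at x D) (\<mu> x))"

text \<open>The Lie derivative of \<open>k\<close>-forms. The contraction of a 0-form is \<open>0\<close>, so the truncated
  \<open>k - 1\<close> is harmless for \<open>k = 0\<close>.\<close>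

definition lie_der ::
  "('a, 'm::euclidean_space, 'v::real_vector, 'f::euclidean_space) vbundle \<Rightarrow> nat \<Rightarrow>
   ('a, 'v) der \<Rightarrow> ('a \<Rightarrow> ('a, 'v) form_at) \<Rightarrow> 'a \<Rightarrow> ('a, 'v) form_at" where
  "lie_der E k D \<mu> = contr D (dD E k \<mu>) + dD E (k - 1) (contr D \<mu>)"

definition J_fib ::
  "('a, 'm::euclidean_space, 'v::real_vector, 'f::euclidean_space) vbundle \<Rightarrow> nat \<Rightarrow> 'a \<Rightarrow>
   ('a, 'v) form_at set" where
  "J_fib E k x = {\<alpha> \<in> alt_forms k (gauge_fib E x) (fib E x). k = 0 \<or>
     (\<exists>\<kappa>\<in>alt_forms (k - 1) (tangent_space E x) (fib E x). \<forall>\<Phi>\<in>endos E x.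
        \<forall>\<delta>s. length \<delta>s = k - 1 \<and> set \<delta>s \<subseteq> gauge_fib E x \<longrightarrow>
          ins (endo_der E x \<Phi>) \<alpha> \<delta>s = \<Phi> (\<kappa> (map (symbol E x) \<delta>s)))}"

definition Omega_J ::
  "('a, 'm::euclidean_space, 'v::real_vector, 'f::euclidean_space) vbundle \<Rightarrow> nat \<Rightarrow>
   ('a \<Rightarrow> ('a, 'v) form_at) set" where
  "Omega_J E k = {\<mu> \<in> Omega E k. \<forall>x. \<mu> x \<in> J_fib E k x}"


section \<open>The higher omni-Lie algebroid\<close>

definition omni_fib ::
  "('a, 'm::euclidean_space, 'v::real_vector, 'f::euclidean_space) vbundle \<Rightarrow> nat \<Rightarrow> 'a \<Rightarrow>
   (('a, 'v) der_at \<times> ('a, 'v) form_at) set" where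
  "omni_fib E n x = gauge_fib E x \<times> J_fib E n x"

definition omni_sections ::
  "('a, 'm::euclidean_space, 'v::real_vector, 'f::euclidean_space) vbundle \<Rightarrow> nat \<Rightarrow>
   (('a, 'v) der \<times> ('a \<Rightarrow> ('a, 'v) form_at)) set" where
  "omni_sections E n = derivations E \<times> Omega_J E n"

definition omni_value ::
  "'a \<Rightarrow> ('a, 'v) der \<times> ('a \<Rightarrow> ('a, 'v) form_at) \<Rightarrow> ('a, 'v) der_at \<times> ('a, 'v) form_at" where
  "omni_value x e = (value_at x (fst e), snd e x)"

definition omni_bracket ::
  "('a, 'm::euclidean_space, 'v::real_vector, 'f::euclidean_space) vbundle \<Rightarrow> nat \<Rightarrow>
   ('a, 'v) der \<times> ('a \<Rightarrow> ('a, 'v) form_at) \<Rightarrow> ('a, 'v) der \<times> ('a \<Rightarrow> ('a, 'v) form_at) \<Rightarrow>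
   ('a, 'v) der \<times> ('a \<Rightarrow> ('a, 'v) form_at)" where
  "omni_bracket E n = (\<lambda>(D, \<mu>) (R, \<nu>).
     (commutator D R, lie_der E n D \<nu> - contr R (dD E n \<mu>)))"

definition omni_pairing ::
  "('a, 'v::real_vector) der_at \<times> ('a, 'v) form_at \<Rightarrow> ('a, 'v) der_at \<times> ('a, 'v) form_at \<Rightarrow>
   ('a, 'v) form_at" where
  "omni_pairing = (\<lambda>(\<delta>, \<alpha>) (\<epsilon>, \<beta>). (1/2) *\<^sub>R (ins \<delta> \<beta> + ins \<epsilon> \<alpha>))"

text \<open>Local frames are taken to be restrictions of global sections; multiplying by bump functions
  shows that this is no restriction.\<close>

definition omni_subbundle ::
  "('a::topological_space, 'm::euclidean_space, 'v::real_vector, 'f::euclidean_space) vbundle \<Rightarrow> nat \<Rightarrow>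
   ('a \<Rightarrow> (('a, 'v) der_at \<times> ('a, 'v) form_at) set) \<Rightarrow> bool" where
  "omni_subbundle E n L \<longleftrightarrow>
     (\<forall>x. subspace (L x) \<and> L x \<subseteq> omni_fib E n x) \<and>
     (\<exists>r. \<forall>p. \<exists>U es. open U \<and> p \<in> U \<and> length es = r \<and> set es \<subseteq> omni_sections E n \<and>
        (\<forall>x\<in>U. distinct (map (omni_value x) es) \<and> independent (omni_value x ` set es) \<and>
           span (omni_value x ` set es) = L x))"

definition sub_sections ::
  "('a, 'm::euclidean_space, 'v::real_vector, 'f::euclidean_space) vbundle \<Rightarrow> nat \<Rightarrow>
   ('a \<Rightarrow> (('a, 'v) der_at \<times> ('a, 'v) form_at) set) \<Rightarrow>
   (('a, 'v) der \<times> ('a \<Rightarrow> ('a, 'v) form_at)) set" where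
  "sub_sections E n L = {e \<in> omni_sections E n. \<forall>x. omni_value x e \<in> L x}"

definition isotropic_subbundle ::
  "('a::topological_space, 'm::euclidean_space, 'v::real_vector, 'f::euclidean_space) vbundle \<Rightarrow> nat \<Rightarrow>
   ('a \<Rightarrow> (('a, 'v) der_at \<times> ('a, 'v) form_at) set) \<Rightarrow> bool" where
  "isotropic_subbundle E n L \<longleftrightarrow>
     omni_subbundle E n L \<and> (\<forall>x. \<forall>e\<^sub>1\<in>L x. \<forall>e\<^sub>2\<in>L x. omni_pairing e\<^sub>1 e\<^sub>2 = 0)"

definition maximal_isotropic_subbundle ::
  "('a::topological_space, 'm::euclidean_space, 'v::real_vector, 'f::euclidean_space) vbundle \<Rightarrow> nat \<Rightarrow>
   ('a \<Rightarrow> (('a, 'v) der_at \<times> ('a, 'v) form_at) set) \<Rightarrow> bool" where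
  "maximal_isotropic_subbundle E n L \<longleftrightarrow> isotropic_subbundle E n L \<and>
     (\<forall>L'. isotropic_subbundle E n L' \<and> (\<forall>x. L x \<subseteq> L' x) \<longrightarrow> L' = L)"

definition involutive ::
  "('a, 'm::euclidean_space, 'v::real_vector, 'f::euclidean_space) vbundle \<Rightarrow> nat \<Rightarrow>
   ('a \<Rightarrow> (('a, 'v) der_at \<times> ('a, 'v) form_at) set) \<Rightarrow> bool" where
  "involutive E n L \<longleftrightarrow>
     (\<forall>e\<^sub>1\<in>sub_sections E n L. \<forall>e\<^sub>2\<in>sub_sections E n L. omni_bracket E n e\<^sub>1 e\<^sub>2 \<in> sub_sections E n L)"

definition higher_dirac_jacobi ::
  "('a::topological_space, 'm::euclidean_space, 'v::real_vector, 'f::euclidean_space) vbundle \<Rightarrow> nat \<Rightarrow>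
   ('a \<Rightarrow> (('a, 'v) der_at \<times> ('a, 'v) form_at) set) \<Rightarrow> bool" where
  "higher_dirac_jacobi E n L \<longleftrightarrow> maximal_isotropic_subbundle E n L \<and> involutive E n L"

text \<open>The projection \<open>L \<rightarrow> \<D>E\<close> is an isomorphism of vector bundles: it is bijective on fibres and
  its inverse is smooth, i.e. maps smooth sections to smooth sections.\<close>

definition projects_isomorphically ::
  "('a, 'm::euclidean_space, 'v::real_vector, 'f::euclidean_space) vbundle \<Rightarrow> nat \<Rightarrow>
   ('a \<Rightarrow> (('a, 'v) der_at \<times> ('a, 'v) form_at) set) \<Rightarrow> bool" where
  "projects_isomorphically E n L \<longleftrightarrow> (\<forall>x. bij_betw fst (L x) (gauge_fib E x)) \<and>
     (\<forall>D\<in>derivations E. \<exists>\<alpha>. (D, \<alpha>) \<in> sub_sections E n L)"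

definition graph_B ::
  "('a, 'm::euclidean_space, 'v::real_vector, 'f::euclidean_space) vbundle \<Rightarrow>
   ('a \<Rightarrow> ('a, 'v) form_at) \<Rightarrow> 'a \<Rightarrow> (('a, 'v) der_at \<times> ('a, 'v) form_at) set" where
  "graph_B E \<mu> x = {(\<delta>, ins \<delta> (\<mu> x)) | \<delta>. \<delta> \<in> gauge_fib E x}"

end

theory Submission
  imports Defs
begin

text \<open>Isotropy of a graph \<open>{(\<delta>, B \<delta>)}\<close> says that \<open>(B \<delta>)(\<epsilon>, \<dots>) = - (B \<epsilon>)(\<delta>, \<dots>)\<close>, which is what makes
  \<open>\<mu>(\<delta>, \<dots>) = (B \<delta>)(\<dots>)\<close> an alternating \<open>(n+1)\<close>-form; so isotropic graphs and forms correspond to each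
  other. An element \<open>(\<delta>, \<alpha>)\<close> that pairs to \<open>0\<close> with all of a graph satisfies
  \<open>\<alpha>(\<epsilon>, \<dots>) = \<mu>(\<delta>, \<epsilon>, \<dots>)\<close> for all \<open>\<epsilon>\<close>; since \<open>n \<ge> 1\<close>, this determines \<open>\<alpha>\<close>, and the graph is maximal.
  That the form \<open>\<mu>\<close> of an isotropic graph lies in \<open>J\<^bsub>n+1\<^esub> E\<close> uses the exact sequence
  \<open>0 \<rightarrow> gl(E) \<rightarrow> \<D>E \<rightarrow> TM \<rightarrow> 0\<close>: one has \<open>\<mu>(\<Phi>, \<dots>) = \<Phi>(\<mu>(1, \<dots>))\<close> for \<open>\<Phi> \<in> gl(E)\<close>, hence \<open>\<mu>(1, \<dots>)\<close> vanishes
  on \<open>gl(E)\<close> and descends to tangent vectors (\<open>isotropic_is_graph\<close>).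

  Cartan's formula \<open>\<iota>\<^bsub>[D,R]\<^esub> = L\<^sub>D \<iota>\<^sub>R - \<iota>\<^sub>R L\<^sub>D\<close> shows that the form component of the bracket of \<open>(D, \<iota>\<^sub>D \<mu>)\<close> and
  \<open>(R, \<iota>\<^sub>R \<mu>)\<close> is \<open>\<iota>\<^bsub>[D,R]\<^esub> \<mu> + \<iota>\<^sub>R \<iota>\<^sub>D d\<mu>\<close> (\<open>bracket_form\<close>). The graph is therefore involutive if and only if all
  \<open>\<iota>\<^sub>R \<iota>\<^sub>D d\<mu>\<close> vanish, i.e. \<open>d\<mu> = 0\<close>. The identity \<open>1\<close> of \<open>\<Gamma>(E)\<close> is a derivation that commutes with all others, so
  that \<open>L\<^sub>1\<close> is the identity; for closed \<open>\<mu>\<close> this reads \<open>\<mu> = d \<iota>\<^sub>1 \<mu>\<close> (\<open>euler_homotopy\<close>). As the symbol of \<open>1\<close> is \<open>0\<close>,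
  the form \<open>\<iota>\<^sub>1 \<mu>\<close> takes values in \<open>J\<^sub>n E\<close>.

  Two things have to be in place first. One is that \<open>d\<close> exists: the value of \<open>d_formula\<close> at a point must depend only on
  the values of the derivations there. Here the differential is treated through the recursion \<open>\<iota>\<^sub>D d = L\<^sub>D - d \<iota>\<^sub>D\<close>, on
  maps that take lists of derivations to sections; by induction along this recursion it produces alternating maps that
  are linear over \<open>C\<^sup>\<infinity>(M)\<close> (\<open>tensorial_koszul\<close>), and such maps are pointwise (\<open>tensorial_form\<close>).

  The other is that \<open>\<D>E\<close> has local frames consisting of global derivations (\<open>gauge_frame_exists\<close>). This is where the
  smooth structure enters. From a chart, a trivialisation and a bump function \<open>\<beta>\<close> one obtains global functions, vector
  fields and sections subject to a few algebraic identities, collected in the locale \<open>local_frame\<close>. All identities are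
  multiplied through by powers of \<open>\<beta>\<close>, so that they hold on the whole of \<open>M\<close> and no extension from open
  subsets is needed afterwards. The analytic core is Hadamard's lemma, which gives the expansion of a
  tangent vector in coordinates.\<close>

section \<open>Maps of class \<open>C\<^sup>k\<close>\<close>

lemma has_derivative_cong_open:
  assumes "open T" "x \<in> T" "\<And>y. y \<in> T \<Longrightarrow> f y = g y"
  shows "(f has_derivative f') (at x) \<longleftrightarrow> (g has_derivative f') (at x)"
  using has_derivative_transform_within_open[of f f' x UNIV T g]
    has_derivative_transform_within_open[of g f' x UNIV T f] assms by auto

lemma frechet_derivative_cong_open:
  assumes "open T" "x \<in> T" "\<And>y. y \<in> T \<Longrightarrow> f y = g y"
  shows "frechet_derivative f (at x) = frechet_derivative g (at x)"
  unfolding frechet_derivative_def using has_derivative_cong_open[OF assms] by simp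

lemma Ck_on_SucD:
  assumes "Ck_on (Suc k) T f" "open T" "x \<in> T"
  shows "(f has_derivative frechet_derivative f (at x)) (at x)"
  using assms by (auto simp: differentiable_on_eq_differentiable_at frechet_derivative_works[symmetric])

lemma Ck_on_cong:
  assumes "open T" "\<And>x. x \<in> T \<Longrightarrow> f x = g x"
  shows "Ck_on k T f \<longleftrightarrow> Ck_on k T g"
  using assms(2)
proof (induction k arbitrary: f g)
  case 0
  then show ?case by (auto cong: continuous_on_cong)
next
  case (Suc k)
  have "f differentiable_on T \<longleftrightarrow> g differentiable_on T"
    unfolding differentiable_on_eq_differentiable_at[OF assms(1)] differentiable_def
    using has_derivative_cong_open[OF assms(1)] Suc.prems by blast
  moreover have "Ck_on k T (\<lambda>x. frechet_derivative f (at x) b) \<longleftrightarrow>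
      Ck_on k T (\<lambda>x. frechet_derivative g (at x) b)" for b
    using frechet_derivative_cong_open[OF assms(1) _ Suc.prems] by (intro Suc.IH) simp
  ultimately show ?case by simp
qed

lemma Ck_on_SucI:
  assumes "open T" "\<And>x. x \<in> T \<Longrightarrow> (f has_derivative f' x) (at x)"
    and "\<And>b. b \<in> Basis \<Longrightarrow> Ck_on k T (\<lambda>x. f' x b)"
  shows "Ck_on (Suc k) T f"
proof -
  have "frechet_derivative f (at x) = f' x" if "x \<in> T" for x
    using frechet_derivative_at[OF assms(2)[OF that]] by simp
  then have "Ck_on k T (\<lambda>x. frechet_derivative f (at x) b) \<longleftrightarrow> Ck_on k T (\<lambda>x. f' x b)" for b
    by (intro Ck_on_cong assms) simp
  moreover have "f differentiable_on T"
    using assms by (auto simp: differentiable_on_eq_differentiable_at differentiable_def)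
  ultimately show ?thesis using assms by simp
qed

lemma Ck_on_subset:
  assumes "Ck_on k T f" "open T" "open T'" "T' \<subseteq> T"
  shows "Ck_on k T' f"
  using assms
  by (induction k arbitrary: f)
    (auto intro: continuous_on_subset differentiable_on_subset)

lemma Ck_on_local:
  assumes "open T" "\<And>x. x \<in> T \<Longrightarrow> \<exists>T'. open T' \<and> x \<in> T' \<and> Ck_on k T' f"
  shows "Ck_on k T f"
  using assms(2)
proof (induction k arbitrary: f)
  case 0
  have "isCont f x" if "x \<in> T" for x
    using 0[OF that] continuous_on_eq_continuous_at by auto
  then show ?case by (simp add: continuous_at_imp_continuous_on)
next
  case (Suc k)
  have "f differentiable (at x)" if "x \<in> T" for x
    using Suc.prems[OF that] by (auto simp: differentiable_on_eq_differentiable_at)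
  then have "f differentiable_on T"
    using assms(1) by (simp add: differentiable_on_eq_differentiable_at)
  moreover have "Ck_on k T (\<lambda>x. frechet_derivative f (at x) b)" if "b \<in> Basis" for b
    using Suc.prems that by (intro Suc.IH) fastforce
  ultimately show ?case by simp
qed

lemma Ck_on_SucD_le:
  assumes "open T" "Ck_on (Suc k) T f"
  shows "Ck_on k T f"
  using assms(2)
proof (induction k arbitrary: f)
  case 0
  then show ?case using differentiable_imp_continuous_on by auto
next
  case (Suc k)
  then show ?case using Suc.IH by (subst Ck_on.simps) auto
qed

lemma Ck_on_const: "Ck_on k T (\<lambda>x. c)"
  by (induction k arbitrary: c) auto

lemma Ck_on_linear:
  assumes "bounded_linear L" "open T" "Ck_on k T f"
  shows "Ck_on k T (\<lambda>x. L (f x))"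
  using assms(3)
proof (induction k arbitrary: f)
  case 0
  then show ?case using bounded_linear.continuous_on[OF assms(1)] by simp
next
  case (Suc k)
  show ?case
    by (rule Ck_on_SucI[OF assms(2)])
      (use Suc bounded_linear.has_derivative[OF assms(1) Ck_on_SucD[OF Suc.prems assms(2)]] in auto)
qed

lemma Ck_on_id:
  assumes "bounded_linear L" "open T" shows "Ck_on k T L"
proof (cases k)
  case (Suc l)
  show ?thesis unfolding Suc
    by (rule Ck_on_SucI[OF assms(2) bounded_linear_imp_has_derivative[OF assms(1)] Ck_on_const])
qed (use assms in \<open>simp add: linear_continuous_on\<close>)

lemma Ck_on_add:
  assumes "open T" "Ck_on k T f" "Ck_on k T g"
  shows "Ck_on k T (\<lambda>x. f x + g x)"
  using assms(2,3)
proof (induction k arbitrary: f g)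
  case 0
  then show ?case by (simp add: continuous_on_add)
next
  case (Suc k)
  show ?case
    by (rule Ck_on_SucI[OF assms(1)
          has_derivative_add[OF Ck_on_SucD[OF Suc.prems(1) assms(1)] Ck_on_SucD[OF Suc.prems(2) assms(1)]]])
      (use Suc in auto)
qed

lemma Ck_on_sum:
  assumes "open T" "\<And>i. i \<in> I \<Longrightarrow> Ck_on k T (f i)"
  shows "Ck_on k T (\<lambda>x. \<Sum>i\<in>I. f i x)"
  using assms(2)
  by (induction I rule: infinite_finite_induct) (auto intro: Ck_on_const Ck_on_add[OF assms(1)])

lemma Ck_on_bilinear:
  assumes "bounded_bilinear prd" "open T" "Ck_on k T f" "Ck_on k T g"
  shows "Ck_on k T (\<lambda>x. prd (f x) (g x))"
  using assms(3,4)
proof (induction k arbitrary: f g)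
  case 0
  then show ?case using bounded_bilinear.continuous_on[OF assms(1)] by simp
next
  case (Suc k)
  have "Ck_on k T f" "Ck_on k T g"
    using Suc.prems Ck_on_SucD_le[OF assms(2)] by blast+
  then show ?case
    by (intro Ck_on_SucI[OF assms(2) bounded_bilinear.FDERIV[OF assms(1)
          Ck_on_SucD[OF Suc.prems(1) assms(2)] Ck_on_SucD[OF Suc.prems(2) assms(2)]]]
        Ck_on_add[OF assms(2)]) (use Suc in auto)
qed

lemma Ck_on_direction:
  assumes "open T" "Ck_on (Suc k) T f"
  shows "Ck_on k T (\<lambda>x. frechet_derivative f (at x) v)"
proof -
  have "frechet_derivative f (at x) v = (\<Sum>b\<in>Basis. (v \<bullet> b) *\<^sub>R frechet_derivative f (at x) b)"
    if "x \<in> T" for x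
  proof -
    interpret bounded_linear "frechet_derivative f (at x)"
      using Ck_on_SucD[OF assms(2,1) that] has_derivative_bounded_linear by blast
    have "frechet_derivative f (at x) v = frechet_derivative f (at x) (\<Sum>b\<in>Basis. (v \<bullet> b) *\<^sub>R b)"
      by (simp add: euclidean_representation)
    then show ?thesis by (simp add: sum scaleR)
  qed
  then have "Ck_on k T (\<lambda>x. frechet_derivative f (at x) v) \<longleftrightarrow>
      Ck_on k T (\<lambda>x. \<Sum>b\<in>Basis. (v \<bullet> b) *\<^sub>R frechet_derivative f (at x) b)"
    by (intro Ck_on_cong assms) simp
  also have "\<dots>"
    by (intro Ck_on_sum[OF assms(1)] Ck_on_linear[OF bounded_linear_scaleR_right assms(1)])
      (use assms(2) in simp)
  finally show ?thesis .
qed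

lemma Ck_on_compose:
  fixes g :: "'m::euclidean_space \<Rightarrow> 'n::euclidean_space" and f :: "'n \<Rightarrow> 'b::real_normed_vector"
  assumes "open T" "open S" "Ck_on k T g" "Ck_on k S f" "\<And>x. x \<in> T \<Longrightarrow> g x \<in> S"
  shows "Ck_on k T (\<lambda>x. f (g x))"
  using assms(3,4)
proof (induction k arbitrary: f)
  case 0
  then show ?case using continuous_on_compose2[of S f T g] assms(5) by auto
next
  case (Suc k)
  define f' where "f' y = frechet_derivative f (at y)" for y
  define g' where "g' x = frechet_derivative g (at x)" for x
  have "((\<lambda>x. f (g x)) has_derivative (\<lambda>h. f' (g x) (g' x h))) (at x)" if "x \<in> T" for x
    using has_derivative_compose[OF Ck_on_SucD[OF Suc.prems(1) assms(1) that]
        Ck_on_SucD[OF Suc.prems(2) assms(2) assms(5)[OF that]]]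
    by (simp add: f'_def g'_def)
  moreover have "Ck_on k T (\<lambda>x. f' (g x) (g' x b))" if b: "b \<in> Basis" for b
  proof -
    have "f' (g x) (g' x b) = (\<Sum>c\<in>Basis. (g' x b \<bullet> c) *\<^sub>R f' (g x) c)" if "x \<in> T" for x
    proof -
      interpret bounded_linear "f' (g x)"
        using Ck_on_SucD[OF Suc.prems(2) assms(2) assms(5)[OF that]] has_derivative_bounded_linear
        unfolding f'_def by blast
      have "f' (g x) (g' x b) = f' (g x) (\<Sum>c\<in>Basis. (g' x b \<bullet> c) *\<^sub>R c)"
        by (simp add: euclidean_representation)
      then show ?thesis by (simp add: sum scaleR)
    qed
    then have "Ck_on k T (\<lambda>x. f' (g x) (g' x b)) \<longleftrightarrow>
        Ck_on k T (\<lambda>x. \<Sum>c\<in>Basis. (g' x b \<bullet> c) *\<^sub>R f' (g x) c)"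
      by (intro Ck_on_cong assms) simp
    also have "\<dots>"
      using Suc.prems b Ck_on_SucD_le[OF assms(1)]
      by (intro Ck_on_sum[OF assms(1)] Ck_on_bilinear[OF bounded_bilinear_scaleR assms(1)]
          Ck_on_linear[OF bounded_linear_inner_left assms(1)] Suc.IH) (auto simp: f'_def g'_def)
    finally show ?thesis .
  qed
  ultimately show ?case by (rule Ck_on_SucI[OF assms(1)])
qed

section \<open>A flat function and bump functions\<close>

text \<open>The functions \<open>exp(-1/t) / t\<^sup>j\<close>, extended by \<open>0\<close>. Together they are closed under differentiation, so their smoothness
  follows by one induction over the order, for all \<open>j\<close> at once.\<close>

definition flat :: "nat \<Rightarrow> real \<Rightarrow> real" where
  "flat j t = (if t \<le> 0 then 0 else exp (- inverse t) / t ^ j)"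

lemma flat_tendsto_0: "(flat j \<longlongrightarrow> 0) (at 0)"
proof -
  have "((\<lambda>t. exp (- t) * t ^ j) \<longlongrightarrow> (0::real)) at_top"
    using tendsto_power_div_exp_0[of j] by (simp add: exp_minus divide_inverse mult.commute)
  then have "((\<lambda>t. exp (- inverse t) * inverse t ^ j) \<longlongrightarrow> (0::real)) (at_right 0)"
    using filterlim_compose[OF _ filterlim_inverse_at_top_right] by blast
  moreover have "\<forall>\<^sub>F t in at_right 0. exp (- inverse t) * inverse t ^ j = flat j t"
    using eventually_at_right_less[of "0::real"]
    by eventually_elim (simp add: flat_def divide_inverse power_inverse)
  ultimately have "(flat j \<longlongrightarrow> 0) (at_right 0)" using Lim_transform_eventually by fast
  moreover have "\<forall>\<^sub>F t in at_left 0. 0 = flat j t"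
    using eventually_at_left_real[of "-1" 0] by (auto simp: flat_def elim: eventually_mono)
  then have "(flat j \<longlongrightarrow> 0) (at_left 0)" using Lim_transform_eventually[OF tendsto_const] by fast
  ultimately show ?thesis by (simp add: filterlim_split_at)
qed

lemma flat_has_derivative: "(flat j has_real_derivative flat (j + 2) t - j * flat (Suc j) t) (at t)"
proof -
  consider "t < 0" | "t = 0" | "t > 0" by linarith
  then show ?thesis
  proof cases
    case 1
    have "((\<lambda>t. 0) has_real_derivative flat (j + 2) t - j * flat (Suc j) t) (at t)"
      using 1 by (simp add: flat_def)
    then show ?thesis
      by (rule has_field_derivative_transform_within_open[where S = "{..<0}"]) (use 1 in \<open>auto simp: flat_def\<close>)
  next
    case 2
    have "(\<lambda>h. (flat j (0 + h) - flat j 0) / h) = flat (Suc j)"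
      by (rule ext) (simp add: flat_def)
    then have "(flat j has_real_derivative 0) (at 0)"
      using flat_tendsto_0[of "Suc j"] unfolding DERIV_def by simp
    then show ?thesis using 2 by (simp add: flat_def)
  next
    case 3
    have "((\<lambda>t. exp (- inverse t) / t ^ j) has_real_derivative
        (exp (- inverse t) * (inverse t)\<^sup>2 * t ^ j - exp (- inverse t) * (j * t ^ (j - 1))) / (t ^ j)\<^sup>2) (at t)"
      using 3 by (auto intro!: derivative_eq_intros simp: power2_eq_square field_simps)
    moreover have "(exp (- inverse t) * (inverse t)\<^sup>2 * t ^ j - exp (- inverse t) * (j * t ^ (j - 1))) / (t ^ j)\<^sup>2
        = flat (j + 2) t - j * flat (Suc j) t"
      using 3 by (cases j) (simp_all add: flat_def field_simps power2_eq_square)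
    ultimately have "((\<lambda>t. exp (- inverse t) / t ^ j) has_real_derivative flat (j + 2) t - j * flat (Suc j) t) (at t)"
      by simp
    then show ?thesis
      by (rule has_field_derivative_transform_within_open[where S = "{0<..}"]) (use 3 in \<open>auto simp: flat_def\<close>)
  qed
qed

lemma Ck_on_flat: "Ck_on k UNIV (flat j)"
proof (induction k arbitrary: j)
  case 0
  show ?case using flat_has_derivative DERIV_isCont continuous_at_imp_continuous_on by (metis Ck_on.simps(1))
next
  case (Suc k)
  show ?case
  proof (rule Ck_on_SucI[OF open_UNIV])
    show "(flat j has_derivative (\<lambda>h. (flat (j + 2) t + (- real j) * flat (Suc j) t) * h)) (at t)" for t
      using flat_has_derivative[of j t] by (simp add: has_field_derivative_def)
    show "Ck_on k UNIV (\<lambda>t. (flat (j + 2) t + (- real j) * flat (Suc j) t) * b)" for b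
      by (intro Ck_on_linear[OF bounded_linear_mult_left] Ck_on_add
          Ck_on_linear[OF bounded_linear_mult_right]) (auto intro: Suc)
  qed
qed

definition bump :: "'m::euclidean_space \<Rightarrow> real \<Rightarrow> 'm \<Rightarrow> real" where
  "bump c r y = flat 0 (r\<^sup>2 - (norm (y - c))\<^sup>2)"

lemma bump_nonzero_iff:
  assumes "r > 0" shows "bump c r y \<noteq> 0 \<longleftrightarrow> y \<in> ball c r"
proof -
  have "(norm (y - c))\<^sup>2 < r\<^sup>2 \<longleftrightarrow> norm (y - c) < r"
    using assms power_mono_iff[of r "norm (y - c)" 2] by (simp add: not_le[symmetric] del: power_mono_iff)
  then show ?thesis by (auto simp: bump_def flat_def dist_norm norm_minus_commute)
qed

lemma Ck_on_bump: "open T \<Longrightarrow> Ck_on k T (bump c r)"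
  unfolding bump_def
proof (rule Ck_on_compose[OF _ open_UNIV _ Ck_on_flat])
  assume T: "open T"
  have "Ck_on k T (\<lambda>y. y + - c)"
    by (intro Ck_on_add[OF T] Ck_on_id[OF bounded_linear_ident T] Ck_on_const)
  then have "Ck_on k T (\<lambda>y. (y - c) \<bullet> (y - c))"
    using Ck_on_bilinear[OF bounded_bilinear_inner T] by simp
  then have "Ck_on k T (\<lambda>y. r\<^sup>2 + - ((y - c) \<bullet> (y - c)))"
    by (intro Ck_on_add[OF T] Ck_on_const Ck_on_linear[OF bounded_linear_minus[OF bounded_linear_ident] T])
  then show "Ck_on k T (\<lambda>y. r\<^sup>2 - (norm (y - c))\<^sup>2)" by (simp add: power2_norm_eq_inner)
qed auto

section \<open>Hadamard's lemma\<close>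

text \<open>Differentiation of \<open>F (x + t (y - x))\<close> in \<open>y\<close> produces a factor \<open>t\<close>. With the powers of \<open>t\<close> in the
  integrand the integrals are closed under differentiation, which is what the induction in the next lemma needs.\<close>

lemma line_integral_has_derivative:
  fixes F :: "'m::euclidean_space \<Rightarrow> real"
  assumes "open S" "convex S" "x \<in> S" "Ck_on 1 S F" "y \<in> S"
  shows "((\<lambda>y. integral (cbox 0 1) (\<lambda>t. t ^ m * F (x + t *\<^sub>R (y - x)))) has_derivative
    (\<lambda>h. integral (cbox 0 1) (\<lambda>t. t ^ Suc m * frechet_derivative F (at (x + t *\<^sub>R (y - x))) h))) (at y)"
proof -
  define p where "p y t = x + t *\<^sub>R (y - x)" for y :: 'm and t :: real
  define F' where "F' z = frechet_derivative F (at z)" for z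
  define A where "A y t = Blinfun (\<lambda>h. t ^ Suc m * F' (p y t) h)" for y and t :: real
  have p: "p y t \<in> S" if "y \<in> S" "t \<in> cbox 0 1" for y t
  proof -
    have "p y t = (1 - t) *\<^sub>R x + t *\<^sub>R y"
      by (simp add: p_def algebra_simps)
    then show ?thesis using assms(2,3) that by (auto intro: convexD_alt)
  qed
  have F': "(F has_derivative F' z) (at z)" if "z \<in> S" for z
    unfolding F'_def using assms(1,4) that by (intro Ck_on_SucD[of 0 S]) simp_all
  have bl: "bounded_linear (F' z)" if "z \<in> S" for z
    using F'[OF that] by (rule has_derivative_bounded_linear)
  have A: "blinfun_apply (A y t) h = t ^ Suc m * F' (p y t) h" if "y \<in> S" "t \<in> cbox 0 1" for y t h
    unfolding A_def using bl[OF p[OF that]]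
    by (subst bounded_linear_Blinfun_apply) (auto intro: bounded_linear_const_mult)
  have cF: "continuous_on S F"
    using Ck_on_SucD_le[OF assms(1), of 0 F] assms(4) by simp
  have cF': "continuous_on S (\<lambda>z. F' z i)" if "i \<in> Basis" for i
    using assms(4) that by (simp add: F'_def)
  have der: "((\<lambda>y. t ^ m * F (p y t)) has_derivative blinfun_apply (A y t)) (at y within S)"
    if "y \<in> S" "t \<in> cbox 0 1" for y t
  proof -
    have "((\<lambda>y. p y t) has_derivative (\<lambda>h. t *\<^sub>R h)) (at y within S)"
      unfolding p_def by (auto intro!: derivative_eq_intros)
    then have "((\<lambda>y. F (p y t)) has_derivative (\<lambda>h. F' (p y t) (t *\<^sub>R h))) (at y within S)"
      using has_derivative_compose[where g = F and f = "\<lambda>y. p y t", OF _ F'[OF p[OF that]]] by blast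
    then have "((\<lambda>y. t ^ m * F (p y t)) has_derivative (\<lambda>h. t ^ m * F' (p y t) (t *\<^sub>R h))) (at y within S)"
      by (rule has_derivative_mult_right)
    moreover have "(\<lambda>h. t ^ m * F' (p y t) (t *\<^sub>R h)) = blinfun_apply (A y t)"
      using linear_simps(5)[OF bl[OF p[OF that]]] by (auto simp: A[OF that])
    ultimately show ?thesis by simp
  qed
  have "((\<lambda>y. integral (cbox 0 1) (\<lambda>t. t ^ m * F (p y t))) has_derivative
      blinfun_apply (integral (cbox 0 1) (A y))) (at y within S)"
  proof (rule leibniz_rule[OF der _ _ assms(5,2)])
    show "(\<lambda>t. t ^ m * F (p y t)) integrable_on cbox 0 1" if "y \<in> S" for y
      by (intro integrable_continuous continuous_intros continuous_on_compose2[OF cF])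
        (auto simp: p_def intro!: continuous_intros p[OF that, unfolded p_def])
    show "continuous_on (S \<times> cbox 0 1) (\<lambda>(y, t). A y t)"
    proof (rule continuous_on_blinfun_componentwise)
      fix i :: 'm assume i: "i \<in> Basis"
      have "continuous_on (S \<times> cbox 0 1) (\<lambda>z. snd z ^ Suc m * F' (p (fst z) (snd z)) i)"
        by (intro continuous_intros continuous_on_compose2[OF cF'[OF i]])
          (auto simp: p_def intro!: continuous_intros p[unfolded p_def])
      then show "continuous_on (S \<times> cbox 0 1) (\<lambda>z. blinfun_apply (case z of (y, t) \<Rightarrow> A y t) i)"
        by (rule continuous_on_eq) (use A in \<open>auto simp: split_beta\<close>)
    qed
  qed
  moreover have "blinfun_apply (integral (cbox 0 1) (A y)) h =
      integral (cbox 0 1) (\<lambda>t. t ^ Suc m * F' (p y t) h)" for h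
  proof -
    have "continuous_on (cbox 0 1) (A y)"
    proof (rule continuous_on_blinfun_componentwise)
      fix i :: 'm assume i: "i \<in> Basis"
      have "continuous_on (cbox 0 1) (\<lambda>t. t ^ Suc m * F' (p y t) i)"
        by (intro continuous_intros continuous_on_compose2[OF cF'[OF i]])
          (auto simp: p_def intro!: continuous_intros p[OF assms(5), unfolded p_def])
      then show "continuous_on (cbox 0 1) (\<lambda>t. blinfun_apply (A y t) i)"
        by (rule continuous_on_eq) (use A[OF assms(5)] in auto)
    qed
    then have "blinfun_apply (integral (cbox 0 1) (A y)) h = integral (cbox 0 1) (\<lambda>t. blinfun_apply (A y t) h)"
      by (intro blinfun_apply_integral integrable_continuous)
    also have "\<dots> = integral (cbox 0 1) (\<lambda>t. t ^ Suc m * F' (p y t) h)"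
      by (rule integral_cong) (use A[OF assms(5)] in auto)
    finally show ?thesis .
  qed
  ultimately show ?thesis
    unfolding p_def F'_def using at_within_open[OF assms(5,1)]
    by (metis (no_types, lifting) ext)
qed

lemma Ck_on_line_integral:
  fixes F :: "'m::euclidean_space \<Rightarrow> real"
  assumes "open S" "convex S" "x \<in> S" "\<And>k. Ck_on k S F"
  shows "Ck_on k S (\<lambda>y. integral (cbox 0 1) (\<lambda>t. t ^ m * F (x + t *\<^sub>R (y - x))))"
  using assms(4)
proof (induction k arbitrary: F m)
  case 0
  show ?case
    using line_integral_has_derivative[OF assms(1-3) 0]
    by (auto intro!: continuous_at_imp_continuous_on has_derivative_continuous)
next
  case (Suc k)
  show ?case
  proof (rule Ck_on_SucI[OF assms(1) line_integral_has_derivative[OF assms(1-3) Suc.prems]])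
    fix b :: 'm assume b: "b \<in> Basis"
    have "Ck_on l S (\<lambda>z. frechet_derivative F (at z) b)" for l
      using Suc.prems[of "Suc l"] b by simp
    then show "Ck_on k S (\<lambda>y. integral (cbox 0 1)
        (\<lambda>t. t ^ Suc m * frechet_derivative F (at (x + t *\<^sub>R (y - x))) b))"
      by (rule Suc.IH)
  qed
qed

text \<open>The fundamental theorem along the segment from \<open>x\<close> to \<open>y\<close>. The functions \<open>g\<close> are indexed by
  all vectors, because the expansion will be used for a basis of a subspace only.\<close>

lemma Hadamard:
  fixes F :: "'m::euclidean_space \<Rightarrow> real"
  assumes "open S" "convex S" "x \<in> S" "\<And>k. Ck_on k S F"
  obtains g where "\<And>k v. Ck_on k S (g v)" "\<And>v. g v x = frechet_derivative F (at x) v"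
    "\<And>y I c. y \<in> S \<Longrightarrow> finite I \<Longrightarrow> y - x = (\<Sum>i\<in>I. c i *\<^sub>R i) \<Longrightarrow> F y = F x + (\<Sum>i\<in>I. c i * g i y)"
proof
  define F' where "F' z = frechet_derivative F (at z)" for z
  define g where "g v y = integral (cbox 0 1) (\<lambda>t. t ^ 0 * F' (x + t *\<^sub>R (y - x)) v)" for v y
  have CF': "Ck_on k S (\<lambda>z. F' z v)" for k v
    unfolding F'_def using Ck_on_direction[OF assms(1,4)] .
  show "Ck_on k S (g v)" for k v
    unfolding g_def by (rule Ck_on_line_integral[OF assms(1-3) CF'])
  show "g v x = frechet_derivative F (at x) v" for v
    by (simp add: g_def F'_def)
  fix y I and c :: "'m \<Rightarrow> real" assume y: "y \<in> S" "finite I" "y - x = (\<Sum>i\<in>I. c i *\<^sub>R i)"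
  have p: "x + t *\<^sub>R (y - x) \<in> S" if "t \<in> {0..1}" for t
  proof -
    have "x + t *\<^sub>R (y - x) = (1 - t) *\<^sub>R x + t *\<^sub>R y"
      by (simp add: algebra_simps)
    then show ?thesis using assms(2,3) that y by (auto intro: convexD_alt)
  qed
  have F': "(F has_derivative F' z) (at z)" if "z \<in> S" for z
    unfolding F'_def using assms(1) assms(4)[of 1] that by (intro Ck_on_SucD[of 0 S]) simp_all
  have lin: "F' z (y - x) = (\<Sum>i\<in>I. c i * F' z i)" if "z \<in> S" for z
  proof -
    interpret bounded_linear "F' z" using F'[OF that] by (rule has_derivative_bounded_linear)
    show ?thesis by (simp add: y(3) sum scaleR)
  qed
  have int: "(\<lambda>t. F' (x + t *\<^sub>R (y - x)) i) integrable_on {0..1}" for i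
  proof (rule integrable_continuous_interval, rule continuous_on_compose2[where g = "\<lambda>z. F' z i"])
    show "continuous_on S (\<lambda>z. F' z i)" using CF'[of 0 i] by simp
    show "continuous_on {0..1} (\<lambda>t. x + t *\<^sub>R (y - x))" by (intro continuous_intros)
  qed (use p in auto)
  have "((\<lambda>t. F' (x + t *\<^sub>R (y - x)) (y - x)) has_integral F (x + 1 *\<^sub>R (y - x)) - F (x + 0 *\<^sub>R (y - x))) {0..1}"
  proof (rule fundamental_theorem_of_calculus)
    fix t :: real assume t: "t \<in> {0..1}"
    have "((\<lambda>t. x + t *\<^sub>R (y - x)) has_derivative (\<lambda>h. h *\<^sub>R (y - x))) (at t within {0..1})"
      by (auto intro!: derivative_eq_intros)
    then have "((\<lambda>t. F (x + t *\<^sub>R (y - x))) has_derivative (\<lambda>h. F' (x + t *\<^sub>R (y - x)) (h *\<^sub>R (y - x)))) (at t within {0..1})"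
      by (rule has_derivative_compose[where g = F and f = "\<lambda>t. x + t *\<^sub>R (y - x)", OF _ F'[OF p[OF t]]])
    then show "((\<lambda>t. F (x + t *\<^sub>R (y - x))) has_vector_derivative F' (x + t *\<^sub>R (y - x)) (y - x)) (at t within {0..1})"
      using linear_simps(5)[OF has_derivative_bounded_linear[OF F'[OF p[OF t]]]]
      by (simp add: has_vector_derivative_def)
  qed simp
  from integral_unique[OF this]
  have "F y - F x = integral {0..1} (\<lambda>t. F' (x + t *\<^sub>R (y - x)) (y - x))" by simp
  also have "\<dots> = integral {0..1} (\<lambda>t. \<Sum>i\<in>I. c i * F' (x + t *\<^sub>R (y - x)) i)"
    by (rule integral_cong) (use lin p in auto)
  also have "\<dots> = (\<Sum>i\<in>I. c i * g i y)"
    using int y(2) by (subst integral_sum) (auto simp: g_def intro: integrable_on_mult_right)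
  finally show "F y = F x + (\<Sum>i\<in>I. c i * g i y)" by simp
qed

section \<open>Smoothness on arbitrary subsets\<close>

lemma smooth_on_open:
  assumes "open T" "\<And>k. Ck_on k T f"
  shows "smooth_on T f"
  unfolding smooth_on_def using assms by blast

lemma smooth_onE:
  assumes "smooth_on S f" "x \<in> S"
  obtains T g where "open T" "x \<in> T" "\<And>k. Ck_on k T g" "\<And>y. y \<in> S \<Longrightarrow> y \<in> T \<Longrightarrow> f y = g y"
proof -
  obtain T g where "open T \<and> x \<in> T \<and> (\<forall>k. Ck_on k T g) \<and> (\<forall>y\<in>S \<inter> T. f y = g y)"
    using assms unfolding smooth_on_def by blast
  then show ?thesis using that[of T g] by simp
qed

lemma smooth_on_imp_Ck_on:
  assumes "open T" "smooth_on T f"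
  shows "Ck_on k T f"
proof (rule Ck_on_local[OF assms(1)])
  fix x assume "x \<in> T"
  obtain T' g where g: "open T'" "x \<in> T'" "\<And>k. Ck_on k T' g" "\<And>y. y \<in> T \<Longrightarrow> y \<in> T' \<Longrightarrow> f y = g y"
    using smooth_onE[OF assms(2) \<open>x \<in> T\<close>] by blast
  have "Ck_on k (T \<inter> T') f \<longleftrightarrow> Ck_on k (T \<inter> T') g"
    by (intro Ck_on_cong) (use g assms in auto)
  then show "\<exists>T'. open T' \<and> x \<in> T' \<and> Ck_on k T' f"
    using g assms \<open>x \<in> T\<close> Ck_on_subset[OF g(3,1), of "T \<inter> T'"] by (intro exI[of _ "T \<inter> T'"]) auto
qed

lemma smooth_on_subset:
  assumes "smooth_on S f" "S' \<subseteq> S"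
  shows "smooth_on S' f"
  unfolding smooth_on_def
proof
  fix x assume "x \<in> S'"
  then have "x \<in> S" using assms(2) by blast
  then obtain T g where "open T" "x \<in> T" "\<And>k. Ck_on k T g" "\<And>y. y \<in> S \<Longrightarrow> y \<in> T \<Longrightarrow> f y = g y"
    using smooth_onE[OF assms(1)] by blast
  then show "\<exists>T g. open T \<and> x \<in> T \<and> (\<forall>k. Ck_on k T g) \<and> (\<forall>y\<in>S' \<inter> T. f y = g y)"
    using assms(2) by (intro exI[of _ T] exI[of _ g]) auto
qed

lemma smooth_on_cong: "(\<And>x. x \<in> S \<Longrightarrow> f x = g x) \<Longrightarrow> smooth_on S f \<longleftrightarrow> smooth_on S g"
  unfolding smooth_on_def by auto

lemma smooth_on_const: "smooth_on S (\<lambda>x. c)"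
  unfolding smooth_on_def using Ck_on_const by blast

lemma smooth_on_lift:
  fixes f :: "'m::euclidean_space \<Rightarrow> 'b::real_normed_vector"
  assumes F: "\<And>k (T :: 'm set) g h. open T \<Longrightarrow> Ck_on k T g \<Longrightarrow> Ck_on k T h \<Longrightarrow> Ck_on k T (\<lambda>x. F (g x) (h x))"
    and "smooth_on S f" "smooth_on S f'"
  shows "smooth_on S (\<lambda>x. F (f x) (f' x))"
  unfolding smooth_on_def
proof
  fix x assume x: "x \<in> S"
  obtain T g where g: "open T" "x \<in> T" "\<And>k. Ck_on k T g" "\<And>y. y \<in> S \<Longrightarrow> y \<in> T \<Longrightarrow> f y = g y"
    using smooth_onE[OF assms(2) x] by blast
  obtain T' g' where g': "open T'" "x \<in> T'" "\<And>k. Ck_on k T' g'" "\<And>y. y \<in> S \<Longrightarrow> y \<in> T' \<Longrightarrow> f' y = g' y"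
    using smooth_onE[OF assms(3) x] by blast
  have "Ck_on k (T \<inter> T') (\<lambda>y. F (g y) (g' y))" for k
    by (rule F) (use g g' in \<open>auto intro: Ck_on_subset\<close>)
  then show "\<exists>T g. open T \<and> x \<in> T \<and> (\<forall>k. Ck_on k T g) \<and> (\<forall>y\<in>S \<inter> T. F (f y) (f' y) = g y)"
    using g g' by (intro exI[of _ "T \<inter> T'"] exI[of _ "\<lambda>y. F (g y) (g' y)"]) (auto intro: open_Int)
qed

lemma smooth_on_linear: "bounded_linear L \<Longrightarrow> smooth_on S f \<Longrightarrow> smooth_on S (\<lambda>x. L (f x))"
  using smooth_on_lift[of "\<lambda>a b. L a" S f f] Ck_on_linear by blast

lemma smooth_on_bilinear:
  "bounded_bilinear prd \<Longrightarrow> smooth_on S f \<Longrightarrow> smooth_on S g \<Longrightarrow> smooth_on S (\<lambda>x. prd (f x) (g x))"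
  by (rule smooth_on_lift[of prd]) (rule Ck_on_bilinear)

lemma smooth_on_add: "smooth_on S f \<Longrightarrow> smooth_on S g \<Longrightarrow> smooth_on S (\<lambda>x. f x + g x)"
  by (rule smooth_on_lift[of "(+)"]) (rule Ck_on_add)

lemma smooth_on_compose:
  fixes g :: "'m::euclidean_space \<Rightarrow> 'n::euclidean_space" and f :: "'n \<Rightarrow> 'b::real_normed_vector"
  assumes "smooth_on S g" "smooth_on S' f" "\<And>x. x \<in> S \<Longrightarrow> g x \<in> S'"
  shows "smooth_on S (\<lambda>x. f (g x))"
  unfolding smooth_on_def
proof
  fix x assume x: "x \<in> S"
  obtain T h where h: "open T" "x \<in> T" "\<And>k. Ck_on k T h" "\<And>y. y \<in> S \<Longrightarrow> y \<in> T \<Longrightarrow> g y = h y"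
    using smooth_onE[OF assms(1) x] by blast
  obtain T' h' where h': "open T'" "g x \<in> T'" "\<And>k. Ck_on k T' h'" "\<And>y. y \<in> S' \<Longrightarrow> y \<in> T' \<Longrightarrow> f y = h' y"
    using smooth_onE[OF assms(2) assms(3)[OF x]] by blast
  define W where "W = T \<inter> h -` T'"
  have "continuous_on T h" using h(3)[of 0] by simp
  then have W: "open W" unfolding W_def using h(1) h'(1) continuous_open_preimage by metis
  have "x \<in> W" using h(2) h'(2) h(4)[OF x h(2)] by (simp add: W_def)
  moreover have "Ck_on k W (\<lambda>y. h' (h y))" for k
  proof (rule Ck_on_compose[OF W h'(1) _ h'(3)])
    show "Ck_on k W h" by (rule Ck_on_subset[OF h(3,1) W]) (simp add: W_def)
  qed (simp add: W_def)
  moreover have "\<forall>y\<in>S \<inter> W. f (g y) = h' (h y)"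
  proof
    fix y assume "y \<in> S \<inter> W"
    then have "y \<in> S" "y \<in> T" "h y \<in> T'" by (auto simp: W_def)
    then show "f (g y) = h' (h y)" using h(4)[of y] h'(4)[of "g y"] assms(3)[of y] by simp
  qed
  ultimately show "\<exists>T h. open T \<and> x \<in> T \<and> (\<forall>k. Ck_on k T h) \<and> (\<forall>y\<in>S \<inter> T. f (g y) = h y)"
    using W by (intro exI[of _ W] exI[of _ "\<lambda>y. h' (h y)"]) auto
qed

section \<open>Linear maps on subspaces\<close>

lemma lin_on_sum:
  assumes "lin_on V f" "subspace V" "\<And>i. i \<in> I \<Longrightarrow> x i \<in> V"
  shows "f (\<Sum>i\<in>I. c i *\<^sub>R x i) = (\<Sum>i\<in>I. c i *\<^sub>R f (x i))"
proof -
  have "f 0 = 0"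
    using assms(1,2) subspace_0[OF assms(2)] unfolding lin_on_def by (metis scaleR_zero_left)
  then show ?thesis
    using assms(3)
    by (induction I rule: infinite_finite_induct)
      (use assms(1,2) in \<open>auto simp: lin_on_def subspace_sum subspace_scale\<close>)
qed

lemma lin_on_0: "lin_on V f \<Longrightarrow> subspace V \<Longrightarrow> f 0 = 0"
  using lin_on_sum[of V f "{}"] by simp

lemma lin_on_diff: "lin_on V f \<Longrightarrow> subspace V \<Longrightarrow> x \<in> V \<Longrightarrow> y \<in> V \<Longrightarrow> f (x - y) = f x - f y"
  unfolding lin_on_def by (metis add_diff_cancel diff_add_cancel subspace_diff)

lemma lin_on_addD: "lin_on V f \<Longrightarrow> x \<in> V \<Longrightarrow> y \<in> V \<Longrightarrow> f (x + y) = f x + f y"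
  and lin_on_scaleD: "lin_on V f \<Longrightarrow> x \<in> V \<Longrightarrow> f (a *\<^sub>R x) = a *\<^sub>R f x"
  by (auto simp: lin_on_def)

section \<open>Smooth maps on a manifold\<close>

context
  fixes E :: "('a::{t2_space,second_countable_topology}, 'm::euclidean_space, 'v, 'f) vbundle"
  assumes manifold: "smooth_manifold E"
begin

lemma chartD:
  assumes "(U, \<phi>) \<in> charts E"
  shows "open U" "\<And>x. x \<in> U \<Longrightarrow> inv_into U \<phi> (\<phi> x) = x" "continuous_on U \<phi>"
    "continuous_on (\<phi> ` U) (inv_into U \<phi>)" "openin (top_of_set (model E)) (\<phi> ` U)"
    "\<And>x. x \<in> U \<Longrightarrow> \<phi> x \<in> model E" "subspace (model E)"
proof -
  have *: "open U" "openin (top_of_set (model E)) (\<phi> ` U)" "homeomorphism U (\<phi> ` U) \<phi> (inv_into U \<phi>)"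
    "subspace (model E)"
    using manifold assms unfolding smooth_manifold_def by auto
  show "open U" "openin (top_of_set (model E)) (\<phi> ` U)" "subspace (model E)" by fact+
  show "\<And>x. x \<in> U \<Longrightarrow> inv_into U \<phi> (\<phi> x) = x" "continuous_on U \<phi>" "continuous_on (\<phi> ` U) (inv_into U \<phi>)"
    using *(3) by (auto simp: homeomorphism_def)
  show "\<And>x. x \<in> U \<Longrightarrow> \<phi> x \<in> model E"
    using openin_imp_subset[OF *(2)] by auto
qed

lemma smooth_map_onI:
  assumes "\<And>U \<phi>. (U, \<phi>) \<in> charts E \<Longrightarrow> smooth_on (\<phi> ` (U \<inter> W)) (\<lambda>y. f (inv_into U \<phi> y))"
  shows "smooth_map_on E W f"
  using assms by (auto simp: smooth_map_on_def comp_def)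

lemma smooth_map_onD:
  assumes "smooth_map_on E W f" "(U, \<phi>) \<in> charts E"
  shows "smooth_on (\<phi> ` (U \<inter> W)) (\<lambda>y. f (inv_into U \<phi> y))"
  using assms by (auto simp: smooth_map_on_def comp_def)

lemma smooth_map_on_subset: "smooth_map_on E W f \<Longrightarrow> W' \<subseteq> W \<Longrightarrow> smooth_map_on E W' f"
  by (rule smooth_map_onI, drule (1) smooth_map_onD, erule smooth_on_subset) auto

lemma smooth_map_on_cong:
  assumes "\<And>x. x \<in> W \<Longrightarrow> f x = g x" "smooth_map_on E W f"
  shows "smooth_map_on E W g"
proof (rule smooth_map_onI)
  fix U \<phi> assume U: "(U, \<phi>) \<in> charts E"
  have "smooth_on (\<phi> ` (U \<inter> W)) (\<lambda>y. f (inv_into U \<phi> y)) \<longleftrightarrow> smooth_on (\<phi> ` (U \<inter> W)) (\<lambda>y. g (inv_into U \<phi> y))"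
    by (rule smooth_on_cong) (use assms(1) chartD(2)[OF U] in auto)
  then show "smooth_on (\<phi> ` (U \<inter> W)) (\<lambda>y. g (inv_into U \<phi> y))"
    using smooth_map_onD[OF assms(2) U] by simp
qed

lemma smooth_map_on_const: "smooth_map_on E W (\<lambda>x. c)"
  by (rule smooth_map_onI) (rule smooth_on_const)

lemma smooth_map_on_add: "smooth_map_on E W f \<Longrightarrow> smooth_map_on E W g \<Longrightarrow> smooth_map_on E W (\<lambda>x. f x + g x)"
  by (rule smooth_map_onI) (rule smooth_on_add; erule (1) smooth_map_onD)

lemma smooth_map_on_linear:
  "bounded_linear L \<Longrightarrow> smooth_map_on E W f \<Longrightarrow> smooth_map_on E W (\<lambda>x. L (f x))"
  by (rule smooth_map_onI) (erule smooth_on_linear, erule (1) smooth_map_onD)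

lemma smooth_map_on_bilinear:
  "bounded_bilinear prd \<Longrightarrow> smooth_map_on E W f \<Longrightarrow> smooth_map_on E W g \<Longrightarrow>
    smooth_map_on E W (\<lambda>x. prd (f x) (g x))"
  by (rule smooth_map_onI) (erule smooth_on_bilinear; erule (1) smooth_map_onD)

text \<open>Transition maps are smooth, so smoothness in one chart implies it in all others.\<close>

lemma smooth_map_on_chart:
  assumes U: "(U, \<phi>) \<in> charts E" and W: "W \<subseteq> U"
    and f: "smooth_on (\<phi> ` W) (\<lambda>y. f (inv_into U \<phi> y))"
  shows "smooth_map_on E W f"
proof (rule smooth_map_onI)
  fix U' \<phi>' assume U': "(U', \<phi>') \<in> charts E"
  have "smooth_on (\<phi>' ` (U' \<inter> U)) (\<phi> \<circ> inv_into U' \<phi>')"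
    using manifold U U' unfolding smooth_manifold_def by fast
  then have "smooth_on (\<phi>' ` (U' \<inter> W)) (\<lambda>y. \<phi> (inv_into U' \<phi>' y))"
    unfolding comp_def by (rule smooth_on_subset) (use W in auto)
  moreover have "\<phi> (inv_into U' \<phi>' y) \<in> \<phi> ` W" if "y \<in> \<phi>' ` (U' \<inter> W)" for y
    using that chartD(2)[OF U'] by auto
  ultimately have "smooth_on (\<phi>' ` (U' \<inter> W)) (\<lambda>y. f (inv_into U \<phi> (\<phi> (inv_into U' \<phi>' y))))"
    using smooth_on_compose[OF _ f] by blast
  moreover have "inv_into U \<phi> (\<phi> (inv_into U' \<phi>' y)) = inv_into U' \<phi>' y" if "y \<in> \<phi>' ` (U' \<inter> W)" for y
    using that W chartD(2)[OF U'] chartD(2)[OF U] by auto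
  ultimately show "smooth_on (\<phi>' ` (U' \<inter> W)) (\<lambda>y. f (inv_into U' \<phi>' y))"
    using smooth_on_cong[of "\<phi>' ` (U' \<inter> W)" "\<lambda>y. f (inv_into U \<phi> (\<phi> (inv_into U' \<phi>' y)))"] by simp
qed

lemma chart_open_image:
  assumes U: "(U, \<phi>) \<in> charts E" and "open W" "W \<subseteq> U"
  obtains T where "open T" "\<phi> ` W = \<phi> ` U \<inter> T"
proof -
  have "openin (top_of_set (\<phi> ` U)) (\<phi> ` U \<inter> inv_into U \<phi> -` W)"
    using continuous_openin_preimage_gen[OF chartD(4)[OF U] assms(2)] .
  moreover have "\<phi> ` U \<inter> inv_into U \<phi> -` W = \<phi> ` W"
    using assms(3) chartD(2)[OF U] by force
  ultimately show ?thesis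
    using that unfolding openin_open by auto
qed

lemma smooth_map_on_local:
  assumes "\<And>q. q \<in> W \<Longrightarrow> \<exists>W'. open W' \<and> q \<in> W' \<and> smooth_map_on E (W' \<inter> W) f"
  shows "smooth_map_on E W f"
proof (rule smooth_map_onI)
  fix U \<phi> assume U: "(U, \<phi>) \<in> charts E"
  show "smooth_on (\<phi> ` (U \<inter> W)) (\<lambda>y. f (inv_into U \<phi> y))"
    unfolding smooth_on_def
  proof
    fix y assume "y \<in> \<phi> ` (U \<inter> W)"
    then obtain q where q: "q \<in> U" "q \<in> W" "y = \<phi> q" by auto
    obtain W' where W': "open W'" "q \<in> W'" "smooth_map_on E (W' \<inter> W) f" using assms q by blast
    have "y \<in> \<phi> ` (U \<inter> (W' \<inter> W))" using q W' by auto
    then obtain T g where T: "open T" "y \<in> T" "\<And>k. Ck_on k T g"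
        "\<And>z. z \<in> \<phi> ` (U \<inter> (W' \<inter> W)) \<Longrightarrow> z \<in> T \<Longrightarrow> f (inv_into U \<phi> z) = g z"
      using smooth_onE[OF smooth_map_onD[OF W'(3) U]] by blast
    obtain T' where T': "open T'" "\<phi> ` (U \<inter> W') = \<phi> ` U \<inter> T'"
      using chart_open_image[OF U, of "U \<inter> W'"] chartD(1)[OF U] W'(1) by blast
    have y: "y \<in> T \<inter> T'" using T(2) T'(2) q W'(2) by auto
    have eq: "f (inv_into U \<phi> z) = g z" if z: "z \<in> \<phi> ` (U \<inter> W) \<inter> (T \<inter> T')" for z
    proof -
      obtain x where x: "x \<in> U" "x \<in> W" "z = \<phi> x" using z by auto
      have "z \<in> \<phi> ` (U \<inter> W')" using T'(2) z by auto
      then obtain x' where "x' \<in> U" "x' \<in> W'" "z = \<phi> x'" by auto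
      then have "x \<in> W'" using x chartD(2)[OF U] by metis
      then show ?thesis using T(4) x z by auto
    qed
    show "\<exists>T g. open T \<and> y \<in> T \<and> (\<forall>k. Ck_on k T g) \<and> (\<forall>z\<in>\<phi> ` (U \<inter> W) \<inter> T. f (inv_into U \<phi> z) = g z)"
      using y eq Ck_on_subset[OF T(3,1) open_Int[OF T(1) T'(1)]]
      by (intro exI[of _ "T \<inter> T'"] exI[of _ g]) (simp add: open_Int[OF T(1) T'(1)])
  qed
qed

text \<open>The open sets \<open>W\<close> and \<open>- K\<close> cover the manifold; on the first the function is a product of smooth ones, on the second
  it vanishes. Coordinates, partial derivatives and local frames are made global in this way.\<close>

lemma extend_by_bump:
  fixes f :: "'a \<Rightarrow> 'b::real_normed_vector"
  assumes "smooth_map_on E UNIV \<beta>" "open W" "closed K" "K \<subseteq> W" "\<And>x. x \<notin> K \<Longrightarrow> \<beta> x = (0::real)"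
    and "open V" "smooth_map_on E (W \<inter> V) f"
  shows "smooth_map_on E V (\<lambda>x. if x \<in> W then \<beta> x *\<^sub>R f x else 0)"
proof (rule smooth_map_on_local)
  fix q assume "q \<in> V"
  show "\<exists>W'. open W' \<and> q \<in> W' \<and> smooth_map_on E (W' \<inter> V) (\<lambda>x. if x \<in> W then \<beta> x *\<^sub>R f x else 0)"
  proof (cases "q \<in> W")
    case True
    have "smooth_map_on E (W \<inter> V) \<beta>" using assms(1) by (rule smooth_map_on_subset) auto
    from smooth_map_on_bilinear[OF bounded_bilinear_scaleR this assms(7)]
    have "smooth_map_on E (W \<inter> V) (\<lambda>x. if x \<in> W then \<beta> x *\<^sub>R f x else 0)"
      by (rule smooth_map_on_cong[rotated]) simp
    then show ?thesis using True assms(2) by blast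
  next
    case False
    have "smooth_map_on E (- K \<inter> V) (\<lambda>x. if x \<in> W then \<beta> x *\<^sub>R f x else 0)"
      by (rule smooth_map_on_cong[OF _ smooth_map_on_const[of _ 0]]) (use assms(5) in auto)
    then show ?thesis using False assms(3,4) by (intro exI[of _ "- K"]) (auto simp: open_Compl)
  qed
qed

end

lemma Cinf_const: "smooth_manifold E \<Longrightarrow> (\<lambda>x. c) \<in> Cinf E"
  by (simp add: Cinf_def smooth_map_on_const)

lemma Cinf_add: "smooth_manifold E \<Longrightarrow> f \<in> Cinf E \<Longrightarrow> g \<in> Cinf E \<Longrightarrow> (\<lambda>x. f x + g x) \<in> Cinf E"
  by (simp add: Cinf_def smooth_map_on_add)

lemma Cinf_mult: "smooth_manifold E \<Longrightarrow> f \<in> Cinf E \<Longrightarrow> g \<in> Cinf E \<Longrightarrow> (\<lambda>x. f x * g x) \<in> Cinf E"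
  by (simp add: Cinf_def smooth_map_on_bilinear[OF _ bounded_bilinear_mult])

lemma Cinf_cmult: "smooth_manifold E \<Longrightarrow> f \<in> Cinf E \<Longrightarrow> (\<lambda>x. c * f x) \<in> Cinf E"
  by (rule Cinf_mult[OF _ Cinf_const])

lemma Cinf_minus: "smooth_manifold E \<Longrightarrow> f \<in> Cinf E \<Longrightarrow> (\<lambda>x. - f x) \<in> Cinf E"
  using Cinf_cmult[of E f "-1"] by simp

lemma Cinf_diff: "smooth_manifold E \<Longrightarrow> f \<in> Cinf E \<Longrightarrow> g \<in> Cinf E \<Longrightarrow> (\<lambda>x. f x - g x) \<in> Cinf E"
  using Cinf_add[of E f "\<lambda>x. - g x"] Cinf_minus[of E g] by simp

lemma Cinf_sum:
  "smooth_manifold E \<Longrightarrow> (\<And>i. i \<in> I \<Longrightarrow> f i \<in> Cinf E) \<Longrightarrow> (\<lambda>x. \<Sum>i\<in>I. f i x) \<in> Cinf E"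
  by (induction I rule: infinite_finite_induct) (auto intro: Cinf_const Cinf_add)

lemma Cinf_power: "smooth_manifold E \<Longrightarrow> f \<in> Cinf E \<Longrightarrow> (\<lambda>x. f x ^ k) \<in> Cinf E"
  by (induction k) (auto intro: Cinf_const Cinf_mult)

lemma Cinf_continuous:
  assumes "smooth_manifold E" "f \<in> Cinf E"
  shows "continuous_on UNIV f"
proof -
  have "isCont f x" for x
  proof -
    obtain U \<phi> where U: "(U, \<phi>) \<in> charts E" "x \<in> U"
      using assms(1) unfolding smooth_manifold_def by force
    have "smooth_on (\<phi> ` U) (\<lambda>y. f (inv_into U \<phi> y))"
      using smooth_map_onD[OF assms(1) _ U(1), of UNIV f] assms(2) by (simp add: Cinf_def)
    moreover have "\<phi> x \<in> \<phi> ` U" using U by simp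
    ultimately obtain T g where T: "open T" "\<phi> x \<in> T" "\<And>k. Ck_on k T g"
        "\<And>y. y \<in> \<phi> ` U \<Longrightarrow> y \<in> T \<Longrightarrow> f (inv_into U \<phi> y) = g y"
      using smooth_onE by blast
    define W where "W = U \<inter> \<phi> -` T"
    have W: "open W" "x \<in> W"
      unfolding W_def using T(1,2) U(2) chartD(1,3)[OF assms(1) U(1)] continuous_open_preimage by auto
    have "continuous_on W (\<lambda>x. g (\<phi> x))"
      by (rule continuous_on_compose2[of T g])
        (use T(3)[of 0] continuous_on_subset[OF chartD(3)[OF assms(1) U(1)], of W] in \<open>auto simp: W_def\<close>)
    then have "continuous_on W f"
      by (rule continuous_on_eq) (use T(4) chartD(2)[OF assms(1) U(1)] in \<open>force simp: W_def\<close>)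
    then show ?thesis using W continuous_on_eq_continuous_at by blast
  qed
  then show ?thesis by (simp add: continuous_at_imp_continuous_on)
qed

lemma Cinf_open_support:
  assumes "smooth_manifold E" "f \<in> Cinf E"
  shows "open {x. f x \<noteq> 0}"
  using open_vimage[of "- {0}" f] Cinf_continuous[OF assms]
  by (simp add: vimage_def open_Compl)

section \<open>Coordinates on a ball in a chart\<close>

text \<open>A ball of the model space inside the image of a chart. The elements of the orthonormal basis \<open>B\<close> of the model
  space serve as coordinate directions.\<close>

locale chart_ball =
  fixes E :: "('a::{t2_space,second_countable_topology}, 'm::euclidean_space, 'v, 'f) vbundle"
    and U :: "'a set" and \<phi> :: "'a \<Rightarrow> 'm" and c :: 'm and r :: real and B :: "'m set"
  assumes manifold: "smooth_manifold E" and U: "(U, \<phi>) \<in> charts E" and r: "r > 0"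
    and c: "c \<in> model E" and ball: "ball c r \<inter> model E \<subseteq> \<phi> ` U"
    and B: "B \<subseteq> model E" "pairwise orthogonal B" "\<And>i. i \<in> B \<Longrightarrow> norm i = 1"
      "finite B" "card B = dim (model E)" "span B = model E"
begin

lemmas chart = chartD[OF manifold U]

definition region :: "'a set" where "region = U \<inter> \<phi> -` ball c r"

text \<open>Half the radius is used, so that the closed support stays inside the region where the coordinates are defined.\<close>

definition \<beta> :: "'a \<Rightarrow> real" where "\<beta> x = (if x \<in> U then bump c (r/2) (\<phi> x) else 0)"

definition spread :: "('m \<Rightarrow> real) \<Rightarrow> 'a \<Rightarrow> real" where
  "spread G x = (if x \<in> region then \<beta> x *\<^sub>R G (\<phi> x) else 0)"

definition core :: "'a set" where
  "core = inv_into U \<phi> ` (cball c (r/2) \<inter> model E)"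

lemma open_region: "open region"
  unfolding region_def using chart(1,3) continuous_open_preimage by blast

lemma cball_chart: "cball c (r/2) \<inter> model E \<subseteq> \<phi> ` U"
  using ball r by fastforce

lemma closed_core: "closed core"
proof -
  have "compact (cball c (r/2) \<inter> model E)"
    by (intro compact_Int_closed compact_cball closed_subspace chart(7))
  then have "compact core"
    unfolding core_def
    by (intro compact_continuous_image continuous_on_subset[OF chart(4) cball_chart])
  then show ?thesis by (rule compact_imp_closed)
qed

lemma core_region: "core \<subseteq> region"
proof
  fix x assume "x \<in> core"
  then obtain y where y: "y \<in> cball c (r/2)" "y \<in> model E" "x = inv_into U \<phi> y" by (auto simp: core_def)
  then have "y \<in> \<phi> ` U" using cball_chart by blast
  then have "x \<in> U" "\<phi> x = y" using y by (auto simp: inv_into_into f_inv_into_f)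
  then show "x \<in> region" using y r by (auto simp: region_def)
qed

lemma \<beta>_nonzero: "\<beta> x \<noteq> 0 \<longleftrightarrow> x \<in> U \<and> \<phi> x \<in> ball c (r/2)"
  using bump_nonzero_iff[of "r/2" c "\<phi> x"] r by (simp add: \<beta>_def)

lemma \<beta>_core: "x \<notin> core \<Longrightarrow> \<beta> x = 0"
proof (rule ccontr)
  assume x: "x \<notin> core" "\<beta> x \<noteq> 0"
  then have "x \<in> U" "\<phi> x \<in> cball c (r/2) \<inter> model E" using \<beta>_nonzero chart(6) by auto
  then have "x \<in> core" unfolding core_def using chart(2) by (metis imageI)
  then show False using x by simp
qed

lemma region_U: "x \<in> region \<Longrightarrow> x \<in> U" and region_ball: "x \<in> region \<Longrightarrow> \<phi> x \<in> ball c r"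
  by (auto simp: region_def)

lemma \<beta>_region: "\<beta> x \<noteq> 0 \<Longrightarrow> x \<in> region"
  using \<beta>_core core_region by blast

lemma smooth_region:
  assumes "\<And>k. Ck_on k (ball c r) G"
  shows "smooth_map_on E region (\<lambda>x. G (\<phi> x))"
proof (rule smooth_map_on_chart[OF manifold U])
  have "smooth_on (\<phi> ` region) G"
    by (rule smooth_on_subset[OF smooth_on_open[OF open_ball assms]]) (auto simp: region_def)
  then show "smooth_on (\<phi> ` region) (\<lambda>y. G (\<phi> (inv_into U \<phi> y)))"
    by (subst smooth_on_cong[of _ _ G]) (use chart(2) in \<open>auto simp: region_def\<close>)
qed (auto simp: region_def)

lemma \<beta>_Cinf: "\<beta> \<in> Cinf E"
  unfolding Cinf_def mem_Collect_eq
proof (rule smooth_map_on_local[OF manifold])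
  fix q :: 'a
  show "\<exists>W'. open W' \<and> q \<in> W' \<and> smooth_map_on E (W' \<inter> UNIV) \<beta>"
  proof (cases "q \<in> region")
    case True
    have "smooth_map_on E region \<beta>"
      by (rule smooth_map_on_cong[OF manifold _ smooth_region[OF Ck_on_bump[OF open_ball]]])
        (simp add: \<beta>_def region_U)
    then show ?thesis using True open_region by auto
  next
    case False
    have "smooth_map_on E (- core) \<beta>"
      by (rule smooth_map_on_cong[OF manifold _ smooth_map_on_const[OF manifold, of _ 0]]) (simp add: \<beta>_core)
    then show ?thesis using False core_region closed_core by (intro exI[of _ "- core"]) auto
  qed
qed

lemma extend:
  assumes "open V" "smooth_map_on E (region \<inter> V) f"
  shows "smooth_map_on E V (\<lambda>x. if x \<in> region then \<beta> x *\<^sub>R f x else 0)"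
  using extend_by_bump[OF manifold _ open_region closed_core core_region \<beta>_core assms] \<beta>_Cinf
  by (simp add: Cinf_def)

lemma spread_Cinf: "(\<And>k. Ck_on k (ball c r) G) \<Longrightarrow> spread G \<in> Cinf E"
  unfolding Cinf_def mem_Collect_eq spread_def using smooth_region[of G] by (intro extend) auto

text \<open>The orthogonal projection onto the model space. A function on the chart, composed with it, extends to an open ball of
  \<open>'m\<close>, where Frechet derivatives are available, and derivatives in directions of the model are not affected.\<close>

definition pr :: "'m \<Rightarrow> 'm" where "pr y = (\<Sum>i\<in>B. (y \<bullet> i) *\<^sub>R i)"

lemma pr_inner: assumes "i \<in> B" shows "pr y \<bullet> i = y \<bullet> i"
proof -
  have "j \<bullet> i = (if j = i then 1 else 0)" if "j \<in> B" for j
    using B(2,3) that assms by (auto simp: pairwise_def orthogonal_def norm_eq_1)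
  then have "pr y \<bullet> i = (\<Sum>j\<in>B. if j = i then y \<bullet> j else 0)"
    unfolding pr_def inner_sum_left by (intro sum.cong) auto
  then show ?thesis using assms B(4) by simp
qed

lemma basis_inner: "i \<in> B \<Longrightarrow> j \<in> B \<Longrightarrow> i \<bullet> j = (if i = j then 1 else 0)"
  using B(2,3) by (auto simp: pairwise_def orthogonal_def norm_eq_1)

lemma pr_linear: "bounded_linear pr"
  unfolding pr_def
  by (intro bounded_linear_sum bounded_linear_compose[OF bounded_linear_scaleR_left] bounded_linear_inner_left)

lemma pr_model: "pr y \<in> model E"
  unfolding pr_def B(6)[symmetric] by (intro span_sum span_scale span_base)

lemma pr_id: assumes "y \<in> model E" shows "pr y = y"
proof -
  have "y - pr y \<in> span B"
    using assms pr_model[of y] unfolding B(6)[symmetric] by (rule span_diff)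
  then have "orthogonal (y - pr y) (y - pr y)"
    by (rule orthogonal_to_span) (simp add: orthogonal_def inner_diff_left pr_inner)
  then show ?thesis by (simp add: orthogonal_self)
qed

lemma pr_ball: assumes "y \<in> ball c r" shows "pr y \<in> ball c r"
proof -
  interpret pr: bounded_linear pr by (rule pr_linear)
  have "pr y - c = pr (y - c)" by (simp add: pr.diff pr_id[OF c])
  moreover have "norm (pr z) \<le> norm z" for z
  proof -
    have "(z - pr z) \<bullet> pr z = (\<Sum>i\<in>B. (z \<bullet> i) * ((z - pr z) \<bullet> i))"
      by (subst (2) pr_def) (simp add: inner_sum_right)
    also have "\<dots> = 0" by (intro sum.neutral) (simp add: inner_diff_left pr_inner)
    finally have "norm (pr z) * norm (pr z) = z \<bullet> pr z"
      by (simp add: inner_diff_left norm_eq_sqrt_inner)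
    also have "\<dots> \<le> norm z * norm (pr z)" by (rule norm_cauchy_schwarz)
    finally show ?thesis by (cases "norm (pr z) = 0") (auto dest: mult_right_le_imp_le)
  qed
  ultimately show ?thesis using assms
    by (metis dist_commute dist_norm le_less_trans mem_ball)
qed

definition hat :: "('a \<Rightarrow> real) \<Rightarrow> 'm \<Rightarrow> real" where
  "hat f y = f (inv_into U \<phi> (pr y))"

lemma hat_chart: "x \<in> U \<Longrightarrow> hat f (\<phi> x) = f x"
  by (simp add: hat_def pr_id chart(2,6))

lemma Ck_on_hat: assumes "f \<in> Cinf E" shows "Ck_on k (ball c r) (hat f)"
proof -
  have "smooth_on (\<phi> ` U) (\<lambda>y. f (inv_into U \<phi> y))"
    using smooth_map_onD[OF manifold _ U, of UNIV f] assms by (simp add: Cinf_def)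
  moreover have "smooth_on (ball c r) pr"
    by (intro smooth_on_open open_ball Ck_on_id pr_linear)
  moreover have "pr y \<in> \<phi> ` U" if "y \<in> ball c r" for y
    using pr_ball[OF that] pr_model[of y] ball by blast
  ultimately have "smooth_on (ball c r) (hat f)"
    unfolding hat_def using smooth_on_compose[of "ball c r" pr "\<phi> ` U" "\<lambda>y. f (inv_into U \<phi> y)"] by simp
  then show ?thesis by (rule smooth_on_imp_Ck_on[OF open_ball])
qed

definition grad :: "('a \<Rightarrow> real) \<Rightarrow> 'm \<Rightarrow> 'm \<Rightarrow> real" where
  "grad f y = frechet_derivative (hat f) (at y)"

lemma hat_has_derivative: "f \<in> Cinf E \<Longrightarrow> y \<in> ball c r \<Longrightarrow> (hat f has_derivative grad f y) (at y)"
  unfolding grad_def by (rule Ck_on_SucD[OF Ck_on_hat open_ball])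

lemma Ck_on_grad: "f \<in> Cinf E \<Longrightarrow> Ck_on k (ball c r) (\<lambda>y. grad f y i)"
  unfolding grad_def by (rule Ck_on_direction[OF open_ball Ck_on_hat])

lemma gradI:
  assumes "(hat f has_derivative D) (at y)" shows "grad f y = D"
  unfolding grad_def using frechet_derivative_at[OF assms] by simp

text \<open>The vector field \<open>\<beta> \<partial>\<^sub>i\<close>.\<close>

definition part :: "'m \<Rightarrow> ('a \<Rightarrow> real) \<Rightarrow> 'a \<Rightarrow> real" where
  "part i f = (if f \<in> Cinf E then spread (\<lambda>y. grad f y i) else 0)"

text \<open>The function \<open>\<beta> x\<^sub>i\<close>.\<close>

definition coord :: "'m \<Rightarrow> 'a \<Rightarrow> real" where "coord i = spread (\<lambda>y. y \<bullet> i)"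

lemma coord_Cinf: "coord i \<in> Cinf E"
  unfolding coord_def by (intro spread_Cinf Ck_on_id bounded_linear_inner_left open_ball)

lemma coord_eq: "coord i x = \<beta> x * (\<phi> x \<bullet> i)"
  using \<beta>_region by (auto simp: coord_def spread_def)

lemma part_vector_field: "vector_field E (part i)"
  unfolding vector_field_def
proof (intro conjI allI ballI)
  fix x
  have "part i (\<lambda>y. f y + g y) x = part i f x + part i g x" if f: "f \<in> Cinf E" and g: "g \<in> Cinf E" for f g
  proof (cases "x \<in> region")
    case True
    then have "(hat (\<lambda>y. f y + g y) has_derivative (\<lambda>h. grad f (\<phi> x) h + grad g (\<phi> x) h)) (at (\<phi> x))"
      unfolding hat_def[of "\<lambda>y. f y + g y"] hat_def[symmetric]
      by (intro has_derivative_add hat_has_derivative f g region_ball)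
    from gradI[OF this] show ?thesis
      using f g True Cinf_add[OF manifold f g] by (simp add: part_def spread_def algebra_simps)
  qed (simp add: part_def spread_def)
  moreover have "part i (\<lambda>y. a * f y) x = a * part i f x" if f: "f \<in> Cinf E" for a f
  proof (cases "x \<in> region")
    case True
    then have "(hat (\<lambda>y. a * f y) has_derivative (\<lambda>h. a * grad f (\<phi> x) h)) (at (\<phi> x))"
      unfolding hat_def[of "\<lambda>y. a * f y"] hat_def[symmetric]
      by (intro has_derivative_mult_right hat_has_derivative f region_ball)
    from gradI[OF this] show ?thesis
      using f True Cinf_cmult[OF manifold f] by (simp add: part_def spread_def algebra_simps)
  qed (simp add: part_def spread_def)
  moreover have "part i (\<lambda>y. f y * g y) x = part i f x * g x + f x * part i g x"
    if f: "f \<in> Cinf E" and g: "g \<in> Cinf E" for f g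
  proof (cases "x \<in> region")
    case True
    then have "(hat (\<lambda>y. f y * g y) has_derivative
        (\<lambda>h. hat f (\<phi> x) * grad g (\<phi> x) h + grad f (\<phi> x) h * hat g (\<phi> x))) (at (\<phi> x))"
      unfolding hat_def[of "\<lambda>y. f y * g y"] hat_def[symmetric]
      by (intro has_derivative_mult hat_has_derivative f g region_ball)
    from gradI[OF this] show ?thesis
      using f g True Cinf_mult[OF manifold f g] region_U[OF True]
      by (simp add: part_def spread_def algebra_simps hat_chart)
  qed (simp add: part_def spread_def)
  ultimately show "(\<lambda>f. part i f x) \<in> tangent_space E x"
    by (auto simp: tangent_space_def lin_on_def plus_fun_def scaleR_fun_def part_def)
next
  fix f assume "f \<in> Cinf E"
  then show "part i f \<in> Cinf E" by (auto simp: part_def intro: spread_Cinf Ck_on_grad)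
qed

text \<open>The product rule for \<open>\<beta> \<partial>\<^sub>i (\<beta> x\<^sub>k)\<close>, arranged so that it makes sense, and holds, where \<open>\<beta>\<close> vanishes.\<close>

lemma part_coord:
  assumes "i \<in> B" "k \<in> B"
  shows "\<beta> x * part i (coord k) x - part i \<beta> x * coord k x = (if i = k then \<beta> x ^ 3 else 0)"
proof (cases "x \<in> region")
  case True
  have y: "\<phi> x \<in> ball c r" by (rule region_ball[OF True])
  have "hat (coord k) y = hat \<beta> y * (y \<bullet> k)" if "y \<in> ball c r" for y
  proof -
    have "pr y \<in> \<phi> ` U" using that ball pr_ball pr_model by blast
    then have "\<phi> (inv_into U \<phi> (pr y)) = pr y" by (rule f_inv_into_f)
    then show ?thesis by (simp add: hat_def coord_eq pr_inner[OF assms(2)])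
  qed
  moreover have "((\<lambda>y. hat \<beta> y * (y \<bullet> k)) has_derivative
      (\<lambda>h. hat \<beta> (\<phi> x) * (h \<bullet> k) + grad \<beta> (\<phi> x) h * (\<phi> x \<bullet> k))) (at (\<phi> x))"
    by (intro has_derivative_mult hat_has_derivative \<beta>_Cinf y
        bounded_linear_imp_has_derivative bounded_linear_inner_left)
  ultimately have "(hat (coord k) has_derivative
      (\<lambda>h. hat \<beta> (\<phi> x) * (h \<bullet> k) + grad \<beta> (\<phi> x) h * (\<phi> x \<bullet> k))) (at (\<phi> x))"
    using has_derivative_cong_open[OF open_ball y, of "hat (coord k)"] by simp
  from gradI[OF this]
  have "part i (coord k) x = \<beta> x * (\<beta> x * (i \<bullet> k) + grad \<beta> (\<phi> x) i * (\<phi> x \<bullet> k))"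
    using True region_U by (simp add: part_def coord_Cinf spread_def hat_chart)
  moreover have "part i \<beta> x = \<beta> x * grad \<beta> (\<phi> x) i"
    using True by (simp add: part_def \<beta>_Cinf spread_def)
  ultimately show ?thesis
    by (simp add: coord_eq basis_inner[OF assms] power3_eq_cube algebra_simps)
next
  case False
  then have "\<beta> x = 0" using \<beta>_region by blast
  then show ?thesis using False by (simp add: coord_def spread_def)
qed

text \<open>By Hadamard's lemma \<open>f - f(x) = \<Sum>\<^sub>i (x\<^sub>i - x\<^sub>i(x)) g\<^sub>i\<close> in the region. Multiplied by \<open>\<beta>\<^sup>2\<close> this becomes an identity of
  global functions, to which \<open>v\<close> can be applied; in the products on the right only the derivatives of the first factor
  survive at \<open>x\<close>.\<close>

lemma tangent_expansion:
  assumes v: "v \<in> tangent_space E x" and f: "f \<in> Cinf E"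
  shows "\<beta> x ^ 3 * v f = (\<Sum>i\<in>B. (\<beta> x * v (coord i) - coord i x * v \<beta>) * part i f x)"
proof (cases "x \<in> region")
  case True
  note add = v[unfolded tangent_space_def mem_Collect_eq lin_on_def plus_fun_def scaleR_fun_def, THEN conjunct1, THEN conjunct1, rule_format]
  note scale = v[unfolded tangent_space_def mem_Collect_eq lin_on_def plus_fun_def scaleR_fun_def, THEN conjunct1, THEN conjunct2, rule_format]
  note leibniz = v[unfolded tangent_space_def mem_Collect_eq, THEN conjunct2, THEN conjunct2, rule_format]
  have lin: "lin_on (Cinf E) v" using v by (simp add: tangent_space_def)
  have vsum: "v (\<lambda>q. \<Sum>i\<in>I. h i q) = (\<Sum>i\<in>I. v (h i))" if "\<And>i. i \<in> I \<Longrightarrow> h i \<in> Cinf E" "finite I" for h and I :: "'m set"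
    using that(2,1)
  proof (induction I rule: finite_induct)
    case empty
    show ?case using scale[OF Cinf_const[OF manifold, of 0], of 0] by simp
  next
    case (insert j I)
    then show ?case using add[of "h j" "\<lambda>q. \<Sum>i\<in>I. h i q"] Cinf_sum[OF manifold, of I h] by simp
  qed
  define xx where "xx = \<phi> x"
  have xx: "xx \<in> ball c r" unfolding xx_def by (rule region_ball[OF True])
  obtain g where g: "\<And>k v. Ck_on k (ball c r) (g v)" "\<And>v. g v xx = frechet_derivative (hat f) (at xx) v"
    "\<And>y I c'. y \<in> ball c r \<Longrightarrow> finite I \<Longrightarrow> y - xx = (\<Sum>i\<in>I. c' i *\<^sub>R i) \<Longrightarrow>
        hat f y = hat f xx + (\<Sum>i\<in>I. c' i * g i y)"
    using Hadamard[OF open_ball convex_ball xx Ck_on_hat[OF f]] by blast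
  \<comment> \<open>\<open>z i\<close> is \<open>\<beta> (x\<^sub>i - x\<^sub>i(x))\<close>, and \<open>G i\<close> is \<open>\<beta> g\<^sub>i\<close>.\<close>
  define z where "z i q = coord i q - (xx \<bullet> i) * \<beta> q" for i q
  define G where "G i = spread (g i)" for i
  have z: "z i \<in> Cinf E" for i
    unfolding z_def by (intro Cinf_diff Cinf_cmult manifold coord_Cinf \<beta>_Cinf)
  have G: "G i \<in> Cinf E" for i unfolding G_def by (rule spread_Cinf[OF g(1)])
  have eq: "\<beta> q * \<beta> q * f q = f x * (\<beta> q * \<beta> q) + (\<Sum>i\<in>B. z i q * G i q)" for q
  proof (cases "q \<in> region")
    case q: True
    have "\<phi> q - xx = pr (\<phi> q - xx)"
      unfolding xx_def using chart(6,7) region_U q True by (simp add: pr_id subspace_diff)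
    then have "hat f (\<phi> q) = hat f xx + (\<Sum>i\<in>B. ((\<phi> q - xx) \<bullet> i) * g i (\<phi> q))"
      by (intro g(3) region_ball q B(4)) (simp add: pr_def)
    then have "f q = f x + (\<Sum>i\<in>B. ((\<phi> q - xx) \<bullet> i) * g i (\<phi> q))"
      using q True region_U by (simp add: hat_chart xx_def)
    moreover have "z i q * G i q = \<beta> q * \<beta> q * (((\<phi> q - xx) \<bullet> i) * g i (\<phi> q))" for i
      using q by (simp add: z_def G_def spread_def coord_eq inner_diff_left algebra_simps)
    ultimately show ?thesis by (simp only: sum_distrib_left distrib_left) (simp add: mult_ac)
  next
    case False
    then have "\<beta> q = 0" using \<beta>_region by blast
    then show ?thesis using False by (simp add: G_def spread_def)
  qed
  have \<beta>2: "(\<lambda>q. \<beta> q * \<beta> q) \<in> Cinf E" by (intro Cinf_mult manifold \<beta>_Cinf)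
  have zG: "(\<lambda>q. z i q * G i q) \<in> Cinf E" for i by (intro Cinf_mult manifold z G)
  have "v (\<lambda>q. \<beta> q * \<beta> q * f q) = v (\<lambda>q. f x * (\<beta> q * \<beta> q) + (\<Sum>i\<in>B. z i q * G i q))"
    by (simp add: eq)
  also have "\<dots> = f x * v (\<lambda>q. \<beta> q * \<beta> q) + (\<Sum>i\<in>B. v (\<lambda>q. z i q * G i q))"
    using add[OF Cinf_cmult[OF manifold \<beta>2, of "f x"] Cinf_sum[OF manifold, of B "\<lambda>i q. z i q * G i q"]] zG
      scale[OF \<beta>2, of "f x"] vsum[of B "\<lambda>i q. z i q * G i q"] B(4) by simp
  finally have "\<beta> x * \<beta> x * v f = (\<Sum>i\<in>B. v (\<lambda>q. z i q * G i q))"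
    using leibniz[OF \<beta>2 f] by simp
  also have "\<dots> = (\<Sum>i\<in>B. (v (coord i) - (xx \<bullet> i) * v \<beta>) * part i f x)"
  proof (rule sum.cong[OF refl])
    fix i
    have "z i x = 0" by (simp add: z_def coord_eq xx_def)
    moreover have "v (z i) = v (coord i) - (xx \<bullet> i) * v \<beta>"
      using add[OF coord_Cinf Cinf_cmult[OF manifold \<beta>_Cinf, of "- (xx \<bullet> i)"]]
        scale[OF \<beta>_Cinf, of "- (xx \<bullet> i)"] by (simp add: z_def[abs_def])
    moreover have "G i x = part i f x"
      using True f by (simp add: G_def spread_def part_def grad_def xx_def[symmetric] g(2))
    ultimately show "v (\<lambda>q. z i q * G i q) = (v (coord i) - (xx \<bullet> i) * v \<beta>) * part i f x"
      using leibniz[OF z G, of i i] by simp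
  qed
  finally have "\<beta> x * (\<beta> x * \<beta> x * v f) = \<beta> x * (\<Sum>i\<in>B. (v (coord i) - (xx \<bullet> i) * v \<beta>) * part i f x)"
    by simp
  then show ?thesis
    by (simp add: sum_distrib_left power3_eq_cube coord_eq xx_def algebra_simps)
next
  case False
  then have "\<beta> x = 0" using \<beta>_region by blast
  then show ?thesis using False f by (simp add: part_def spread_def)
qed

end

lemma chart_ball_exists:
  fixes E :: "('a::{t2_space,second_countable_topology}, 'm::euclidean_space, 'v, 'f) vbundle"
  assumes manifold: "smooth_manifold E" and V: "open V" "p \<in> V"
  obtains U \<phi> r B where "chart_ball E U \<phi> (\<phi> p) r B" "p \<in> U" "U \<inter> \<phi> -` ball (\<phi> p) r \<subseteq> V"
proof -
  obtain U \<phi> where U: "(U, \<phi>) \<in> charts E" "p \<in> U"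
    using manifold unfolding smooth_manifold_def by force
  note ch = chartD[OF manifold U(1)]
  obtain T where T: "open T" "\<phi> ` (U \<inter> V) = \<phi> ` U \<inter> T"
    using chart_open_image[OF manifold U(1), of "U \<inter> V"] ch(1) V(1) by blast
  obtain T' where T': "open T'" "\<phi> ` U = model E \<inter> T'"
    using ch(5) unfolding openin_open by auto
  have "\<phi> p \<in> \<phi> ` (U \<inter> V)" using U(2) V(2) by blast
  then have "\<phi> p \<in> T \<inter> T'" using T(2) T'(2) by blast
  then obtain r where r: "r > 0" "ball (\<phi> p) r \<subseteq> T \<inter> T'"
    using T(1) T'(1) open_Int openE by metis
  obtain B where B: "B \<subseteq> model E" "pairwise orthogonal B" "\<And>i. i \<in> B \<Longrightarrow> norm i = 1"
      "independent B" "card B = dim (model E)" "span B = model E"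
    using orthonormal_basis_subspace[OF ch(7)] by metis
  have "chart_ball E U \<phi> (\<phi> p) r B"
    using manifold U r B ch(6) T'(2) by unfold_locales (auto intro: independent_imp_finite)
  moreover have "U \<inter> \<phi> -` ball (\<phi> p) r \<subseteq> V"
  proof
    fix x assume "x \<in> U \<inter> \<phi> -` ball (\<phi> p) r"
    then have "x \<in> U" "\<phi> x \<in> \<phi> ` (U \<inter> V)" using r(2) T(2) by auto
    then show "x \<in> V" using ch(2) by (metis IntD1 IntD2 imageE)
  qed
  ultimately show ?thesis using that U(2) by blast
qed

section \<open>Sections of the bundle\<close>

lemma sections_fib: "u \<in> sections E \<Longrightarrow> u x \<in> fib E x"
  by (simp add: sections_def)

lemma sectionsI:
  assumes "\<And>x. u x \<in> fib E x" "\<And>V \<tau>. (V, \<tau>) \<in> trivs E \<Longrightarrow> smooth_map_on E V (\<lambda>x. \<tau> x (u x))"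
  shows "u \<in> sections E"
  using assms by (auto simp: sections_def)

lemma sections_smooth: "u \<in> sections E \<Longrightarrow> (V, \<tau>) \<in> trivs E \<Longrightarrow> smooth_map_on E V (\<lambda>x. \<tau> x (u x))"
  by (auto simp: sections_def)

locale smooth_bundle =
  fixes E :: "('a::{t2_space,second_countable_topology}, 'm::euclidean_space, 'v::real_vector,
    'f::euclidean_space) vbundle"
  assumes vb: "vector_bundle E"
begin

lemma mfd: "smooth_manifold E" and fib_subspace: "subspace (fib E x)"
  using vb by (auto simp: vector_bundle_def)

lemma trivD:
  assumes "(V, \<tau>) \<in> trivs E"
  shows "open V" "\<And>x. x \<in> V \<Longrightarrow> lin_on (fib E x) (\<tau> x)" "\<And>x. x \<in> V \<Longrightarrow> bij_betw (\<tau> x) (fib E x) UNIV"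
    "\<And>V' \<tau>' w. (V', \<tau>') \<in> trivs E \<Longrightarrow> smooth_map_on E (V \<inter> V') (\<lambda>x. \<tau>' x (inv_into (fib E x) (\<tau> x) w))"
proof -
  have 1: "\<forall>(V, \<tau>)\<in>trivs E. open V \<and> (\<forall>x\<in>V. lin_on (fib E x) (\<tau> x) \<and> bij_betw (\<tau> x) (fib E x) UNIV)"
    and 2: "\<forall>(V, \<tau>)\<in>trivs E. \<forall>(V', \<tau>')\<in>trivs E. \<forall>w.
        smooth_map_on E (V \<inter> V') (\<lambda>x. \<tau>' x (inv_into (fib E x) (\<tau> x) w))"
    using vb unfolding vector_bundle_def by simp_all
  show "open V" "\<And>x. x \<in> V \<Longrightarrow> lin_on (fib E x) (\<tau> x)" "\<And>x. x \<in> V \<Longrightarrow> bij_betw (\<tau> x) (fib E x) UNIV"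
    using 1[rule_format, OF assms] by auto
  show "\<And>V' \<tau>' w. (V', \<tau>') \<in> trivs E \<Longrightarrow> smooth_map_on E (V \<inter> V') (\<lambda>x. \<tau>' x (inv_into (fib E x) (\<tau> x) w))"
    using 2[rule_format, OF assms, simplified, rule_format] by auto
qed

lemma sections_add:
  assumes "u \<in> sections E" "w \<in> sections E"
  shows "(\<lambda>x. u x + w x) \<in> sections E"
proof (rule sectionsI)
  show "u x + w x \<in> fib E x" for x
    using assms fib_subspace by (auto intro: subspace_add sections_fib)
  fix V \<tau> assume V: "(V, \<tau>) \<in> trivs E"
  show "smooth_map_on E V (\<lambda>x. \<tau> x (u x + w x))"
    by (rule smooth_map_on_cong[OF mfd _ smooth_map_on_add[OF mfd sections_smooth[OF assms(1) V] sections_smooth[OF assms(2) V]]])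
      (simp add: lin_on_addD[OF trivD(2)[OF V]] sections_fib[OF assms(1)] sections_fib[OF assms(2)])
qed

lemma sections_scale:
  assumes "f \<in> Cinf E" "u \<in> sections E"
  shows "(\<lambda>x. f x *\<^sub>R u x) \<in> sections E"
proof (rule sectionsI)
  show "f x *\<^sub>R u x \<in> fib E x" for x
    using assms fib_subspace by (auto intro: subspace_scale sections_fib)
  fix V \<tau> assume V: "(V, \<tau>) \<in> trivs E"
  have "smooth_map_on E V f" using assms(1) smooth_map_on_subset[OF mfd] by (auto simp: Cinf_def)
  from smooth_map_on_bilinear[OF mfd bounded_bilinear_scaleR this sections_smooth[OF assms(2) V]]
  show "smooth_map_on E V (\<lambda>x. \<tau> x (f x *\<^sub>R u x))"
    by (rule smooth_map_on_cong[OF mfd, rotated])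
      (simp add: lin_on_scaleD[OF trivD(2)[OF V]] sections_fib[OF assms(2)])
qed

lemma sections_0: "(\<lambda>x. 0) \<in> sections E"
proof (rule sectionsI)
  show "0 \<in> fib E x" for x using fib_subspace by (rule subspace_0)
  fix V \<tau> assume V: "(V, \<tau>) \<in> trivs E"
  show "smooth_map_on E V (\<lambda>x. \<tau> x 0)"
    by (rule smooth_map_on_cong[OF mfd _ smooth_map_on_const[OF mfd, of _ 0]])
      (use lin_on_0[OF trivD(2)[OF V] fib_subspace] in auto)
qed

lemma sections_cscale: "u \<in> sections E \<Longrightarrow> (\<lambda>x. a *\<^sub>R u x) \<in> sections E"
  by (rule sections_scale[OF Cinf_const[OF mfd]])

lemma sections_diff:
  assumes "u \<in> sections E" "w \<in> sections E"
  shows "(\<lambda>x. u x - w x) \<in> sections E"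
  using sections_add[OF assms(1) sections_cscale[OF assms(2), of "-1"]] by simp

lemma sections_sum: "(\<And>i. i \<in> I \<Longrightarrow> u i \<in> sections E) \<Longrightarrow> (\<lambda>x. \<Sum>i\<in>I. u i x) \<in> sections E"
  by (induction I rule: infinite_finite_induct) (auto intro: sections_0 sections_add)

end

section \<open>Local frames\<close>

text \<open>The algebraic content of a chart together with a trivialisation: \<open>y\<^sub>i = \<beta> x\<^sub>i\<close> for coordinates \<open>x\<^sub>i\<close>, \<open>P\<^sub>i = \<beta> \<partial>\<^sub>i\<close>,
  \<open>s\<^sub>j = \<beta> e\<^sub>j\<close> for the local frame \<open>e\<^sub>j\<close> of the trivialisation, and \<open>\<omega>\<^sub>j\<close> is \<open>\<beta>\<close> times the dual coframe. Everything about
  derivations will be deduced from these identities.\<close>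

locale local_frame = smooth_bundle E
  for E :: "('a::{t2_space,second_countable_topology}, 'm::euclidean_space, 'v::real_vector, 'f::euclidean_space) vbundle" +
  fixes B :: "'m set" and \<beta> :: "'a \<Rightarrow> real" and y :: "'m \<Rightarrow> 'a \<Rightarrow> real"
    and P :: "'m \<Rightarrow> ('a \<Rightarrow> real) \<Rightarrow> 'a \<Rightarrow> real"
    and s :: "'f \<Rightarrow> 'a \<Rightarrow> 'v" and \<omega> :: "'f \<Rightarrow> 'a \<Rightarrow> 'v \<Rightarrow> real"
  assumes B: "finite B" "card B = dim (model E)"
    and \<beta>: "\<beta> \<in> Cinf E" and y: "y i \<in> Cinf E" and P: "vector_field E (P i)"
    and dual: "i \<in> B \<Longrightarrow> k \<in> B \<Longrightarrow> \<beta> x * P i (y k) x - P i \<beta> x * y k x = (if i = k then \<beta> x ^ 3 else 0)"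
    and expand: "v \<in> tangent_space E x \<Longrightarrow> f \<in> Cinf E \<Longrightarrow>
      \<beta> x ^ 3 * v f = (\<Sum>i\<in>B. (\<beta> x * v (y i) - y i x * v \<beta>) * P i f x)"
    and s: "s j \<in> sections E"
    and \<omega>_lin: "lin_on (fib E x) (\<omega> j x)"
    and \<omega>_Cinf: "u \<in> sections E \<Longrightarrow> (\<lambda>x. \<omega> j x (u x)) \<in> Cinf E"
    and s_expand: "e \<in> fib E x \<Longrightarrow> (\<Sum>j\<in>Basis. \<omega> j x e *\<^sub>R s j x) = \<beta> x ^ 2 *\<^sub>R e"
    and s_dual: "j \<in> Basis \<Longrightarrow> l \<in> Basis \<Longrightarrow> \<omega> j x (s l x) = (if j = l then \<beta> x ^ 2 else 0)"

text \<open>The ball of the chart is chosen inside the domain of a trivialisation.\<close>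

lemma (in smooth_bundle) local_frame_exists:
  obtains B \<beta> y P s \<omega> where "local_frame E B \<beta> y P s \<omega>" "\<beta> p \<noteq> 0"
proof -
  note fs = fib_subspace
  have "(\<Union>(U, \<tau>)\<in>trivs E. U) = UNIV" using vb by (simp add: vector_bundle_def)
  then have "p \<in> (\<Union>(U, \<tau>)\<in>trivs E. U)" by (simp only: UNIV_I)
  then obtain V\<tau> where V\<tau>: "V\<tau> \<in> trivs E" "p \<in> (case V\<tau> of (V, \<tau>) \<Rightarrow> V)" by (rule UN_E)
  obtain V \<tau> where "V\<tau> = (V, \<tau>)" by (cases V\<tau>)
  with V\<tau> have V: "(V, \<tau>) \<in> trivs E" "p \<in> V" by simp_all
  note tr = trivD[OF V(1)]
  obtain U \<phi> r B where cb: "chart_ball E U \<phi> (\<phi> p) r B" "p \<in> U" "U \<inter> \<phi> -` ball (\<phi> p) r \<subseteq> V"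
    using chart_ball_exists[OF mfd tr(1) V(2)] by blast
  interpret chart_ball E U \<phi> "\<phi> p" r B by (rule cb(1))
  have RV: "region \<subseteq> V" using cb(3) by (simp add: region_def)
  define s where "s b x = (if x \<in> region then \<beta> x *\<^sub>R inv_into (fib E x) (\<tau> x) b else 0)" for b x
  define \<omega> where "\<omega> b x e = (if x \<in> region then \<beta> x *\<^sub>R (\<tau> x e \<bullet> b) else 0)" for b x e
  have invfib: "inv_into (fib E x) (\<tau> x) b \<in> fib E x" and tinv: "\<tau> x (inv_into (fib E x) (\<tau> x) b) = b"
    if "x \<in> region" for x b
  proof -
    have "b \<in> \<tau> x ` fib E x" using tr(3)[of x] that RV by (auto simp: bij_betw_def)
    then show "inv_into (fib E x) (\<tau> x) b \<in> fib E x" "\<tau> x (inv_into (fib E x) (\<tau> x) b) = b"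
      by (auto intro: inv_into_into f_inv_into_f)
  qed
  have sfib: "s b x \<in> fib E x" for b x
    using invfib fs by (auto simp: s_def intro: subspace_scale subspace_0)
  have "local_frame E B \<beta> coord part s \<omega>"
  proof (intro local_frame.intro local_frame_axioms.intro smooth_bundle_axioms)
    show "finite B" "card B = dim (model E)" "\<beta> \<in> Cinf E" by (fact B \<beta>_Cinf)+
    show "coord i \<in> Cinf E" "vector_field E (part i)" for i by (fact coord_Cinf part_vector_field)+
    show "\<beta> x * part i (coord k) x - part i \<beta> x * coord k x = (if i = k then \<beta> x ^ 3 else 0)"
      if "i \<in> B" "k \<in> B" for i k x using part_coord[OF that] .
    show "\<beta> x ^ 3 * v f = (\<Sum>i\<in>B. (\<beta> x * v (coord i) - coord i x * v \<beta>) * part i f x)"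
      if "v \<in> tangent_space E x" "f \<in> Cinf E" for v x f using tangent_expansion[OF that] .
    show "s b \<in> sections E" for b
    proof (rule sectionsI[OF sfib])
      fix V' \<tau>' assume V': "(V', \<tau>') \<in> trivs E"
      note tr' = trivD[OF V']
      have "smooth_map_on E (region \<inter> V') (\<lambda>x. \<tau>' x (inv_into (fib E x) (\<tau> x) b))"
        by (rule smooth_map_on_subset[OF mfd tr(4)[OF V']]) (use RV in auto)
      from extend[OF tr'(1) this] show "smooth_map_on E V' (\<lambda>x. \<tau>' x (s b x))"
      proof (rule smooth_map_on_cong[OF mfd, rotated])
        fix x assume x: "x \<in> V'"
        show "(if x \<in> region then \<beta> x *\<^sub>R \<tau>' x (inv_into (fib E x) (\<tau> x) b) else 0) = \<tau>' x (s b x)"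
          using lin_on_scaleD[OF tr'(2)[OF x] invfib] lin_on_0[OF tr'(2)[OF x] fs] by (simp add: s_def)
      qed
    qed
    show "lin_on (fib E x) (\<omega> b x)" for b x
      using tr(2)[of x] RV by (cases "x \<in> region") (auto simp: \<omega>_def lin_on_def inner_add_left algebra_simps)
    show "(\<lambda>x. \<omega> b x (u x)) \<in> Cinf E" if u: "u \<in> sections E" for b u
    proof -
      have "smooth_map_on E V (\<lambda>x. \<tau> x (u x) \<bullet> b)"
        by (intro smooth_map_on_linear[OF mfd bounded_linear_inner_left] sections_smooth[OF u V(1)])
      then have "smooth_map_on E (region \<inter> UNIV) (\<lambda>x. \<tau> x (u x) \<bullet> b)"
        by (rule smooth_map_on_subset[OF mfd]) (use RV in auto)
      from extend[OF open_UNIV this] show ?thesis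
        by (simp add: Cinf_def \<omega>_def)
    qed
    show "\<omega> j x (s k x) = (if j = k then \<beta> x ^ 2 else 0)" if "j \<in> Basis" "k \<in> Basis" for j k x
    proof (cases "x \<in> region")
      case True
      have "\<tau> x (s k x) = \<beta> x *\<^sub>R k"
        using lin_on_scaleD[OF tr(2) invfib[OF True]] RV True tinv[OF True] by (auto simp: s_def)
      then show ?thesis using True that by (auto simp: \<omega>_def inner_Basis power2_eq_square)
    qed (use \<beta>_region in \<open>auto simp: \<omega>_def\<close>)
    show "(\<Sum>j\<in>Basis. \<omega> j x e *\<^sub>R s j x) = \<beta> x ^ 2 *\<^sub>R e" if e: "e \<in> fib E x" for x e
    proof (cases "x \<in> region")
      case True
      have x: "x \<in> V" using RV True by blast
      have lin: "lin_on (fib E x) (\<tau> x)" by (rule tr(2)[OF x])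
      have inj: "inj_on (\<tau> x) (fib E x)" using tr(3)[OF x] by (simp add: bij_betw_def)
      have "(\<Sum>j\<in>Basis. (\<tau> x e \<bullet> j) *\<^sub>R inv_into (fib E x) (\<tau> x) j) = e"
      proof (rule inj_onD[OF inj _ _ e])
        show "(\<Sum>j\<in>Basis. (\<tau> x e \<bullet> j) *\<^sub>R inv_into (fib E x) (\<tau> x) j) \<in> fib E x"
          by (intro subspace_sum subspace_scale fs invfib True)
        show "\<tau> x (\<Sum>j\<in>Basis. (\<tau> x e \<bullet> j) *\<^sub>R inv_into (fib E x) (\<tau> x) j) = \<tau> x e"
          by (subst lin_on_sum[OF lin fs]) (auto simp: invfib True tinv euclidean_representation)
      qed
      moreover have "(\<Sum>j\<in>Basis. \<omega> j x e *\<^sub>R s j x) =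
          \<beta> x ^ 2 *\<^sub>R (\<Sum>j\<in>Basis. (\<tau> x e \<bullet> j) *\<^sub>R inv_into (fib E x) (\<tau> x) j)"
        using True by (simp add: \<omega>_def s_def scaleR_sum_right power2_eq_square algebra_simps)
      ultimately show ?thesis by simp
    next
      case False
      then have "\<beta> x = 0" using \<beta>_region by blast
      then show ?thesis using False by (simp add: s_def)
    qed
  qed
  moreover have "\<beta> p \<noteq> 0" using \<beta>_nonzero[of p] cb(2) r by simp
  ultimately show ?thesis using that by blast
qed

section \<open>Tangent vectors and vector fields\<close>

lemma sum_fun_apply: "(\<Sum>i\<in>I. f i) x = (\<Sum>i\<in>I. f i x)"
  by (induction I rule: infinite_finite_induct) (simp_all add: zero_fun_def plus_fun_def)

lemma tangentD:
  assumes "v \<in> tangent_space E x"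
  shows "f \<in> Cinf E \<Longrightarrow> g \<in> Cinf E \<Longrightarrow> v (\<lambda>x. f x + g x) = v f + v g"
    and "f \<in> Cinf E \<Longrightarrow> v (\<lambda>x. a * f x) = a * v f"
    and "f \<notin> Cinf E \<Longrightarrow> v f = 0"
    and "f \<in> Cinf E \<Longrightarrow> g \<in> Cinf E \<Longrightarrow> v (\<lambda>x. f x * g x) = v f * g x + f x * v g"
  using assms by (simp_all add: tangent_space_def lin_on_def plus_fun_def scaleR_fun_def)

lemma tangentI:
  assumes "\<And>f g. f \<in> Cinf E \<Longrightarrow> g \<in> Cinf E \<Longrightarrow> v (\<lambda>x. f x + g x) = v f + v g"
    and "\<And>f a. f \<in> Cinf E \<Longrightarrow> v (\<lambda>x. a * f x) = a * v f"
    and "\<And>f. f \<notin> Cinf E \<Longrightarrow> v f = 0"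
    and "\<And>f g. f \<in> Cinf E \<Longrightarrow> g \<in> Cinf E \<Longrightarrow> v (\<lambda>x. f x * g x) = v f * g x + f x * v g"
  shows "v \<in> tangent_space E x"
  using assms by (simp add: tangent_space_def lin_on_def plus_fun_def scaleR_fun_def)

lemma tangent_subspace: "subspace (tangent_space E x)"
proof (rule subspaceI)
  show "0 \<in> tangent_space E x" by (rule tangentI) simp_all
  fix v w assume v: "v \<in> tangent_space E x" and w: "w \<in> tangent_space E x"
  show "v + w \<in> tangent_space E x"
    by (rule tangentI) (simp_all add: tangentD[OF v] tangentD[OF w] algebra_simps)
next
  fix v and a :: real assume v: "v \<in> tangent_space E x"
  show "a *\<^sub>R v \<in> tangent_space E x"
    by (rule tangentI) (simp_all add: tangentD[OF v] scaleR_fun_def algebra_simps)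
qed

lemma vector_fieldD:
  assumes "vector_field E X"
  shows "(\<lambda>f. X f x) \<in> tangent_space E x" "f \<in> Cinf E \<Longrightarrow> X f \<in> Cinf E"
  using assms by (auto simp: vector_field_def)

lemmas vector_field_rules = tangentD[OF vector_fieldD(1)]

lemma vector_field_0: "smooth_manifold E \<Longrightarrow> vector_field E (\<lambda>f x. 0)"
  by (auto simp: vector_field_def Cinf_const intro: tangentI)

lemma vector_field_add:
  assumes "smooth_manifold E" "vector_field E X" "vector_field E Y"
  shows "vector_field E (\<lambda>f x. X f x + Y f x)"
  unfolding vector_field_def
proof (intro conjI allI ballI)
  show "(\<lambda>f. X f x + Y f x) \<in> tangent_space E x" for x
    using subspace_add[OF tangent_subspace vector_fieldD(1)[OF assms(2)] vector_fieldD(1)[OF assms(3)]]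
    by (simp add: plus_fun_def)
qed (use assms in \<open>auto intro: Cinf_add vector_fieldD(2)\<close>)

lemma vector_field_scale:
  assumes "smooth_manifold E" "h \<in> Cinf E" "vector_field E X"
  shows "vector_field E (\<lambda>f x. h x * X f x)"
  unfolding vector_field_def
proof (intro conjI allI ballI)
  show "(\<lambda>f. h x * X f x) \<in> tangent_space E x" for x
    using subspace_scale[OF tangent_subspace vector_fieldD(1)[OF assms(3)], of "h x" x]
    by (simp add: scaleR_fun_def)
qed (use assms in \<open>auto intro: Cinf_mult vector_fieldD(2)\<close>)

lemma vector_field_bracket:
  assumes "smooth_manifold E" and X: "vector_field E X" and Y: "vector_field E Y"
  shows "vector_field E (\<lambda>f x. X (Y f) x - Y (X f) x)"
  unfolding vector_field_def
proof (intro conjI allI ballI)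
  note C = Cinf_add[OF assms(1)] Cinf_cmult[OF assms(1)] Cinf_mult[OF assms(1)]
    vector_fieldD(2)[OF X] vector_fieldD(2)[OF Y]
  have out: "X f = (\<lambda>x. 0)" "Y f = (\<lambda>x. 0)" if "f \<notin> Cinf E" for f
    using vector_field_rules(3)[OF X that] vector_field_rules(3)[OF Y that] by auto
  have zero: "Z (\<lambda>x. 0) x = 0" if "vector_field E Z" for Z x
    using vector_field_rules(2)[OF that Cinf_const[OF assms(1), of 0], where a = 0] by simp
  have add: "Z (\<lambda>x. f x + g x) = (\<lambda>x. Z f x + Z g x)"
    and cm: "Z (\<lambda>x. a * f x) = (\<lambda>x. a * Z f x)"
    and mult: "Z (\<lambda>x. f x * g x) = (\<lambda>x. Z f x * g x + f x * Z g x)"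
    if "vector_field E Z" "f \<in> Cinf E" "g \<in> Cinf E" for Z f g a
    using vector_field_rules[OF that(1)] that(2,3) by auto
  note X' = add[OF X] cm[OF X _ Cinf_const[OF assms(1)]] mult[OF X]
    and Y' = add[OF Y] cm[OF Y _ Cinf_const[OF assms(1)]] mult[OF Y]
  show "(\<lambda>f. X (Y f) x - Y (X f) x) \<in> tangent_space E x" for x
    by (rule tangentI) (simp_all add: X' Y' C out zero X Y algebra_simps)
  fix f assume "f \<in> Cinf E"
  then show "(\<lambda>x. X (Y f) x - Y (X f) x) \<in> Cinf E" by (intro Cinf_diff assms(1) C)
qed

section \<open>Derivations\<close>

definition fscale :: "('a \<Rightarrow> real) \<Rightarrow> (('a \<Rightarrow> 'v::real_vector) \<Rightarrow> 'a \<Rightarrow> 'v) \<Rightarrow> ('a \<Rightarrow> 'v) \<Rightarrow> 'a \<Rightarrow> 'v" where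
  "fscale f D u x = f x *\<^sub>R D u x"

definition anchor ::
  "('a, 'm::euclidean_space, 'v::real_vector, 'f::euclidean_space) vbundle \<Rightarrow> ('a, 'v) der \<Rightarrow>
    ('a \<Rightarrow> real) \<Rightarrow> 'a \<Rightarrow> real" where
  "anchor E D f x = symbol E x (value_at x D) f"

lemma value_at_add: "value_at x (D + R) = value_at x D + value_at x R"
  and value_at_cscale: "value_at x (a *\<^sub>R D) = a *\<^sub>R value_at x D"
  and value_at_fscale: "value_at x (fscale f D) = f x *\<^sub>R value_at x D"
  and value_at_0: "value_at x 0 = 0"
  by (auto simp: value_at_def fscale_def plus_fun_def scaleR_fun_def zero_fun_def)

lemma derivationsD:
  assumes "D \<in> derivations E"
  shows "u \<in> sections E \<Longrightarrow> D u \<in> sections E"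
    and "u \<in> sections E \<Longrightarrow> w \<in> sections E \<Longrightarrow> D (\<lambda>x. u x + w x) = (\<lambda>x. D u x + D w x)"
    and "u \<notin> sections E \<Longrightarrow> D u = (\<lambda>x. 0)"
  using assms by (auto simp: derivations_def lin_on_def plus_fun_def zero_fun_def)

context smooth_bundle
begin

text \<open>Linearity over the reals is the Leibniz rule for constant functions.\<close>

lemma derivationI:
  assumes "\<And>u. u \<in> sections E \<Longrightarrow> D u \<in> sections E" "\<And>u. u \<notin> sections E \<Longrightarrow> D u = (\<lambda>x. 0)"
    and "\<And>u w x. u \<in> sections E \<Longrightarrow> w \<in> sections E \<Longrightarrow> D (\<lambda>x. u x + w x) x = D u x + D w x"
    and X: "vector_field E X"
    and leib: "\<And>f u x. f \<in> Cinf E \<Longrightarrow> u \<in> sections E \<Longrightarrow> D (\<lambda>x. f x *\<^sub>R u x) x = X f x *\<^sub>R u x + f x *\<^sub>R D u x"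
  shows "D \<in> derivations E"
proof -
  have "X (\<lambda>x. a) y = 0" for a y
  proof -
    have "X (\<lambda>x. 1) y = 0"
      using vector_field_rules(4)[OF X Cinf_const[OF mfd, of 1] Cinf_const[OF mfd, of 1], where x = y] by simp
    then show ?thesis
      using vector_field_rules(2)[OF X Cinf_const[OF mfd, of 1], where x = y and a = a] by simp
  qed
  then have "D (a *\<^sub>R u) = a *\<^sub>R D u" if "u \<in> sections E" for a u
    using leib[OF Cinf_const[OF mfd] that, of a] by (auto simp: scaleR_fun_def)
  moreover have "D (u + w) = D u + D w" if "u \<in> sections E" "w \<in> sections E" for u w
    using assms(3)[OF that] by (auto simp: plus_fun_def)
  moreover have "\<exists>X. vector_field E X \<and> (\<forall>f\<in>Cinf E. \<forall>u\<in>sections E.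
      D (\<lambda>x. f x *\<^sub>R u x) = (\<lambda>x. X f x *\<^sub>R u x + f x *\<^sub>R D u x))"
    using X leib by (intro exI[of _ X]) auto
  ultimately show ?thesis
    unfolding derivations_def lin_on_def using assms(1,2) by (simp add: zero_fun_def image_subset_iff)
qed

lemma section_through:
  assumes "e \<in> fib E x" obtains u where "u \<in> sections E" "u x = e"
proof -
  obtain B \<beta> y P s \<omega> where "local_frame E B \<beta> y P s \<omega>" and nz: "\<beta> x \<noteq> 0"
    using local_frame_exists[ of x] by blast
  then interpret local_frame E B \<beta> y P s \<omega> by simp
  define u where "u z = (\<Sum>j\<in>Basis. (\<omega> j x e / \<beta> x ^ 2) *\<^sub>R s j z)" for z
  have "u = (\<lambda>z. \<Sum>j\<in>Basis. (\<omega> j x e / \<beta> x ^ 2) *\<^sub>R s j z)" by (auto simp: u_def)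
  then have "u \<in> sections E" by (simp add: sections_sum sections_cscale s)
  moreover have "u x = e"
  proof -
    have "u x = (1 / \<beta> x ^ 2) *\<^sub>R (\<Sum>j\<in>Basis. \<omega> j x e *\<^sub>R s j x)"
      by (simp add: u_def scaleR_sum_right)
    then show ?thesis using s_expand[OF assms] nz by simp
  qed
  ultimately show ?thesis using that by blast
qed

lemma section_nonzero: obtains u where "u \<in> sections E" "u x \<noteq> 0"
proof -
  obtain B \<beta> y P s \<omega> where "local_frame E B \<beta> y P s \<omega>" and nz: "\<beta> x \<noteq> 0"
    using local_frame_exists[ of x] by blast
  then interpret local_frame E B \<beta> y P s \<omega> by simp
  obtain j :: 'f where j: "j \<in> Basis" using nonempty_Basis by blast
  have "\<omega> j x (s j x) \<noteq> 0" using s_dual[OF j j, of x] nz by simp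
  then have "s j x \<noteq> 0" using lin_on_0[OF \<omega>_lin fib_subspace] by metis
  then show ?thesis using that s by blast
qed

text \<open>The symbol is unique because some section does not vanish at \<open>x\<close>.\<close>

lemma symbol_eqI:
  assumes "v \<in> tangent_space E x"
    and "\<And>f u. f \<in> Cinf E \<Longrightarrow> u \<in> sections E \<Longrightarrow> \<delta> (\<lambda>y. f y *\<^sub>R u y) = v f *\<^sub>R u x + f x *\<^sub>R \<delta> u"
  shows "symbol E x \<delta> = v"
  unfolding symbol_def
proof (rule the_equality)
  show "v \<in> tangent_space E x \<and> (\<forall>f\<in>Cinf E. \<forall>u\<in>sections E. \<delta> (\<lambda>y. f y *\<^sub>R u y) = v f *\<^sub>R u x + f x *\<^sub>R \<delta> u)"
    using assms by blast
  fix w assume w: "w \<in> tangent_space E x \<and> (\<forall>f\<in>Cinf E. \<forall>u\<in>sections E. \<delta> (\<lambda>y. f y *\<^sub>R u y) = w f *\<^sub>R u x + f x *\<^sub>R \<delta> u)"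
  obtain u where u: "u \<in> sections E" "u x \<noteq> 0" using section_nonzero by blast
  show "w = v"
  proof
    fix f show "w f = v f"
    proof (cases "f \<in> Cinf E")
      case True
      then have "v f *\<^sub>R u x + f x *\<^sub>R \<delta> u = w f *\<^sub>R u x + f x *\<^sub>R \<delta> u"
        using assms(2)[OF True u(1)] w u(1) by metis
      then show ?thesis using u(2) by simp
    next
      case False
      have "w \<in> tangent_space E x" using w by simp
      then show ?thesis using tangentD(3)[OF _ False] assms(1) by metis
    qed
  qed
qed

lemma anchor_eqI:
  assumes "vector_field E X"
    and "\<And>f u x. f \<in> Cinf E \<Longrightarrow> u \<in> sections E \<Longrightarrow> D (\<lambda>x. f x *\<^sub>R u x) x = X f x *\<^sub>R u x + f x *\<^sub>R D u x"
  shows "anchor E D = X"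
proof (intro ext)
  fix f x
  have "symbol E x (value_at x D) = (\<lambda>f. X f x)"
    using assms vector_fieldD(1)[OF assms(1)] by (intro symbol_eqI) (auto simp: value_at_def)
  then show "anchor E D f x = X f x" by (simp add: anchor_def)
qed

lemma
  assumes "D \<in> derivations E"
  shows anchor_vector_field: "vector_field E (anchor E D)"
    and der_leibniz: "f \<in> Cinf E \<Longrightarrow> u \<in> sections E \<Longrightarrow>
      D (\<lambda>x. f x *\<^sub>R u x) = (\<lambda>x. anchor E D f x *\<^sub>R u x + f x *\<^sub>R D u x)"
proof -
  obtain X where X: "vector_field E X" "\<And>f u. f \<in> Cinf E \<Longrightarrow> u \<in> sections E \<Longrightarrow>
      D (\<lambda>x. f x *\<^sub>R u x) = (\<lambda>x. X f x *\<^sub>R u x + f x *\<^sub>R D u x)"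
    using assms by (auto simp: derivations_def)
  have *: "anchor E D = X" using X(2) by (intro anchor_eqI[OF X(1)]) simp
  show "vector_field E (anchor E D)"
    "f \<in> Cinf E \<Longrightarrow> u \<in> sections E \<Longrightarrow>
      D (\<lambda>x. f x *\<^sub>R u x) = (\<lambda>x. anchor E D f x *\<^sub>R u x + f x *\<^sub>R D u x)"
    unfolding * using X by auto
qed

lemma der_cscale:
  assumes "D \<in> derivations E" "u \<in> sections E"
  shows "D (\<lambda>x. a *\<^sub>R u x) = (\<lambda>x. a *\<^sub>R D u x)"
  using assms by (auto simp: derivations_def lin_on_def scaleR_fun_def)

lemma der_diff:
  assumes "D \<in> derivations E" "u \<in> sections E" "w \<in> sections E"
  shows "D (\<lambda>x. u x - w x) = (\<lambda>x. D u x - D w x)"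
  using derivationsD(2)[OF assms(1,2) sections_cscale[OF assms(3), of "-1"]] der_cscale[OF assms(1,3), of "-1"]
  by simp

lemma der_0: assumes "D \<in> derivations E" shows "D (\<lambda>x. 0) = (\<lambda>x. 0)"
  using der_cscale[OF assms sections_0, of 0] by simp

lemma der_sum:
  assumes "D \<in> derivations E" "\<And>i. i \<in> I \<Longrightarrow> u i \<in> sections E"
  shows "D (\<lambda>x. \<Sum>i\<in>I. u i x) = (\<lambda>x. \<Sum>i\<in>I. D (u i) x)"
  using assms(2)
  by (induction I rule: infinite_finite_induct)
    (simp_all add: der_0[OF assms(1)] derivationsD(2)[OF assms(1)] sections_sum)

lemma
  assumes D: "D \<in> derivations E" and R: "R \<in> derivations E"
  shows derivations_add: "D + R \<in> derivations E"
    and anchor_add: "anchor E (D + R) = (\<lambda>f x. anchor E D f x + anchor E R f x)"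
proof -
  have vf: "vector_field E (\<lambda>f x. anchor E D f x + anchor E R f x)"
    by (intro vector_field_add mfd anchor_vector_field assms)
  have l: "(D + R) (\<lambda>x. f x *\<^sub>R u x) x = (anchor E D f x + anchor E R f x) *\<^sub>R u x + f x *\<^sub>R (D + R) u x"
    if "f \<in> Cinf E" "u \<in> sections E" for f u x
    by (simp add: plus_fun_def der_leibniz[OF D that] der_leibniz[OF R that] algebra_simps)
  show "D + R \<in> derivations E"
    by (rule derivationI[OF _ _ _ vf l])
      (auto simp: plus_fun_def derivationsD[OF D] derivationsD[OF R] sections_add)
  show "anchor E (D + R) = (\<lambda>f x. anchor E D f x + anchor E R f x)"
    by (rule anchor_eqI[OF vf l])
qed

lemma
  assumes D: "D \<in> derivations E" and h: "h \<in> Cinf E"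
  shows derivations_fscale: "fscale h D \<in> derivations E"
    and anchor_fscale: "anchor E (fscale h D) = (\<lambda>f x. h x * anchor E D f x)"
proof -
  have vf: "vector_field E (\<lambda>f x. h x * anchor E D f x)"
    by (intro vector_field_scale mfd anchor_vector_field assms)
  have l: "fscale h D (\<lambda>x. f x *\<^sub>R u x) x = (h x * anchor E D f x) *\<^sub>R u x + f x *\<^sub>R fscale h D u x"
    if "f \<in> Cinf E" "u \<in> sections E" for f u x
    by (simp add: fscale_def der_leibniz[OF D that] algebra_simps)
  show "fscale h D \<in> derivations E"
    by (rule derivationI[OF _ _ _ vf l])
      (auto simp: fscale_def[abs_def] derivationsD[OF D] sections_scale[OF h] algebra_simps)
  show "anchor E (fscale h D) = (\<lambda>f x. h x * anchor E D f x)"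
    by (rule anchor_eqI[OF vf l])
qed

lemma derivations_0: "0 \<in> derivations E"
  by (rule derivationI[OF _ _ _ vector_field_0[OF mfd]]) (auto simp: zero_fun_def sections_0)

lemma derivations_cscale: "D \<in> derivations E \<Longrightarrow> a *\<^sub>R D \<in> derivations E"
  using derivations_fscale[OF _ Cinf_const[OF mfd], of D a]
  by (simp add: fscale_def[abs_def] scaleR_fun_def)

lemma derivations_subspace: "subspace (derivations E)"
  by (rule subspaceI) (auto intro: derivations_0 derivations_add derivations_cscale)

lemma derivations_commutator:
  assumes D: "D \<in> derivations E" and R: "R \<in> derivations E"
  shows "commutator D R \<in> derivations E"
proof -
  note vD = anchor_vector_field[OF D] and vR = anchor_vector_field[OF R]
  have vf: "vector_field E (\<lambda>f x. anchor E D (anchor E R f) x - anchor E R (anchor E D f) x)"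
    by (intro vector_field_bracket mfd vD vR)
  note sec = derivationsD(1)[OF D] derivationsD(1)[OF R] sections_scale
    vector_fieldD(2)[OF vD] vector_fieldD(2)[OF vR]
  have l: "commutator D R (\<lambda>x. f x *\<^sub>R u x) x =
      (anchor E D (anchor E R f) x - anchor E R (anchor E D f) x) *\<^sub>R u x + f x *\<^sub>R commutator D R u x"
    if "f \<in> Cinf E" "u \<in> sections E" for f u x
    using that by (simp add: commutator_def der_leibniz[OF D] der_leibniz[OF R] derivationsD(2)[OF D]
        derivationsD(2)[OF R] sec algebra_simps)
  show ?thesis
  proof (rule derivationI[OF _ _ _ vf l])
    show "commutator D R u \<in> sections E" if "u \<in> sections E" for u
      using sections_diff[OF sec(1)[OF sec(2)[OF that]] sec(2)[OF sec(1)[OF that]]]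
      by (simp add: commutator_def fun_diff_def)
    show "commutator D R u = (\<lambda>x. 0)" if "u \<notin> sections E" for u
      using der_0[OF D] der_0[OF R] by (auto simp: commutator_def derivationsD(3)[OF D that] derivationsD(3)[OF R that])
    show "commutator D R (\<lambda>x. u x + w x) x = commutator D R u x + commutator D R w x"
      if "u \<in> sections E" "w \<in> sections E" for u w x
      using that by (simp add: commutator_def derivationsD(2)[OF D] derivationsD(2)[OF R] sec)
  qed
qed

text \<open>The identity of \<open>\<Gamma>(E)\<close>, extended by \<open>0\<close> as all derivations are.\<close>

definition euler :: "('a, 'v) der" where "euler u = (if u \<in> sections E then u else 0)"

lemma euler_derivation: "euler \<in> derivations E" and anchor_euler: "anchor E euler = (\<lambda>f x. 0)"
proof -
  have l: "euler (\<lambda>x. f x *\<^sub>R u x) x = 0 *\<^sub>R u x + f x *\<^sub>R euler u x"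
    if "f \<in> Cinf E" "u \<in> sections E" for f u x
    using that sections_scale[OF that] by (simp add: euler_def)
  show "euler \<in> derivations E"
    by (rule derivationI[where D = euler and X = "\<lambda>f x. 0", OF _ _ _ vector_field_0[OF mfd] l])
      (auto simp: euler_def zero_fun_def sections_add)
  show "anchor E euler = (\<lambda>f x. 0)" by (rule anchor_eqI[where D = euler and X = "\<lambda>f x. 0", OF vector_field_0[OF mfd] l])
qed

lemma commutator_euler: assumes "D \<in> derivations E" shows "commutator euler D = 0"
proof
  fix u show "commutator euler D u = 0 u"
    using derivationsD(1)[OF assms, of u] derivationsD(3)[OF assms, of u] der_0[OF assms]
    by (cases "u \<in> sections E") (auto simp: commutator_def euler_def zero_fun_def sections_0)
qed

lemma gauge_subspace: "subspace (gauge_fib E x)"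
proof (rule subspaceI)
  show "0 \<in> gauge_fib E x" unfolding gauge_fib_def using derivations_0 value_at_0 by (metis imageI)
  show "\<delta> + \<epsilon> \<in> gauge_fib E x" if "\<delta> \<in> gauge_fib E x" "\<epsilon> \<in> gauge_fib E x" for \<delta> \<epsilon>
    using that derivations_add unfolding gauge_fib_def by (auto simp flip: value_at_add)
  show "a *\<^sub>R \<delta> \<in> gauge_fib E x" if "\<delta> \<in> gauge_fib E x" for \<delta> a
    using that derivations_cscale unfolding gauge_fib_def by (auto simp flip: value_at_cscale)
qed

lemma symbol_value: "symbol E x (value_at x D) = (\<lambda>f. anchor E D f x)"
  by (simp add: anchor_def)

lemma symbol_tangent: "\<delta> \<in> gauge_fib E x \<Longrightarrow> symbol E x \<delta> \<in> tangent_space E x"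
  unfolding gauge_fib_def using vector_fieldD(1)[OF anchor_vector_field] by (auto simp: symbol_value)

lemma symbol_lin: "lin_on (gauge_fib E x) (symbol E x)"
  unfolding lin_on_def
proof (intro conjI allI ballI)
  fix \<delta> \<epsilon> and a :: real assume "\<delta> \<in> gauge_fib E x"
  then obtain D where D: "D \<in> derivations E" "\<delta> = value_at x D" by (auto simp: gauge_fib_def)
  have "a *\<^sub>R \<delta> = value_at x (fscale (\<lambda>x. a) D)" by (simp add: D value_at_fscale)
  then show "symbol E x (a *\<^sub>R \<delta>) = a *\<^sub>R symbol E x \<delta>"
    by (simp add: D(2) symbol_value anchor_fscale[OF D(1) Cinf_const[OF mfd]] scaleR_fun_def)
  assume "\<epsilon> \<in> gauge_fib E x"
  then obtain R where R: "R \<in> derivations E" "\<epsilon> = value_at x R" by (auto simp: gauge_fib_def)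
  show "symbol E x (\<delta> + \<epsilon>) = symbol E x \<delta> + symbol E x \<epsilon>"
    unfolding D(2) R(2) value_at_add[symmetric] symbol_value anchor_add[OF D(1) R(1)] by (simp add: plus_fun_def)
qed

text \<open>If the symbol vanishes at \<open>x\<close>, then so does \<open>(D u)(x)\<close> whenever \<open>u(x) = 0\<close>, because \<open>\<beta>\<^sup>2 u = \<Sum>\<^sub>j \<omega>\<^sub>j(u) s\<^sub>j\<close> with
  coefficients that vanish at \<open>x\<close>. Hence \<open>(D u)(x)\<close> is a function of \<open>u(x)\<close>.\<close>

lemma kernel_symbol:
  assumes \<delta>: "\<delta> \<in> gauge_fib E x" and 0: "symbol E x \<delta> = 0"
  obtains \<Phi> where "\<Phi> \<in> endos E x" "\<delta> = endo_der E x \<Phi>"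
proof -
  obtain D where D: "D \<in> derivations E" "\<delta> = value_at x D" using \<delta> by (auto simp: gauge_fib_def)
  have anch: "anchor E D f x = 0" for f using 0 by (simp add: D(2) symbol_value fun_eq_iff)
  obtain B \<beta> y P s \<omega> where "local_frame E B \<beta> y P s \<omega>" and nz: "\<beta> x \<noteq> 0"
    using local_frame_exists[ of x] by blast
  then interpret local_frame E B \<beta> y P s \<omega> by simp
  have vanish: "D u x = 0" if u: "u \<in> sections E" "u x = 0" for u
  proof -
    have C2: "(\<lambda>x. \<beta> x ^ 2) \<in> Cinf E" by (rule Cinf_power[OF mfd \<beta>])
    have "(\<lambda>x. \<beta> x ^ 2 *\<^sub>R u x) = (\<lambda>x. \<Sum>j\<in>Basis. \<omega> j x (u x) *\<^sub>R s j x)"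
      using s_expand[OF sections_fib[OF u(1)]] by simp
    then have "D (\<lambda>x. \<beta> x ^ 2 *\<^sub>R u x) x = D (\<lambda>x. \<Sum>j\<in>Basis. \<omega> j x (u x) *\<^sub>R s j x) x" by simp
    then have "\<beta> x ^ 2 *\<^sub>R D u x = (\<Sum>j\<in>Basis. \<omega> j x (u x) *\<^sub>R D (s j) x)"
      using u by (simp add: der_sum[OF D(1)] sections_scale \<omega>_Cinf s der_leibniz[OF D(1)] C2 anch)
    also have "\<dots> = 0" using lin_on_0[OF \<omega>_lin fib_subspace] by (simp add: u(2))
    finally show ?thesis using nz by simp
  qed
  have local: "D u x = D w x" if "u \<in> sections E" "w \<in> sections E" "u x = w x" for u w
    using vanish[OF sections_diff[OF that(1,2)]] der_diff[OF D(1) that(1,2)] that(3) by simp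
  define \<Phi> where "\<Phi> e = D (SOME u. u \<in> sections E \<and> u x = e) x" for e
  have \<Phi>: "\<Phi> (u x) = D u x" if u: "u \<in> sections E" for u
  proof -
    have "(SOME w. w \<in> sections E \<and> w x = u x) \<in> sections E \<and> (SOME w. w \<in> sections E \<and> w x = u x) x = u x"
      by (rule someI[of _ u]) (simp add: u)
    then show ?thesis unfolding \<Phi>_def by (intro local u) auto
  qed
  have "\<Phi> \<in> endos E x"
    unfolding endos_def lin_on_def mem_Collect_eq
  proof (intro conjI ballI allI subsetI)
    fix d e and a :: real assume "e \<in> fib E x"
    then obtain w where w: "w \<in> sections E" "w x = e" using section_through by blast
    show "\<Phi> (a *\<^sub>R e) = a *\<^sub>R \<Phi> e"
      using \<Phi>[OF sections_cscale[OF w(1), of a]] \<Phi>[OF w(1)] der_cscale[OF D(1) w(1), of a] by (simp add: w)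
    assume "d \<in> fib E x"
    then obtain u where u: "u \<in> sections E" "u x = d" using section_through by blast
    show "\<Phi> (d + e) = \<Phi> d + \<Phi> e"
      using \<Phi>[OF sections_add[OF u(1) w(1)]] \<Phi>[OF w(1)] \<Phi>[OF u(1)] derivationsD(2)[OF D(1) u(1) w(1)] by (simp add: u w)
  next
    fix e assume "e \<in> \<Phi> ` fib E x"
    then obtain d where d: "d \<in> fib E x" "e = \<Phi> d" by blast
    then obtain u where u: "u \<in> sections E" "u x = d" using section_through by blast
    then show "e \<in> fib E x" using d \<Phi>[OF u(1)] sections_fib[OF derivationsD(1)[OF D(1) u(1)]] by simp
  qed
  moreover have "\<delta> = endo_der E x \<Phi>"
    using \<Phi> derivationsD(3)[OF D(1)] by (auto simp: D(2) value_at_def endo_der_def)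
  ultimately show ?thesis using that by blast
qed

lemma endo_der_id: "endo_der E x (\<lambda>e. e) = value_at x euler"
  by (auto simp: endo_der_def value_at_def euler_def)

end

section \<open>Frames of derivations\<close>

context local_frame
begin

text \<open>Up to the factor \<open>\<beta>\<^sup>4\<close>, this is the derivative \<open>\<partial>\<^sub>i\<close> of the components in the trivialisation. The formula applies
  \<open>P\<^sub>i\<close> to the global function \<open>\<omega>\<^sub>j(u)\<close>, which is \<open>\<beta>\<close> times a component, and subtracts the derivative of \<open>\<beta>\<close>.\<close>

definition horiz :: "'m \<Rightarrow> ('a, 'v) der" where
  "horiz i u = (if u \<in> sections E then
     (\<lambda>x. \<Sum>j\<in>Basis. (\<beta> x * P i (\<lambda>x. \<omega> j x (u x)) x - P i \<beta> x * \<omega> j x (u x)) *\<^sub>R s j x) else (\<lambda>x. 0))"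

text \<open>Up to the factor \<open>\<beta>\<^sup>2\<close>, an elementary matrix in the trivialisation.\<close>

definition vert :: "'f \<Rightarrow> 'f \<Rightarrow> ('a, 'v) der" where
  "vert j k u = (if u \<in> sections E then (\<lambda>x. \<omega> j x (u x) *\<^sub>R s k x) else (\<lambda>x. 0))"

lemma \<omega>_add: "u \<in> sections E \<Longrightarrow> w \<in> sections E \<Longrightarrow> \<omega> j x (u x + w x) = \<omega> j x (u x) + \<omega> j x (w x)"
  by (intro lin_on_addD[OF \<omega>_lin] sections_fib)

lemma \<omega>_scale: "u \<in> sections E \<Longrightarrow> \<omega> j x (a *\<^sub>R u x) = a * \<omega> j x (u x)"
  using lin_on_scaleD[OF \<omega>_lin] sections_fib by fastforce

lemmas Cinf_ops = Cinf_add[OF mfd] Cinf_mult[OF mfd] Cinf_diff[OF mfd] Cinf_const[OF mfd] Cinf_power[OF mfd]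
  Cinf_sum[OF mfd] \<beta> y \<omega>_Cinf vector_fieldD(2)[OF P]

lemma
  shows horiz_derivation: "horiz i \<in> derivations E"
    and anchor_horiz: "anchor E (horiz i) = (\<lambda>f x. \<beta> x ^ 3 * P i f x)"
proof -
  have vf: "vector_field E (\<lambda>f x. \<beta> x ^ 3 * P i f x)"
    by (intro vector_field_scale mfd P Cinf_ops)
  have l: "horiz i (\<lambda>x. f x *\<^sub>R u x) x = (\<beta> x ^ 3 * P i f x) *\<^sub>R u x + f x *\<^sub>R horiz i u x"
    if f: "f \<in> Cinf E" and u: "u \<in> sections E" for f u x
  proof -
    have "horiz i (\<lambda>x. f x *\<^sub>R u x) x = (\<Sum>j\<in>Basis. (\<beta> x * P i f x) *\<^sub>R (\<omega> j x (u x) *\<^sub>R s j x) +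
        f x *\<^sub>R ((\<beta> x * P i (\<lambda>x. \<omega> j x (u x)) x - P i \<beta> x * \<omega> j x (u x)) *\<^sub>R s j x))"
      using f u by (simp add: horiz_def sections_scale \<omega>_scale vector_field_rules(4)[OF P f \<omega>_Cinf] algebra_simps)
    also have "\<dots> = (\<beta> x * P i f x) *\<^sub>R (\<beta> x ^ 2 *\<^sub>R u x) + f x *\<^sub>R horiz i u x"
      using u by (simp only: sum.distrib scaleR_sum_right[symmetric] s_expand[OF sections_fib[OF u]] horiz_def if_True)
    finally show ?thesis by (simp add: power2_eq_square power3_eq_cube algebra_simps)
  qed
  show "horiz i \<in> derivations E"
  proof (rule derivationI[OF _ _ _ vf l])
    show "horiz i u \<in> sections E" if "u \<in> sections E" for u
      using that by (simp add: horiz_def) (intro sections_sum sections_scale Cinf_ops s; simp)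
    show "horiz i (\<lambda>x. u x + w x) x = horiz i u x + horiz i w x"
      if "u \<in> sections E" "w \<in> sections E" for u w x
      using that by (simp add: horiz_def sections_add \<omega>_add vector_field_rules(1)[OF P \<omega>_Cinf \<omega>_Cinf]
          sum.distrib[symmetric] algebra_simps)
  qed (simp add: horiz_def)
  show "anchor E (horiz i) = (\<lambda>f x. \<beta> x ^ 3 * P i f x)"
    by (rule anchor_eqI[OF vf l])
qed

lemma
  shows vert_derivation: "vert j k \<in> derivations E"
    and anchor_vert: "anchor E (vert j k) = (\<lambda>f x. 0)"
proof -
  have l: "vert j k (\<lambda>x. f x *\<^sub>R u x) x = 0 *\<^sub>R u x + f x *\<^sub>R vert j k u x"
    if f: "f \<in> Cinf E" and u: "u \<in> sections E" for f u x
    using that by (simp add: vert_def sections_scale \<omega>_scale)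
  show "vert j k \<in> derivations E"
    by (rule derivationI[where D = "vert j k" and X = "\<lambda>f x. 0", OF _ _ _ vector_field_0[OF mfd] l])
      (auto simp: vert_def sections_add sections_scale \<omega>_Cinf s \<omega>_add algebra_simps)
  show "anchor E (vert j k) = (\<lambda>f x. 0)"
    by (rule anchor_eqI[where D = "vert j k" and X = "\<lambda>f x. 0", OF vector_field_0[OF mfd] l])
qed

text \<open>Apply \<open>D\<close> to \<open>\<beta>\<^sup>2 u = \<Sum>\<^sub>j \<omega>\<^sub>j(u) s\<^sub>j\<close> and expand the symbol of \<open>D\<close> in the \<open>P\<^sub>i\<close>. Beside the horizontal part there
  remain terms that are linear in the \<open>\<omega>\<^sub>j(u)\<close>; their coefficients are sections, which are expanded in the \<open>s\<^sub>k\<close> again.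
  Each of these expansions costs some powers of \<open>\<beta>\<close>, eight in total.\<close>

lemma derivation_expand:
  assumes D: "D \<in> derivations E"
  obtains c d where "\<And>i. c i \<in> Cinf E" "\<And>j k. d j k \<in> Cinf E"
    "\<And>u x. \<beta> x ^ 8 *\<^sub>R D u x = (\<Sum>i\<in>B. c i x *\<^sub>R horiz i u x) + (\<Sum>j\<in>Basis. \<Sum>k\<in>Basis. d j k x *\<^sub>R vert j k u x)"
proof -
  define X where "X = anchor E D"
  have X: "vector_field E X" unfolding X_def by (rule anchor_vector_field[OF D])
  define a where "a i x = \<beta> x * X (y i) x - y i x * X \<beta> x" for i x
  \<comment> \<open>The \<open>a i\<close> are the coefficients of \<open>\<beta>\<^sup>3 X\<close> with respect to the \<open>P i\<close>, so \<open>A\<close> is \<open>\<beta>\<^sup>3 X(\<beta>)\<close>.\<close>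
  define A where "A x = (\<Sum>i\<in>B. a i x * P i \<beta> x)" for x
  \<comment> \<open>The coefficient of \<open>\<omega>\<^sub>j(u)\<close> in the remainder, up to \<open>\<beta>\<^sup>2\<close>. The term with \<open>A\<close> comes from the derivatives of \<open>\<beta>\<close>: twice
  in \<open>D (\<beta>\<^sup>2 u)\<close>, once in the horizontal derivations.\<close>
  define t where "t j x = \<beta> x ^ 4 *\<^sub>R D (s j) x - A x *\<^sub>R s j x" for j x
  have a: "a i \<in> Cinf E" for i
    unfolding a_def[abs_def] by (intro Cinf_ops vector_fieldD(2)[OF X])
  have A: "A \<in> Cinf E" unfolding A_def[abs_def] by (intro Cinf_ops a)
  have t: "t j \<in> sections E" for j
    unfolding t_def[abs_def]
    by (intro sections_diff sections_scale Cinf_ops A s derivationsD(1)[OF D])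
  have Xf: "\<beta> x ^ 3 * X f x = (\<Sum>i\<in>B. a i x * P i f x)" if "f \<in> Cinf E" for f x
    using expand[OF vector_fieldD(1)[OF X] that] by (simp add: a_def)
  \<comment> \<open>The powers of \<open>\<beta>\<close> balance: expanding \<open>t j\<close> in the sections \<open>s k\<close> costs a factor \<open>\<beta>\<^sup>2\<close>.\<close>
  define c where "c i x = \<beta> x ^ 2 * a i x" for i x
  define d where "d j k x = \<omega> k x (t j x)" for j k x
  show ?thesis
  proof (rule that)
    show "c i \<in> Cinf E" for i unfolding c_def[abs_def] by (intro Cinf_ops a)
    show "d j k \<in> Cinf E" for j k unfolding d_def[abs_def] by (intro Cinf_ops t)
    fix u x
    show "\<beta> x ^ 8 *\<^sub>R D u x = (\<Sum>i\<in>B. c i x *\<^sub>R horiz i u x) + (\<Sum>j\<in>Basis. \<Sum>k\<in>Basis. d j k x *\<^sub>R vert j k u x)"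
    proof (cases "u \<in> sections E")
      case u: True
      define w where "w j x = \<omega> j x (u x)" for j x
      have w: "w j \<in> Cinf E" for j unfolding w_def[abs_def] by (rule \<omega>_Cinf[OF u])
      have ws: "(\<Sum>j\<in>Basis. w j x *\<^sub>R s j x) = \<beta> x ^ 2 *\<^sub>R u x" for x
        unfolding w_def by (rule s_expand[OF sections_fib[OF u]])
      have "D (\<lambda>x. \<beta> x ^ 2 *\<^sub>R u x) x = D (\<lambda>x. \<Sum>j\<in>Basis. w j x *\<^sub>R s j x) x"
        by (simp add: ws)
      moreover have "X (\<lambda>x. \<beta> x ^ 2) x = 2 * \<beta> x * X \<beta> x"
        using vector_field_rules(4)[OF X \<beta> \<beta>] by (simp add: power2_eq_square)
      ultimately have Du: "\<beta> x ^ 2 *\<^sub>R D u x =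
          (\<Sum>j\<in>Basis. X (w j) x *\<^sub>R s j x + w j x *\<^sub>R D (s j) x) - (2 * \<beta> x * X \<beta> x) *\<^sub>R u x"
        using der_leibniz[OF D Cinf_power[OF mfd \<beta>] u, of 2]
        by (simp add: X_def[symmetric] der_sum[OF D] sections_scale w s der_leibniz[OF D] algebra_simps)
      have "\<beta> x ^ 8 *\<^sub>R D u x = \<beta> x ^ 6 *\<^sub>R (\<beta> x ^ 2 *\<^sub>R D u x)"
        by (simp add: power_add[symmetric])
      also have "\<dots> = (\<Sum>j\<in>Basis. \<beta> x ^ 6 *\<^sub>R (X (w j) x *\<^sub>R s j x + w j x *\<^sub>R D (s j) x))
          - (2 * \<beta> x ^ 5 * X \<beta> x) *\<^sub>R (\<beta> x ^ 2 *\<^sub>R u x)"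
      proof -
        have "\<beta> x ^ 6 * (2 * \<beta> x * X \<beta> x) = (2 * \<beta> x ^ 5 * X \<beta> x) * \<beta> x ^ 2"
          by (simp add: eval_nat_numeral)
        then show ?thesis unfolding Du by (simp only: scaleR_diff_right scaleR_sum_right scaleR_scaleR)
      qed
      also have "\<dots> = (\<Sum>j\<in>Basis. \<beta> x ^ 6 *\<^sub>R (X (w j) x *\<^sub>R s j x + w j x *\<^sub>R D (s j) x)
          - (2 * \<beta> x ^ 5 * X \<beta> x * w j x) *\<^sub>R s j x)"
        unfolding ws[symmetric] by (simp add: sum_subtractf scaleR_sum_right)
      also have "\<dots> = (\<Sum>j\<in>Basis. (\<Sum>i\<in>B. (c i x * (\<beta> x * P i (w j) x - P i \<beta> x * w j x)) *\<^sub>R s j x)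
          + w j x *\<^sub>R (\<beta> x ^ 2 *\<^sub>R t j x))"
      proof (rule sum.cong[OF refl])
        fix j
        have 1: "\<beta> x ^ 3 * X \<beta> x = A x" unfolding A_def by (rule Xf[OF \<beta>])
        define Q where "Q = (\<Sum>i\<in>B. c i x * (\<beta> x * P i (w j) x - P i \<beta> x * w j x))"
        have Q: "Q = \<beta> x ^ 3 * (\<beta> x ^ 3 * X (w j) x) - \<beta> x ^ 2 * A x * w j x"
          unfolding Q_def Xf[OF w] A_def sum_distrib_left sum_distrib_right sum_subtractf[symmetric]
          by (rule sum.cong) (simp_all add: c_def power2_eq_square power3_eq_cube algebra_simps)
        have "\<beta> x ^ 6 *\<^sub>R (X (w j) x *\<^sub>R s j x + w j x *\<^sub>R D (s j) x) - (2 * \<beta> x ^ 5 * X \<beta> x * w j x) *\<^sub>R s j x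
            = (\<beta> x ^ 6 * X (w j) x - 2 * \<beta> x ^ 5 * X \<beta> x * w j x) *\<^sub>R s j x + (\<beta> x ^ 6 * w j x) *\<^sub>R D (s j) x"
          by (simp add: algebra_simps)
        also have "\<beta> x ^ 6 * X (w j) x - 2 * \<beta> x ^ 5 * X \<beta> x * w j x = Q - w j x * \<beta> x ^ 2 * A x"
          unfolding Q 1[symmetric] by (simp add: eval_nat_numeral algebra_simps)
        also have "\<beta> x ^ 6 * w j x = w j x * \<beta> x ^ 2 * \<beta> x ^ 4"
          by (simp add: power_add[symmetric])
        also have "(Q - w j x * \<beta> x ^ 2 * A x) *\<^sub>R s j x + (w j x * \<beta> x ^ 2 * \<beta> x ^ 4) *\<^sub>R D (s j) x =
            Q *\<^sub>R s j x + w j x *\<^sub>R (\<beta> x ^ 2 *\<^sub>R t j x)"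
          by (simp add: t_def algebra_simps)
        finally show "\<beta> x ^ 6 *\<^sub>R (X (w j) x *\<^sub>R s j x + w j x *\<^sub>R D (s j) x) - (2 * \<beta> x ^ 5 * X \<beta> x * w j x) *\<^sub>R s j x
          = (\<Sum>i\<in>B. (c i x * (\<beta> x * P i (w j) x - P i \<beta> x * w j x)) *\<^sub>R s j x) + w j x *\<^sub>R (\<beta> x ^ 2 *\<^sub>R t j x)"
          unfolding scaleR_sum_left[symmetric] Q_def .
      qed
      also have "\<dots> = (\<Sum>i\<in>B. c i x *\<^sub>R horiz i u x) + (\<Sum>j\<in>Basis. \<Sum>k\<in>Basis. d j k x *\<^sub>R vert j k u x)"
      proof -
        have "(\<Sum>k\<in>Basis. d j k x *\<^sub>R vert j k u x) = w j x *\<^sub>R (\<beta> x ^ 2 *\<^sub>R t j x)" for j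
          using s_expand[OF sections_fib[OF t], of x j, symmetric] u
          by (simp add: d_def vert_def w_def scaleR_sum_right mult.commute)
        moreover have "(\<Sum>i\<in>B. c i x *\<^sub>R horiz i u x) =
            (\<Sum>j\<in>Basis. \<Sum>i\<in>B. (c i x * (\<beta> x * P i (w j) x - P i \<beta> x * w j x)) *\<^sub>R s j x)"
          using u by (subst sum.swap) (simp add: horiz_def w_def[abs_def] scaleR_sum_right)
        ultimately show ?thesis by (simp add: sum.distrib)
      qed
      finally show ?thesis .
    qed (simp add: derivationsD(3)[OF D] horiz_def vert_def)
  qed
qed

text \<open>In a relation applied to \<open>f u\<close>, the Leibniz rule isolates the symbols of the horizontal part. The dual coordinates
  then annihilate its coefficients, and what is left is a relation between elementary matrices.\<close>

lemma frame_independent: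
  assumes nz: "\<beta> x \<noteq> 0"
    and 0: "\<And>u. (\<Sum>i\<in>B. c i *\<^sub>R horiz i u x) + (\<Sum>j\<in>Basis. \<Sum>k\<in>Basis. d j k *\<^sub>R vert j k u x) = 0"
  shows "i \<in> B \<Longrightarrow> c i = 0" "j \<in> Basis \<Longrightarrow> k \<in> Basis \<Longrightarrow> d j k = 0"
proof -
  have sym: "(\<Sum>i\<in>B. c i * P i f x) = 0" if f: "f \<in> Cinf E" for f
  proof -
    obtain u where u: "u \<in> sections E" "u x \<noteq> 0" using section_nonzero by blast
    have "0 = (\<Sum>i\<in>B. c i *\<^sub>R horiz i (\<lambda>x. f x *\<^sub>R u x) x) + (\<Sum>j\<in>Basis. \<Sum>k\<in>Basis. d j k *\<^sub>R vert j k (\<lambda>x. f x *\<^sub>R u x) x)"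
      using 0 by simp
    also have "\<dots> = (\<Sum>i\<in>B. (\<beta> x ^ 3 * (c i * P i f x)) *\<^sub>R u x) + f x *\<^sub>R
        ((\<Sum>i\<in>B. c i *\<^sub>R horiz i u x) + (\<Sum>j\<in>Basis. \<Sum>k\<in>Basis. d j k *\<^sub>R vert j k u x))"
      by (simp add: der_leibniz[OF horiz_derivation f u(1)] der_leibniz[OF vert_derivation f u(1)]
          anchor_horiz anchor_vert sum.distrib[symmetric] scaleR_sum_right algebra_simps)
    also have "\<dots> = (\<beta> x ^ 3 * (\<Sum>i\<in>B. c i * P i f x)) *\<^sub>R u x"
      unfolding 0 by (simp add: scaleR_sum_left sum_distrib_left)
    finally show ?thesis using u(2) nz by auto
  qed
  have c: "c k = 0" if k: "k \<in> B" for k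
  proof -
    have "(\<Sum>i\<in>B. c i * (\<beta> x * P i (y k) x - P i \<beta> x * y k x)) =
        \<beta> x * (\<Sum>i\<in>B. c i * P i (y k) x) - y k x * (\<Sum>i\<in>B. c i * P i \<beta> x)"
      by (simp add: sum_distrib_left sum_subtractf[symmetric] algebra_simps)
    also have "\<dots> = 0" by (simp add: sym y \<beta>)
    finally have "(\<Sum>i\<in>B. if i = k then c k * \<beta> x ^ 3 else 0) = 0"
      by (simp add: dual[OF _ k] if_distrib cong: if_cong sum.cong)
    then show ?thesis using k B nz by simp
  qed
  then show "i \<in> B \<Longrightarrow> c i = 0" .
  assume j: "j \<in> Basis" and k: "k \<in> Basis"
  have "(\<Sum>i\<in>Basis. \<Sum>l\<in>Basis. d i l *\<^sub>R vert i l (s j) x) = 0"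
    using 0[of "s j"] by (simp add: c)
  moreover have "(\<Sum>l\<in>Basis. d i l *\<^sub>R vert i l (s j) x) = (if i = j then \<Sum>l\<in>Basis. (d j l * \<beta> x ^ 2) *\<^sub>R s l x else 0)"
    if "i \<in> Basis" for i
    using that j by (simp add: vert_def s s_dual)
  ultimately have "(\<Sum>l\<in>Basis. (d j l * \<beta> x ^ 2) *\<^sub>R s l x) = 0" using j by simp
  then have "\<omega> k x (\<Sum>l\<in>Basis. (d j l * \<beta> x ^ 2) *\<^sub>R s l x) = 0"
    using lin_on_0[OF \<omega>_lin fib_subspace] by simp
  moreover have "\<omega> k x (\<Sum>l\<in>Basis. (d j l * \<beta> x ^ 2) *\<^sub>R s l x) = (\<Sum>l\<in>Basis. (d j l * \<beta> x ^ 2) *\<^sub>R \<omega> k x (s l x))"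
    by (rule lin_on_sum[OF \<omega>_lin fib_subspace]) (rule sections_fib[OF s])
  ultimately have "(\<Sum>l\<in>Basis. if l = k then d j l * \<beta> x ^ 4 else 0) = 0"
    using k by (simp add: s_dual if_distrib eq_commute[of k] power_add[symmetric] cong: if_cong sum.cong)
  then show "d j k = 0" using k nz by simp
qed

lemma symbol_surjective:
  assumes nz: "\<beta> x \<noteq> 0" and v: "v \<in> tangent_space E x"
  obtains \<delta> where "\<delta> \<in> gauge_fib E x" "symbol E x \<delta> = v"
proof -
  define a where "a i = (\<beta> x * v (y i) - y i x * v \<beta>) / \<beta> x ^ 6" for i
  define \<delta> where "\<delta> = (\<Sum>i\<in>B. a i *\<^sub>R value_at x (horiz i))"
  have g: "value_at x (horiz i) \<in> gauge_fib E x" for i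
    unfolding gauge_fib_def using horiz_derivation by blast
  have "symbol E x \<delta> = (\<Sum>i\<in>B. a i *\<^sub>R symbol E x (value_at x (horiz i)))"
    unfolding \<delta>_def by (rule lin_on_sum[OF symbol_lin gauge_subspace g])
  also have "\<dots> = v"
  proof
    fix f
    have "(\<Sum>i\<in>B. a i *\<^sub>R symbol E x (value_at x (horiz i))) f = (\<Sum>i\<in>B. a i * (\<beta> x ^ 3 * P i f x))"
      by (simp add: sum_fun_apply scaleR_fun_def symbol_value anchor_horiz)
    also have "\<dots> = (\<Sum>i\<in>B. (\<beta> x * v (y i) - y i x * v \<beta>) * P i f x) / \<beta> x ^ 3"
      unfolding sum_divide_distrib using nz
      by (intro sum.cong) (auto simp: a_def field_simps power_add[symmetric])
    also have "\<dots> = v f"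
    proof (cases "f \<in> Cinf E")
      case True
      then show ?thesis using expand[OF v True, symmetric] nz by simp
    next
      case False
      then show ?thesis using tangentD(3)[OF v False] vector_field_rules(3)[OF P False] by simp
    qed
    finally show "(\<Sum>i\<in>B. a i *\<^sub>R symbol E x (value_at x (horiz i))) f = v f" .
  qed
  finally have "symbol E x \<delta> = v" .
  moreover have "\<delta> \<in> gauge_fib E x"
    unfolding \<delta>_def by (intro subspace_sum subspace_scale gauge_subspace g)
  ultimately show ?thesis using that by blast
qed

end

lemma indexed_independent:
  fixes f :: "'i \<Rightarrow> 'b::real_vector"
  assumes "finite I" and ind: "\<And>c. (\<Sum>i\<in>I. c i *\<^sub>R f i) = 0 \<Longrightarrow> \<forall>i\<in>I. c i = 0"
  shows "inj_on f I" "independent (f ` I)"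
proof -
  show inj: "inj_on f I"
  proof (rule inj_onI, rule ccontr)
    fix i j assume ij: "i \<in> I" "j \<in> I" "f i = f j" "i \<noteq> j"
    define c :: "'i \<Rightarrow> real" where "c k = (if k = i then 1 else if k = j then -1 else 0)" for k
    have "(\<Sum>k\<in>I. c k *\<^sub>R f k) = (\<Sum>k\<in>I. (if k = i then f i else 0) + (if k = j then - f j else 0))"
      using ij by (intro sum.cong) (auto simp: c_def)
    also have "\<dots> = 0" using ij assms(1) by (simp add: sum.distrib)
    finally show False using ind[of c] ij by (auto simp: c_def)
  qed
  show "independent (f ` I)"
  proof
    assume "dependent (f ` I)"
    then obtain c where c: "\<exists>v\<in>f ` I. c v \<noteq> 0" "(\<Sum>v\<in>f ` I. c v *\<^sub>R v) = 0"
      using dependent_finite[of "f ` I"] assms(1) by auto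
    have "(\<Sum>i\<in>I. c (f i) *\<^sub>R f i) = 0" using c(2) inj by (simp add: sum.reindex)
    then show False using ind c(1) by fastforce
  qed
qed

text \<open>The derivations \<open>Ds\<close> form a frame of \<open>\<D>E\<close> where \<open>\<psi>\<close> does not vanish. The expansions of \<open>\<psi> D\<close>, instead of \<open>D\<close>, have global
  smooth coefficients.\<close>

definition gauge_frame ::
  "('a, 'm::euclidean_space, 'v::real_vector, 'f::euclidean_space) vbundle \<Rightarrow> ('a, 'v) der list \<Rightarrow> ('a \<Rightarrow> real) \<Rightarrow> bool" where
  "gauge_frame E Ds \<psi> \<longleftrightarrow> set Ds \<subseteq> derivations E \<and> \<psi> \<in> Cinf E \<and>
    (\<forall>x. \<psi> x \<noteq> 0 \<longrightarrow> distinct (map (value_at x) Ds) \<and> independent (value_at x ` set Ds)) \<and>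
    (\<forall>D\<in>derivations E. \<exists>c. (\<forall>R\<in>set Ds. c R \<in> Cinf E) \<and>
      (\<forall>u x. \<psi> x *\<^sub>R D u x = (\<Sum>R\<in>set Ds. c R x *\<^sub>R R u x)))"

text \<open>The length of the frame is the same at all points; it will be the rank of the graph.\<close>

lemma (in smooth_bundle) gauge_frame_exists:
  obtains Ds \<psi> where "gauge_frame E Ds \<psi>" "\<psi> p \<noteq> 0" "length Ds = dim (model E) + DIM('f) * DIM('f)"
proof -
  obtain B \<beta> y P s \<omega> where "local_frame E B \<beta> y P s \<omega>" and nzp: "\<beta> p \<noteq> 0"
    using local_frame_exists[ of p] by blast
  then interpret local_frame E B \<beta> y P s \<omega> by simp
  define I where "I = B <+> ((Basis :: 'f set) \<times> (Basis :: 'f set))"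
  define F where "F = case_sum horiz (\<lambda>(j, k). vert j k)"
  have fin: "finite I" using B by (simp add: I_def)
  have sumI: "(\<Sum>i\<in>I. g i) = (\<Sum>i\<in>B. g (Inl i)) + (\<Sum>j\<in>Basis. \<Sum>k\<in>Basis. g (Inr (j, k)))"
    for g :: "'m + 'f \<times> 'f \<Rightarrow> 'v"
    using B by (simp add: I_def sum.Plus comp_def sum.cartesian_product split_beta)
  have ind: "inj_on (\<lambda>i. value_at x (F i)) I \<and> independent ((\<lambda>i. value_at x (F i)) ` I)" if nz: "\<beta> x \<noteq> 0" for x
  proof -
    have *: "\<forall>i\<in>I. c i = 0" if c: "(\<Sum>i\<in>I. c i *\<^sub>R value_at x (F i)) = 0" for c
    proof -
      have "(\<Sum>i\<in>I. c i *\<^sub>R F i u x) = 0" for u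
        using fun_cong[OF c, of u] by (simp add: sum_fun_apply scaleR_fun_def value_at_def)
      then have "(\<Sum>i\<in>B. c (Inl i) *\<^sub>R horiz i u x) + (\<Sum>j\<in>Basis. \<Sum>k\<in>Basis. c (Inr (j, k)) *\<^sub>R vert j k u x) = 0" for u
        unfolding sumI by (simp add: F_def)
      from frame_independent[OF nz this] show ?thesis by (auto simp: I_def)
    qed
    show ?thesis
      using indexed_independent[of I "\<lambda>i. value_at x (F i)", OF fin *] by simp
  qed
  obtain js where js: "set js = I" "distinct js" using finite_distinct_list[OF fin] by blast
  define Ds where "Ds = map F js"
  have "inj_on (\<lambda>i. value_at p (F i)) I" using ind nzp by blast
  then have injF: "inj_on F I" by (auto simp: inj_on_def)
  have sumDs: "(\<Sum>R\<in>set Ds. g R) = (\<Sum>i\<in>I. g (F i))" for g :: "('a, 'v) der \<Rightarrow> 'v"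
    using injF by (simp add: Ds_def js(1) sum.reindex)
  have "gauge_frame E Ds (\<lambda>x. \<beta> x ^ 8)"
    unfolding gauge_frame_def
  proof (intro conjI allI impI ballI)
    show "set Ds \<subseteq> derivations E"
      using horiz_derivation vert_derivation by (auto simp: Ds_def F_def js(1) I_def)
    show "(\<lambda>x. \<beta> x ^ 8) \<in> Cinf E" by (rule Cinf_power[OF mfd \<beta>])
    fix x assume "\<beta> x ^ 8 \<noteq> 0"
    then have nz: "\<beta> x \<noteq> 0" by simp
    show "distinct (map (value_at x) Ds)"
      using ind[OF nz] js by (simp add: Ds_def distinct_map comp_def)
    show "independent (value_at x ` set Ds)"
      using ind[OF nz] by (simp add: Ds_def js(1) image_image)
  next
    fix D assume D: "D \<in> derivations E"
    obtain c d where cd: "\<And>i. c i \<in> Cinf E" "\<And>j k. d j k \<in> Cinf E"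
      "\<And>u x. \<beta> x ^ 8 *\<^sub>R D u x = (\<Sum>i\<in>B. c i x *\<^sub>R horiz i u x) + (\<Sum>j\<in>Basis. \<Sum>k\<in>Basis. d j k x *\<^sub>R vert j k u x)"
      using derivation_expand[OF D] by blast
    define h where "h R = case_sum c (\<lambda>(j, k). d j k) (inv_into I F R)" for R
    have h: "h (F i) = case_sum c (\<lambda>(j, k). d j k) i" if "i \<in> I" for i
      using injF that by (simp add: h_def)
    have "(\<Sum>R\<in>set Ds. h R x *\<^sub>R R u x) = \<beta> x ^ 8 *\<^sub>R D u x" for u x
    proof -
      have "(\<Sum>R\<in>set Ds. h R x *\<^sub>R R u x) = (\<Sum>i\<in>I. case_sum c (\<lambda>(j, k). d j k) i x *\<^sub>R F i u x)"
        unfolding sumDs by (rule sum.cong) (simp_all add: h)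
      then show ?thesis unfolding sumI cd(3) by (simp add: F_def)
    qed
    moreover have "\<forall>R\<in>set Ds. h R \<in> Cinf E"
      using cd(1,2) by (auto simp: Ds_def h js(1) split: sum.split)
    ultimately show "\<exists>c. (\<forall>R\<in>set Ds. c R \<in> Cinf E) \<and> (\<forall>u x. \<beta> x ^ 8 *\<^sub>R D u x = (\<Sum>R\<in>set Ds. c R x *\<^sub>R R u x))"
      by (intro exI[of _ h]) simp
  qed
  moreover have "length Ds = dim (model E) + DIM('f) * DIM('f)"
  proof -
    have "length Ds = card I" using js by (simp add: Ds_def flip: distinct_card)
    then show ?thesis using B by (simp add: I_def card_Plus)
  qed
  moreover have "\<beta> p ^ 8 \<noteq> 0" using nzp by simp
  ultimately show ?thesis using that by blast
qed

section \<open>Tensorial alternating maps\<close>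

context smooth_bundle
begin

lemmas der_closed = derivations_add derivations_fscale derivations_commutator derivations_0

definition der_lists :: "nat \<Rightarrow> ('a, 'v) der list set" where
  "der_lists k = {Ds. length Ds = k \<and> set Ds \<subseteq> derivations E}"

lemma der_lists_0 [simp]: "Ds \<in> der_lists 0 \<longleftrightarrow> Ds = []"
  and der_lists_Cons [simp]: "D # Ds \<in> der_lists (Suc k) \<longleftrightarrow> D \<in> derivations E \<and> Ds \<in> der_lists k"
  and der_lists_Nil [simp]: "[] \<in> der_lists k \<longleftrightarrow> k = 0"
  by (auto simp: der_lists_def)

lemma der_lists_SucE:
  assumes "Ds \<in> der_lists (Suc k)"
  obtains R Rs where "Ds = R # Rs" "R \<in> derivations E" "Rs \<in> der_lists k"
  using assms by (cases Ds) auto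

lemma der_lists_del: "Ds \<in> der_lists (Suc k) \<Longrightarrow> j < Suc k \<Longrightarrow> del j Ds \<in> der_lists k"
  by (auto simp: der_lists_def del_def dest: in_set_takeD in_set_dropD)

lemma der_lists_nth: "Ds \<in> der_lists k \<Longrightarrow> j < k \<Longrightarrow> Ds ! j \<in> derivations E"
  by (auto simp: der_lists_def)

text \<open>Alternating maps of \<open>k\<close> derivations to sections that are linear over \<open>C\<^sup>\<infinity>(M)\<close>. The conditions are on the first
  slot, and on the first two, only; the recursion imposes them on every map obtained by fixing the first few
  arguments, which gives them for all slots.\<close>

fun tensorial :: "nat \<Rightarrow> (('a, 'v) der list \<Rightarrow> 'a \<Rightarrow> 'v) \<Rightarrow> bool" where
  "tensorial 0 F \<longleftrightarrow> F [] \<in> sections E"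
| "tensorial (Suc k) F \<longleftrightarrow>
     (\<forall>D\<in>derivations E. tensorial k (\<lambda>Ds. F (D # Ds))) \<and>
     (\<forall>D\<in>derivations E. \<forall>R\<in>derivations E. \<forall>Ds\<in>der_lists k. F ((D + R) # Ds) = F (D # Ds) + F (R # Ds)) \<and>
     (\<forall>f\<in>Cinf E. \<forall>D\<in>derivations E. \<forall>Ds\<in>der_lists k. F (fscale f D # Ds) = (\<lambda>x. f x *\<^sub>R F (D # Ds) x)) \<and>
     (\<forall>D\<in>derivations E. \<forall>Ds. D # Ds \<in> der_lists k \<longrightarrow> F (D # D # Ds) = 0)"

lemma tensorialD:
  assumes "tensorial (Suc k) F"
  shows "D \<in> derivations E \<Longrightarrow> tensorial k (\<lambda>Ds. F (D # Ds))"
    and "D \<in> derivations E \<Longrightarrow> R \<in> derivations E \<Longrightarrow> Ds \<in> der_lists k \<Longrightarrow> F ((D + R) # Ds) = F (D # Ds) + F (R # Ds)"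
    and "f \<in> Cinf E \<Longrightarrow> D \<in> derivations E \<Longrightarrow> Ds \<in> der_lists k \<Longrightarrow> F (fscale f D # Ds) = (\<lambda>x. f x *\<^sub>R F (D # Ds) x)"
    and "D \<in> derivations E \<Longrightarrow> D # Ds \<in> der_lists k \<Longrightarrow> F (D # D # Ds) = 0"
  using assms by simp_all

declare tensorial.simps(2) [simp del]

lemma tensorial_SucI:
  assumes "\<And>D. D \<in> derivations E \<Longrightarrow> tensorial k (\<lambda>Ds. F (D # Ds))"
    and "\<And>D R Ds. D \<in> derivations E \<Longrightarrow> R \<in> derivations E \<Longrightarrow> Ds \<in> der_lists k \<Longrightarrow> F ((D + R) # Ds) = F (D # Ds) + F (R # Ds)"
    and "\<And>f D Ds. f \<in> Cinf E \<Longrightarrow> D \<in> derivations E \<Longrightarrow> Ds \<in> der_lists k \<Longrightarrow> F (fscale f D # Ds) = (\<lambda>x. f x *\<^sub>R F (D # Ds) x)"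
    and "\<And>D Ds k'. k = Suc k' \<Longrightarrow> D \<in> derivations E \<Longrightarrow> Ds \<in> der_lists k' \<Longrightarrow> F (D # D # Ds) = 0"
  shows "tensorial (Suc k) F"
  unfolding tensorial.simps(2) using assms by (cases k) auto

lemma tensorial_section: "tensorial k F \<Longrightarrow> Ds \<in> der_lists k \<Longrightarrow> F Ds \<in> sections E"
proof (induction k arbitrary: F Ds)
  case (Suc k)
  from Suc.prems(2) obtain R Rs where "Ds = R # Rs" "R \<in> derivations E" "Rs \<in> der_lists k" by (rule der_lists_SucE)
  then show ?case using Suc.IH[OF tensorialD(1)[OF Suc.prems(1)]] by simp
qed simp

lemma tensorial_comb:
  assumes "a \<in> Cinf E" "b \<in> Cinf E" "tensorial k F" "tensorial k G"
  shows "tensorial k (\<lambda>Ds x. a x *\<^sub>R F Ds x + b x *\<^sub>R G Ds x)"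
  using assms(3,4)
proof (induction k arbitrary: F G)
  case 0
  then show ?case by (simp add: sections_add sections_scale assms)
next
  case (Suc k)
  note F = tensorialD[OF Suc.prems(1)] and G = tensorialD[OF Suc.prems(2)]
  show ?case
  proof (rule tensorial_SucI)
    show "tensorial k (\<lambda>Ds x. a x *\<^sub>R F (D # Ds) x + b x *\<^sub>R G (D # Ds) x)" if "D \<in> derivations E" for D
      using Suc.IH[OF F(1) G(1), OF that that] .
    show "(\<lambda>x. a x *\<^sub>R F ((D + R) # Ds) x + b x *\<^sub>R G ((D + R) # Ds) x) =
        (\<lambda>x. a x *\<^sub>R F (D # Ds) x + b x *\<^sub>R G (D # Ds) x) + (\<lambda>x. a x *\<^sub>R F (R # Ds) x + b x *\<^sub>R G (R # Ds) x)"
      if "D \<in> derivations E" "R \<in> derivations E" "Ds \<in> der_lists k" for D R Ds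
      by (simp only: F(2)[OF that] G(2)[OF that]) (simp add: plus_fun_def algebra_simps)
  qed (simp_all add: F(3,4) G(3,4) algebra_simps zero_fun_def)
qed

lemma tensorial_diff: "tensorial k F \<Longrightarrow> tensorial k G \<Longrightarrow> tensorial k (\<lambda>Ds. F Ds - G Ds)"
  using tensorial_comb[OF Cinf_const[OF mfd, of 1] Cinf_const[OF mfd, of "-1"], of k F G] by (simp add: fun_diff_def)

lemma tensorial_zero: "D \<in> derivations E \<Longrightarrow> tensorial (Suc k) F \<Longrightarrow> Ds \<in> der_lists k \<Longrightarrow> F (0 # Ds) = 0"
  using tensorialD(2)[of k F 0 0 Ds] by (simp add: der_closed)

lemma tensorial_swap:
  assumes F: "tensorial (Suc (Suc k)) F" and D: "D \<in> derivations E" "R \<in> derivations E" "Ds \<in> der_lists k"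
  shows "F (D # R # Ds) = - F (R # D # Ds)"
proof -
  have "0 = F ((D + R) # (D + R) # Ds)"
    using tensorialD(4)[OF F, of "D + R" Ds] D by (simp add: der_closed)
  also have "\<dots> = F (D # D # Ds) + F (D # R # Ds) + (F (R # D # Ds) + F (R # R # Ds))"
    using tensorialD(2)[OF F, of D R] tensorialD(2)[OF tensorialD(1)[OF F D(1)], of D R Ds]
      tensorialD(2)[OF tensorialD(1)[OF F D(2)], of D R Ds] D by (simp add: der_closed)
  also have "\<dots> = F (D # R # Ds) + F (R # D # Ds)"
    using tensorialD(4)[OF F] D by simp
  finally show ?thesis by (simp add: eq_neg_iff_add_eq_0)
qed

section \<open>Commutators\<close>

lemma commutator_add_right:
  assumes "D \<in> derivations E" "R \<in> derivations E" "S \<in> derivations E"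
  shows "commutator D (R + S) = commutator D R + commutator D S"
proof
  fix u show "commutator D (R + S) u = (commutator D R + commutator D S) u"
  proof (cases "u \<in> sections E")
    case True
    then show ?thesis
      using derivationsD(2)[OF assms(1) derivationsD(1)[OF assms(2)] derivationsD(1)[OF assms(3)]]
      by (simp add: commutator_def plus_fun_def fun_diff_def algebra_simps)
  qed (simp add: commutator_def plus_fun_def fun_diff_def derivationsD(3)[OF assms(1)]
      derivationsD(3)[OF assms(2)] derivationsD(3)[OF assms(3)] der_0[OF assms(1)] der_0[OF assms(2)] der_0[OF assms(3)])
qed

lemma commutator_antisym: "commutator D R = - commutator R D"
  by (auto simp: commutator_def)

lemma commutator_self: "commutator D D = 0"
  by (auto simp: commutator_def zero_fun_def)

lemma commutator_add_left:
  assumes "D \<in> derivations E" "R \<in> derivations E" "S \<in> derivations E"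
  shows "commutator (D + R) S = commutator D S + commutator R S"
  unfolding commutator_antisym[of _ S] commutator_add_right[OF assms(3,1,2)] by simp

lemma commutator_fscale_right:
  assumes D: "D \<in> derivations E" and R: "R \<in> derivations E" and f: "f \<in> Cinf E"
  shows "commutator D (fscale f R) = fscale f (commutator D R) + fscale (anchor E D f) R"
proof
  fix u show "commutator D (fscale f R) u = (fscale f (commutator D R) + fscale (anchor E D f) R) u"
  proof (cases "u \<in> sections E")
    case True
    then show ?thesis
      using der_leibniz[OF D f derivationsD(1)[OF R True]]
      by (simp add: commutator_def plus_fun_def fun_diff_def fscale_def[abs_def] algebra_simps)
  qed (simp add: commutator_def plus_fun_def fun_diff_def fscale_def[abs_def] derivationsD(3)[OF D]
      derivationsD(3)[OF R] der_0[OF D] der_0[OF R])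
qed

lemma commutator_fscale_left:
  assumes D: "D \<in> derivations E" and R: "R \<in> derivations E" and f: "f \<in> Cinf E"
  shows "commutator (fscale f D) R = fscale f (commutator D R) + fscale (\<lambda>x. - anchor E R f x) D"
  unfolding commutator_antisym[of _ R] commutator_fscale_right[OF R D f]
  by (auto simp: fscale_def fun_Compl_def plus_fun_def fun_eq_iff commutator_antisym[of D R])

lemma anchor_Cinf: "D \<in> derivations E \<Longrightarrow> f \<in> Cinf E \<Longrightarrow> anchor E D f \<in> Cinf E"
  by (rule vector_fieldD(2)[OF anchor_vector_field])

section \<open>The Lie derivative\<close>

text \<open>\<open>(L\<^sub>D M)(R\<^sub>1, \<dots>, R\<^sub>k) = D (M(R\<^sub>1, \<dots>, R\<^sub>k)) - \<Sum>\<^sub>i M(R\<^sub>1, \<dots>, [D, R\<^sub>i], \<dots>, R\<^sub>k)\<close>, by recursion over the arguments.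
  The recursion is the commutation rule \<open>\<iota>\<^sub>R L\<^sub>D = L\<^sub>D \<iota>\<^sub>R - \<iota>\<^bsub>[D,R]\<^esub>\<close>.\<close>

fun lie :: "(('a, 'v) der list \<Rightarrow> 'a \<Rightarrow> 'v) \<Rightarrow> ('a, 'v) der \<Rightarrow> ('a, 'v) der list \<Rightarrow> 'a \<Rightarrow> 'v" where
  "lie M D [] = D (M [])"
| "lie M D (R # Rs) = lie (\<lambda>Ds. M (R # Ds)) D Rs - M (commutator D R # Rs)"

lemma lie_cong:
  assumes "D \<in> derivations E" "Ds \<in> der_lists k" "\<And>Ds. Ds \<in> der_lists k \<Longrightarrow> M Ds = N Ds"
  shows "lie M D Ds = lie N D Ds"
  using assms(2,3)
proof (induction k arbitrary: M N Ds)
  case (Suc k)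
  from Suc.prems(1) obtain R Rs where R: "Ds = R # Rs" "R \<in> derivations E" "Rs \<in> der_lists k" by (rule der_lists_SucE)
  have "lie (\<lambda>Ds. M (R # Ds)) D Rs = lie (\<lambda>Ds. N (R # Ds)) D Rs"
    by (rule Suc.IH) (use R Suc.prems(2) in auto)
  then show ?case using R Suc.prems(2) assms(1) by (simp add: der_closed)
qed simp

lemma lie_add:
  assumes "D \<in> derivations E" "Ds \<in> der_lists k" "tensorial k M" "tensorial k N"
  shows "lie (\<lambda>Ds. M Ds + N Ds) D Ds = lie M D Ds + lie N D Ds"
  using assms(2-4)
proof (induction k arbitrary: M N Ds)
  case 0
  then show ?case using derivationsD(2)[OF assms(1)] by (simp add: plus_fun_def)
next
  case (Suc k)
  from Suc.prems(1) obtain R Rs where R: "Ds = R # Rs" "R \<in> derivations E" "Rs \<in> der_lists k" by (rule der_lists_SucE)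
  then show ?case using Suc.IH[OF R(3) tensorialD(1)[OF Suc.prems(2) R(2)] tensorialD(1)[OF Suc.prems(3) R(2)]]
    by (simp add: algebra_simps)
qed

lemma lie_scale:
  assumes "D \<in> derivations E" "Ds \<in> der_lists k" "tensorial k M" "f \<in> Cinf E"
  shows "lie (\<lambda>Ds x. f x *\<^sub>R M Ds x) D Ds = (\<lambda>x. anchor E D f x *\<^sub>R M Ds x + f x *\<^sub>R lie M D Ds x)"
  using assms(2,3)
proof (induction k arbitrary: M Ds)
  case 0
  then show ?case using der_leibniz[OF assms(1,4)] by simp
next
  case (Suc k)
  from Suc.prems(1) obtain R Rs where R: "Ds = R # Rs" "R \<in> derivations E" "Rs \<in> der_lists k" by (rule der_lists_SucE)
  then show ?case using Suc.IH[OF R(3) tensorialD(1)[OF Suc.prems(2) R(2)]]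
    by (simp add: fun_diff_def algebra_simps)
qed

lemma lie_0: "D \<in> derivations E \<Longrightarrow> lie (\<lambda>Ds. 0) D Ds = 0"
  by (induction Ds) (simp_all add: der_0 zero_fun_def fun_diff_def)

text \<open>The derivatives of \<open>f\<close> that arise from \<open>D (f M(R, \<dots>))\<close> and from \<open>[D, f R] = f [D, R] + D(f) R\<close> cancel.\<close>

lemma tensorial_lie:
  assumes "D \<in> derivations E" "tensorial k M"
  shows "tensorial k (lie M D)"
  using assms(2)
proof (induction k arbitrary: M)
  case 0
  then show ?case using derivationsD(1)[OF assms(1)] by simp
next
  case (Suc k)
  note M = tensorialD[OF Suc.prems]
  note cc = derivations_commutator[OF assms(1)]
  show ?case
  proof (rule tensorial_SucI)
    show "tensorial k (\<lambda>Ds. lie M D (R # Ds))" if "R \<in> derivations E" for R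
      using tensorial_diff[OF Suc.IH[OF M(1)[OF that]] M(1)[OF cc[OF that]]] by simp
    show "lie M D ((R + S) # Ds) = lie M D (R # Ds) + lie M D (S # Ds)"
      if "R \<in> derivations E" "S \<in> derivations E" "Ds \<in> der_lists k" for R S Ds
    proof -
      have "lie (\<lambda>Ds. M ((R + S) # Ds)) D Ds = lie (\<lambda>Ds. M (R # Ds) + M (S # Ds)) D Ds"
        by (rule lie_cong[OF assms(1) that(3)]) (rule M(2)[OF that(1,2)])
      also have "\<dots> = lie (\<lambda>Ds. M (R # Ds)) D Ds + lie (\<lambda>Ds. M (S # Ds)) D Ds"
        by (rule lie_add[OF assms(1) that(3) M(1)[OF that(1)] M(1)[OF that(2)]])
      finally show ?thesis
        using M(2)[OF cc[OF that(1)] cc[OF that(2)] that(3)] commutator_add_right[OF assms(1) that(1,2)] by simp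
    qed
    show "lie M D (fscale f R # Ds) = (\<lambda>x. f x *\<^sub>R lie M D (R # Ds) x)"
      if "f \<in> Cinf E" "R \<in> derivations E" "Ds \<in> der_lists k" for f R Ds
    proof -
      have "lie (\<lambda>Ds. M (fscale f R # Ds)) D Ds = lie (\<lambda>Ds x. f x *\<^sub>R M (R # Ds) x) D Ds"
        by (rule lie_cong[OF assms(1) that(3)]) (rule M(3)[OF that(1,2)])
      also have "\<dots> = (\<lambda>x. anchor E D f x *\<^sub>R M (R # Ds) x + f x *\<^sub>R lie (\<lambda>Ds. M (R # Ds)) D Ds x)"
        by (rule lie_scale[OF assms(1) that(3) M(1)[OF that(2)] that(1)])
      finally show ?thesis
        using that M(2)[of "fscale f (commutator D R)" "fscale (anchor E D f) R" Ds]
          M(3)[OF that(1) cc[OF that(2)] that(3)] M(3)[OF anchor_Cinf[OF assms(1) that(1)] that(2,3)]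
        by (simp add: commutator_fscale_right[OF assms(1)] der_closed assms(1) anchor_Cinf
            plus_fun_def fun_diff_def algebra_simps)
    qed
    show "lie M D (R # R # Ds) = 0" if k: "k = Suc k'" and R: "R \<in> derivations E" "Ds \<in> der_lists k'" for R Ds k'
    proof -
      have "lie (\<lambda>Ds. M (R # R # Ds)) D Ds = lie (\<lambda>Ds. 0) D Ds"
        by (rule lie_cong[OF assms(1) R(2)]) (use M(4) R k in simp)
      then show ?thesis
        using tensorial_swap[OF Suc.prems[unfolded k] cc[OF R(1)] R] by (simp add: lie_0[OF assms(1)])
    qed
  qed
qed

lemma lie_der_add:
  assumes D: "D \<in> derivations E" "R \<in> derivations E" and "Ds \<in> der_lists k" "tensorial k M"
  shows "lie M (D + R) Ds = lie M D Ds + lie M R Ds"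
  using assms(3,4)
proof (induction k arbitrary: M Ds)
  case (Suc k)
  from Suc.prems(1) obtain S Ss where S: "Ds = S # Ss" "S \<in> derivations E" "Ss \<in> der_lists k" by (rule der_lists_SucE)
  have "M ((commutator D S + commutator R S) # Ss) = M (commutator D S # Ss) + M (commutator R S # Ss)"
    using S D by (intro tensorialD(2)[OF Suc.prems(2)] der_closed)
  then show ?case
    unfolding S(1) lie.simps commutator_add_left[OF D S(2)] Suc.IH[OF S(3) tensorialD(1)[OF Suc.prems(2) S(2)]]
    by (simp add: algebra_simps)
qed (simp add: plus_fun_def)

text \<open>The wedge product \<open>df \<and> N\<close>, where \<open>df\<close> is evaluated on derivations through their symbols.\<close>

fun d_wedge :: "('a \<Rightarrow> real) \<Rightarrow> (('a, 'v) der list \<Rightarrow> 'a \<Rightarrow> 'v) \<Rightarrow> ('a, 'v) der list \<Rightarrow> 'a \<Rightarrow> 'v" where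
  "d_wedge f N [] = 0"
| "d_wedge f N (R # Rs) = (\<lambda>x. anchor E R f x *\<^sub>R N Rs x - d_wedge f (\<lambda>Ds. N (R # Ds)) Rs x)"

lemma d_wedge_uminus:
  assumes "Ds = [] \<or> Ds \<in> der_lists (Suc k)" "\<And>Ds. Ds \<in> der_lists k \<Longrightarrow> M Ds = - N Ds"
  shows "d_wedge f M Ds = - d_wedge f N Ds"
  using assms
proof (induction Ds arbitrary: M N k)
  case (Cons R Rs)
  have Rs: "Rs \<in> der_lists k" "R \<in> derivations E" using Cons.prems(1) by auto
  have "d_wedge f (\<lambda>Ds. M (R # Ds)) Rs = - d_wedge f (\<lambda>Ds. N (R # Ds)) Rs"
  proof (cases k)
    case (Suc l)
    then show ?thesis using Rs Cons.prems(2) by (intro Cons.IH[where k = l]) auto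
  qed (use Rs in simp)
  then show ?case using Cons.prems(2)[OF Rs(1)] by (simp add: fun_Compl_def)
qed simp

text \<open>By \<open>[f D, R] = f [D, R] - R(f) D\<close>, every argument \<open>R\<close> contributes a term \<open>R(f) M(\<dots>, D, \<dots>)\<close>. With \<open>D\<close> moved to the first
  slot these terms add up to \<open>df \<and> \<iota>\<^sub>D M\<close>.\<close>

lemma lie_der_fscale:
  assumes D: "D \<in> derivations E" and f: "f \<in> Cinf E" and "Ds \<in> der_lists k" "tensorial k M"
  shows "lie M (fscale f D) Ds = (\<lambda>x. f x *\<^sub>R lie M D Ds x + d_wedge f (\<lambda>Ds. M (D # Ds)) Ds x)"
  using assms(3,4)
proof (induction k arbitrary: M Ds)
  case 0
  then show ?case by (auto simp: fscale_def)
next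
  case (Suc k)
  from Suc.prems(1) obtain R Rs where R: "Ds = R # Rs" "R \<in> derivations E" "Rs \<in> der_lists k" by (rule der_lists_SucE)
  note M = tensorialD[OF Suc.prems(2)]
  have c: "commutator D R \<in> derivations E" using D R by (intro der_closed)
  have g: "(\<lambda>x. - anchor E R f x) \<in> Cinf E" by (intro Cinf_minus mfd anchor_Cinf R f)
  have "M (commutator (fscale f D) R # Rs) = (\<lambda>x. f x *\<^sub>R M (commutator D R # Rs) x - anchor E R f x *\<^sub>R M (D # Rs) x)"
    unfolding commutator_fscale_left[OF D R(2) f]
    using M(2)[of "fscale f (commutator D R)" "fscale (\<lambda>x. - anchor E R f x) D" Rs] M(3)[OF f c R(3)] M(3)[OF g D R(3)]
    by (simp add: der_closed D R c f g plus_fun_def)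
  moreover have "d_wedge f (\<lambda>Ds. M (R # D # Ds)) Rs = - d_wedge f (\<lambda>Ds. M (D # R # Ds)) Rs"
  proof (cases k)
    case (Suc l)
    then show ?thesis using R D tensorial_swap[of l M R D] Suc.prems(2) by (intro d_wedge_uminus[where k = l]) auto
  qed (use R in simp)
  ultimately show ?case
    using Suc.IH[OF R(3) M(1)[OF R(2)]] by (simp add: R(1) fun_diff_def fun_Compl_def algebra_simps)
qed

section \<open>The differential\<close>

text \<open>The differential, with \<open>\<iota>\<^sub>D d = L\<^sub>D - d \<iota>\<^sub>D\<close> as its definition. The value on the empty list is never used as that of a
  form: it makes the recursion start correctly, since \<open>\<iota>\<^sub>D\<close> annihilates forms of degree \<open>0\<close>.\<close>

fun koszul :: "(('a, 'v) der list \<Rightarrow> 'a \<Rightarrow> 'v) \<Rightarrow> ('a, 'v) der list \<Rightarrow> 'a \<Rightarrow> 'v" where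
  "koszul M [] = 0"
| "koszul M (D # Ds) = lie M D Ds - koszul (\<lambda>Ds. M (D # Ds)) Ds"

lemma koszul_cong:
  assumes "Ds = [] \<or> Ds \<in> der_lists (Suc k)" "\<And>Ds. Ds \<in> der_lists k \<Longrightarrow> M Ds = N Ds"
  shows "koszul M Ds = koszul N Ds"
  using assms
proof (induction Ds arbitrary: M N k)
  case (Cons R Rs)
  have Rs: "Rs \<in> der_lists k" "R \<in> derivations E" using Cons.prems(1) by auto
  have "koszul (\<lambda>Ds. M (R # Ds)) Rs = koszul (\<lambda>Ds. N (R # Ds)) Rs"
  proof (cases k)
    case (Suc l)
    then show ?thesis using Rs Cons.prems(2) by (intro Cons.IH[where k = l]) auto
  qed (use Rs in simp)
  then show ?case using lie_cong[OF Rs(2,1) Cons.prems(2)] by simp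
qed simp

lemma koszul_add:
  assumes "Ds = [] \<or> Ds \<in> der_lists (Suc k) \<and> tensorial k M \<and> tensorial k N"
  shows "koszul (\<lambda>Ds. M Ds + N Ds) Ds = koszul M Ds + koszul N Ds"
  using assms
proof (induction Ds arbitrary: M N k)
  case (Cons R Rs)
  have Rs: "Rs \<in> der_lists k" "R \<in> derivations E" and MN: "tensorial k M" "tensorial k N" using Cons.prems(1) by auto
  have "koszul (\<lambda>Ds. M (R # Ds) + N (R # Ds)) Rs = koszul (\<lambda>Ds. M (R # Ds)) Rs + koszul (\<lambda>Ds. N (R # Ds)) Rs"
  proof (cases k)
    case (Suc l)
    then show ?thesis using Rs MN tensorialD(1) by (intro Cons.IH[where k = l]) blast
  qed (use Rs in simp)
  then show ?case
    by (simp only: koszul.simps lie_add[OF Rs(2,1) MN]) (simp add: algebra_simps)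
qed simp

text \<open>Every Lie derivative in the recursion contributes one derivative of \<open>f\<close>.\<close>

lemma koszul_scale:
  assumes "Ds = [] \<or> Ds \<in> der_lists (Suc k) \<and> tensorial k M" "f \<in> Cinf E"
  shows "koszul (\<lambda>Ds x. f x *\<^sub>R M Ds x) Ds = (\<lambda>x. f x *\<^sub>R koszul M Ds x + d_wedge f M Ds x)"
  using assms(1)
proof (induction Ds arbitrary: M k)
  case Nil
  then show ?case by (auto simp: zero_fun_def)
next
  case (Cons R Rs)
  have Rs: "Rs \<in> der_lists k" "R \<in> derivations E" and M: "tensorial k M" using Cons.prems(1) by auto
  have "koszul (\<lambda>Ds x. f x *\<^sub>R M (R # Ds) x) Rs = (\<lambda>x. f x *\<^sub>R koszul (\<lambda>Ds. M (R # Ds)) Rs x + d_wedge f (\<lambda>Ds. M (R # Ds)) Rs x)"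
  proof (cases k)
    case (Suc l)
    then show ?thesis using Rs M tensorialD(1) by (intro Cons.IH[where k = l]) blast
  qed (use Rs in \<open>auto simp: zero_fun_def\<close>)
  then show ?case using lie_scale[OF Rs(2,1) M assms(2)] by (simp add: fun_diff_def algebra_simps)
qed

lemma koszul_0: "set Ds \<subseteq> derivations E \<Longrightarrow> koszul (\<lambda>Ds. 0) Ds = 0"
  by (induction Ds) (simp_all add: lie_0)

text \<open>In \<open>\<iota>\<^bsub>f D\<^esub> d = L\<^bsub>f D\<^esub> - d f \<iota>\<^sub>D\<close> the two terms \<open>df \<and> \<iota>\<^sub>D\<close> cancel. For alternation one needs \<open>\<iota>\<^sub>D \<iota>\<^sub>D d = 0\<close>; both
  \<open>\<iota>\<^sub>D L\<^sub>D = L\<^sub>D \<iota>\<^sub>D\<close> and \<open>\<iota>\<^sub>D \<iota>\<^sub>D = 0\<close> enter.\<close>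

lemma tensorial_koszul: "tensorial k M \<Longrightarrow> tensorial (Suc k) (koszul M)"
proof (induction k arbitrary: M)
  case (0 M)
  then have M: "M [] \<in> sections E" by simp
  show ?case
    by (rule tensorial_SucI) (auto simp: derivationsD(1)[OF _ M] plus_fun_def fscale_def)
next
  case (Suc k M)
  note M = tensorialD[OF Suc.prems]
  show ?case
  proof (rule tensorial_SucI)
    show "tensorial (Suc k) (\<lambda>Ds. koszul M (D # Ds))" if "D \<in> derivations E" for D
      using tensorial_diff[OF tensorial_lie[OF that Suc.prems] Suc.IH[OF M(1)[OF that]]] by simp
    show "koszul M ((D + R) # Ds) = koszul M (D # Ds) + koszul M (R # Ds)"
      if "D \<in> derivations E" "R \<in> derivations E" "Ds \<in> der_lists (Suc k)" for D R Ds
    proof -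
      have "koszul (\<lambda>Ds. M ((D + R) # Ds)) Ds = koszul (\<lambda>Ds. M (D # Ds) + M (R # Ds)) Ds"
        by (rule koszul_cong[where k = k]) (use that M(2) in auto)
      also have "\<dots> = koszul (\<lambda>Ds. M (D # Ds)) Ds + koszul (\<lambda>Ds. M (R # Ds)) Ds"
        by (rule koszul_add[where k = k]) (use that M(1) in auto)
      finally show ?thesis using lie_der_add[OF that Suc.prems] by simp
    qed
    show "koszul M (fscale f D # Ds) = (\<lambda>x. f x *\<^sub>R koszul M (D # Ds) x)"
      if "f \<in> Cinf E" "D \<in> derivations E" "Ds \<in> der_lists (Suc k)" for f D Ds
    proof -
      have "koszul (\<lambda>Ds. M (fscale f D # Ds)) Ds = koszul (\<lambda>Ds x. f x *\<^sub>R M (D # Ds) x) Ds"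
        by (rule koszul_cong[where k = k]) (use that M(3) in auto)
      also have "\<dots> = (\<lambda>x. f x *\<^sub>R koszul (\<lambda>Ds. M (D # Ds)) Ds x + d_wedge f (\<lambda>Ds. M (D # Ds)) Ds x)"
        by (rule koszul_scale[where k = k]) (use that M(1) in auto)
      finally show ?thesis using lie_der_fscale[OF that(2,1,3) Suc.prems]
        by (simp add: fun_diff_def algebra_simps)
    qed
    show "koszul M (D # D # Ds) = 0" if k: "Suc k = Suc k'" and D: "D \<in> derivations E" "Ds \<in> der_lists k'" for D Ds k'
    proof -
      have "koszul (\<lambda>Ds. M (D # D # Ds)) Ds = koszul (\<lambda>Ds. 0) Ds"
      proof (cases k)
        case 0
        then show ?thesis using D k by simp
      next
        case (Suc l)
        then show ?thesis using D k M(4) by (intro koszul_cong[where k = l]) auto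
      qed
      moreover have "set Ds \<subseteq> derivations E" using D by (simp add: der_lists_def)
      ultimately show ?thesis
        using tensorial_zero[OF D(1) Suc.prems] D k by (simp add: commutator_self koszul_0)
    qed
  qed
qed

text \<open>All commutators in the Lie derivative vanish.\<close>

lemma lie_euler:
  assumes "Ds \<in> der_lists k" "tensorial k M"
  shows "lie M euler Ds = M Ds"
  using assms
proof (induction k arbitrary: M Ds)
  case 0
  then show ?case by (simp add: euler_def)
next
  case (Suc k)
  from Suc.prems(1) obtain R Rs where R: "Ds = R # Rs" "R \<in> derivations E" "Rs \<in> der_lists k" by (rule der_lists_SucE)
  show ?case
    using Suc.IH[OF R(3) tensorialD(1)[OF Suc.prems(2) R(2)]] tensorial_zero[OF R(2) Suc.prems(2) R(3)]
    by (simp add: R(1) commutator_euler[OF R(2)])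
qed

section \<open>The explicit formula\<close>

lemma lie_formula:
  assumes D: "D \<in> derivations E" and "Ds \<in> der_lists k" "tensorial k M"
  shows "lie M D Ds = D (M Ds) - (\<Sum>j<length Ds. (-1) ^ j *\<^sub>R M (commutator D (Ds ! j) # del j Ds))"
  using assms(2,3)
proof (induction k arbitrary: M Ds)
  case (Suc k)
  from Suc.prems(1) obtain R Rs where R: "Ds = R # Rs" "R \<in> derivations E" "Rs \<in> der_lists k" by (rule der_lists_SucE)
  have len: "length Rs = k" using R(3) by (simp add: der_lists_def)
  have "(-1) ^ j *\<^sub>R M (R # commutator D (Rs ! j) # del j Rs) = (-1) ^ Suc j *\<^sub>R M (commutator D (Rs ! j) # R # del j Rs)"
    if "j < k" for j
  proof -
    obtain l where l: "k = Suc l" using \<open>j < k\<close> by (cases k) auto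
    have "M (R # commutator D (Rs ! j) # del j Rs) = - M (commutator D (Rs ! j) # R # del j Rs)"
      using R(3) that unfolding l
      by (intro tensorial_swap[OF Suc.prems(2)[unfolded l] R(2)] der_closed D der_lists_del der_lists_nth[of Rs "Suc l"])
    then show ?thesis by simp
  qed
  then have "(\<Sum>j<length Rs. (-1) ^ j *\<^sub>R M (R # commutator D (Rs ! j) # del j Rs)) =
      (\<Sum>j<length Rs. (-1) ^ Suc j *\<^sub>R M (commutator D (Rs ! j) # R # del j Rs))"
    by (intro sum.cong) (simp_all add: len)
  then show ?case
    using Suc.IH[OF R(3) tensorialD(1)[OF Suc.prems(2) R(2)]]
    by (simp add: R(1) sum.lessThan_Suc_shift del_def algebra_simps del: sum.lessThan_Suc)
qed simp

text \<open>The sums of \<open>d_formula\<close>, as a map on lists of derivations.\<close>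

definition koszul_sum :: "(('a, 'v) der list \<Rightarrow> 'a \<Rightarrow> 'v) \<Rightarrow> ('a, 'v) der list \<Rightarrow> 'a \<Rightarrow> 'v" where
  "koszul_sum M Ds = (\<Sum>i<length Ds. (-1) ^ i *\<^sub>R (Ds ! i) (M (del i Ds))) +
     (\<Sum>j<length Ds. \<Sum>i<j. (-1) ^ (i + j) *\<^sub>R M (commutator (Ds ! i) (Ds ! j) # del i (del j Ds)))"

lemma koszul_sum_koszul:
  assumes "Ds = [] \<or> Ds \<in> der_lists (Suc k) \<and> tensorial k M"
  shows "koszul_sum M Ds = koszul M Ds"
  using assms
proof (induction Ds arbitrary: M k)
  case Nil
  then show ?case by (simp add: koszul_sum_def)
next
  case (Cons D Ds)
  have Ds: "Ds \<in> der_lists k" "D \<in> derivations E" and M: "tensorial k M" using Cons.prems(1) by auto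
  have len: "length Ds = k" using Ds by (simp add: der_lists_def)
  have IH: "koszul_sum (\<lambda>Ds. M (D # Ds)) Ds = koszul (\<lambda>Ds. M (D # Ds)) Ds"
  proof (cases k)
    case (Suc l)
    then show ?thesis using Ds M tensorialD(1) by (intro Cons.IH[where k = l]) blast
  qed (use Ds in \<open>simp add: koszul_sum_def\<close>)
  have del: "del 0 (D # Ds) = Ds" "del (Suc j) (D # Ds) = D # del j Ds" for j and D :: "('a, 'v) der" and Ds
    by (simp_all add: del_def)
  have inner: "(\<Sum>i<Suc j. (-1) ^ (i + Suc j) *\<^sub>R M (commutator ((D # Ds) ! i) (Ds ! j) # del i (D # del j Ds))) =
      - ((-1) ^ j *\<^sub>R M (commutator D (Ds ! j) # del j Ds)) -
      (\<Sum>i<j. (-1) ^ (i + j) *\<^sub>R M (D # commutator (Ds ! i) (Ds ! j) # del i (del j Ds)))" if j: "j < k" for j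
  proof -
    have "(-1) ^ (i + j) *\<^sub>R M (commutator (Ds ! i) (Ds ! j) # D # del i (del j Ds)) =
        - ((-1) ^ (i + j) *\<^sub>R M (D # commutator (Ds ! i) (Ds ! j) # del i (del j Ds)))" if i: "i < j" for i
    proof -
      obtain l where l: "k = Suc (Suc l)" using i j by (cases k; cases "k - 1") auto
      have "M (commutator (Ds ! i) (Ds ! j) # D # del i (del j Ds)) = - M (D # commutator (Ds ! i) (Ds ! j) # del i (del j Ds))"
        using Ds i j unfolding l
        by (intro tensorial_swap[OF M[unfolded l]] der_closed der_lists_del der_lists_nth[of Ds "Suc (Suc l)"]) auto
      then show ?thesis by simp
    qed
    then show ?thesis
      by (simp add: sum.lessThan_Suc_shift del sum_negf del: sum.lessThan_Suc)
  qed
  have "(\<Sum>i<Suc k. (-1) ^ i *\<^sub>R ((D # Ds) ! i) (M (del i (D # Ds)))) =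
      D (M Ds) - (\<Sum>i<k. (-1) ^ i *\<^sub>R (Ds ! i) (M (D # del i Ds)))"
    by (subst sum.lessThan_Suc_shift) (simp add: del sum_negf)
  moreover have "(\<Sum>j<Suc k. \<Sum>i<j. G i j) = (\<Sum>j<k. \<Sum>i<Suc j. G i (Suc j))" for G :: "nat \<Rightarrow> nat \<Rightarrow> 'a \<Rightarrow> 'v"
    by (subst sum.lessThan_Suc_shift) simp
  ultimately have "koszul_sum M (D # Ds) = D (M Ds) - (\<Sum>i<k. (-1) ^ i *\<^sub>R (Ds ! i) (M (D # del i Ds))) +
      (\<Sum>j<k. \<Sum>i<Suc j. (-1) ^ (i + Suc j) *\<^sub>R M (commutator ((D # Ds) ! i) (Ds ! j) # del i (D # del j Ds)))"
    by (simp only: koszul_sum_def list.size(4) len add_Suc_right add_0_right Suc_eq_plus1[symmetric] nth_Cons_Suc del)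
  also have "(\<Sum>j<k. \<Sum>i<Suc j. (-1) ^ (i + Suc j) *\<^sub>R M (commutator ((D # Ds) ! i) (Ds ! j) # del i (D # del j Ds))) =
      (\<Sum>j<k. - ((-1) ^ j *\<^sub>R M (commutator D (Ds ! j) # del j Ds)) -
      (\<Sum>i<j. (-1) ^ (i + j) *\<^sub>R M (D # commutator (Ds ! i) (Ds ! j) # del i (del j Ds))))"
    by (rule sum.cong) (simp_all only: inner lessThan_iff)
  finally have koszul_sum_Cons: "koszul_sum M (D # Ds) = D (M Ds) - (\<Sum>i<k. (-1) ^ i *\<^sub>R (Ds ! i) (M (D # del i Ds))) +
      (\<Sum>j<k. - ((-1) ^ j *\<^sub>R M (commutator D (Ds ! j) # del j Ds)) -
      (\<Sum>i<j. (-1) ^ (i + j) *\<^sub>R M (D # commutator (Ds ! i) (Ds ! j) # del i (del j Ds))))" .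
  show ?case
    unfolding koszul.simps(2) lie_formula[OF Ds(2,1) M] IH[symmetric] koszul_sum_Cons
    by (simp add: koszul_sum_def len sum_subtractf sum_negf algebra_simps)
qed

end

section \<open>Alternating forms\<close>

lemma alt_formsD:
  assumes "\<alpha> \<in> alt_forms k V W"
  shows "length xs = k \<Longrightarrow> set xs \<subseteq> V \<Longrightarrow> \<alpha> xs \<in> W"
    and "length xs = k \<Longrightarrow> set xs \<subseteq> V \<Longrightarrow> i < k \<Longrightarrow> lin_on V (\<lambda>v. \<alpha> (xs[i := v]))"
    and "length xs = k \<Longrightarrow> set xs \<subseteq> V \<Longrightarrow> \<not> distinct xs \<Longrightarrow> \<alpha> xs = 0"
    and "\<not> (length xs = k \<and> set xs \<subseteq> V) \<Longrightarrow> \<alpha> xs = 0"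
  using assms unfolding alt_forms_def by blast+

lemma alt_forms_lin:
  assumes "\<alpha> \<in> alt_forms (Suc k) V W" "length xs = k" "set xs \<subseteq> V" "V \<noteq> {}"
  shows "lin_on V (\<lambda>v. \<alpha> (v # xs))"
proof -
  obtain a where "a \<in> V" using assms(4) by blast
  then show ?thesis using alt_formsD(2)[OF assms(1), of "a # xs" 0] assms(2,3) by simp
qed

lemma alt_forms_swap:
  assumes \<alpha>: "\<alpha> \<in> alt_forms k V W" and V: "subspace V"
  shows "\<alpha> (a # b # xs) = - \<alpha> (b # a # xs)"
proof (cases "length (a # b # xs) = k \<and> set (a # b # xs) \<subseteq> V")
  case True
  then have k: "k = Suc (Suc (length xs))" and ab: "a \<in> V" "b \<in> V" "set xs \<subseteq> V" by auto
  have ab': "a + b \<in> V" using ab V by (simp add: subspace_add)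
  have l0: "\<alpha> ((c + d) # e # xs) = \<alpha> (c # e # xs) + \<alpha> (d # e # xs)" if "c \<in> V" "d \<in> V" "e \<in> V" for c d e
    using alt_forms_lin[OF \<alpha>[unfolded k], of "e # xs"] that ab by (auto simp: lin_on_def)
  have l1: "\<alpha> (e # (c + d) # xs) = \<alpha> (e # c # xs) + \<alpha> (e # d # xs)" if "c \<in> V" "d \<in> V" "e \<in> V" for c d e
    using alt_formsD(2)[OF \<alpha>[unfolded k], of "e # c # xs" 1] that ab by (auto simp: lin_on_def)
  have z: "\<alpha> (c # c # xs) = 0" if "c \<in> V" for c
    using alt_formsD(3)[OF \<alpha>, of "c # c # xs"] that ab k by auto
  have "0 = \<alpha> ((a + b) # (a + b) # xs)" using z[OF ab'] by simp
  also have "\<dots> = \<alpha> (a # b # xs) + \<alpha> (b # a # xs)"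
    using l0[OF ab(1,2) ab'] l1[OF ab(1,2) ab(1)] l1[OF ab(1,2) ab(2)] z[OF ab(1)] z[OF ab(2)] by simp
  finally show ?thesis by (simp add: eq_neg_iff_add_eq_0)
next
  case False
  then have "\<alpha> (a # b # xs) = 0" "\<alpha> (b # a # xs) = 0"
    using alt_formsD(4)[OF \<alpha>] by auto
  then show ?thesis by simp
qed

lemma alt_forms_ins:
  assumes \<alpha>: "\<alpha> \<in> alt_forms (Suc k) V W" and v: "v \<in> V"
  shows "ins v \<alpha> \<in> alt_forms k V W"
  unfolding alt_forms_def mem_Collect_eq
proof (intro conjI allI impI)
  fix xs :: "'a list" and i
  show "ins v \<alpha> xs \<in> W" if "length xs = k \<and> set xs \<subseteq> V"
    using alt_formsD(1)[OF \<alpha>, of "v # xs"] that v by (simp add: ins_def)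
  show "lin_on V (\<lambda>w. ins v \<alpha> (xs[i := w]))" if "length xs = k \<and> set xs \<subseteq> V \<and> i < k"
    using alt_formsD(2)[OF \<alpha>, of "v # xs" "Suc i"] that v by (simp add: ins_def)
  show "ins v \<alpha> xs = 0" if "length xs = k \<and> set xs \<subseteq> V \<and> \<not> distinct xs"
    using alt_formsD(3)[OF \<alpha>, of "v # xs"] that v by (simp add: ins_def)
  show "ins v \<alpha> xs = 0" if "\<not> (length xs = k \<and> set xs \<subseteq> V)"
    using alt_formsD(4)[OF \<alpha>, of "v # xs"] that by (auto simp: ins_def)
qed

lemma alt_forms_move:
  assumes "\<alpha> \<in> alt_forms k V W" "subspace V" "set ys \<subseteq> V" "length (ys @ a # zs) = k"
  shows "\<alpha> (ys @ a # zs) = (-1) ^ length ys *\<^sub>R \<alpha> (a # ys @ zs)"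
  using assms(1,3,4)
proof (induction ys arbitrary: \<alpha> k)
  case (Cons y ys)
  then obtain l where k: "k = Suc l" by auto
  have "ins y \<alpha> (ys @ a # zs) = (-1) ^ length ys *\<^sub>R ins y \<alpha> (a # ys @ zs)"
    using Cons.prems k by (intro Cons.IH[where k = l] alt_forms_ins) auto
  then show ?case using alt_forms_swap[OF Cons.prems(1) assms(2), of y a] by (simp add: ins_def)
qed simp

text \<open>Alternation in the first two slots suffices if the forms obtained by fixing the first argument alternate: a repetition
  of the first argument can be moved next to it.\<close>

lemma alt_forms_SucI:
  assumes V: "subspace V" and W: "0 \<in> W"
    and ins: "\<And>v. v \<in> V \<Longrightarrow> ins v \<alpha> \<in> alt_forms k V W"
    and lin: "\<And>xs. length xs = k \<Longrightarrow> set xs \<subseteq> V \<Longrightarrow> lin_on V (\<lambda>v. \<alpha> (v # xs))"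
    and alt: "\<And>v xs. v \<in> V \<Longrightarrow> k = Suc (length xs) \<Longrightarrow> set xs \<subseteq> V \<Longrightarrow> \<alpha> (v # v # xs) = 0"
    and out: "\<And>xs. \<not> (length xs = Suc k \<and> set xs \<subseteq> V) \<Longrightarrow> \<alpha> xs = 0"
  shows "\<alpha> \<in> alt_forms (Suc k) V W"
  unfolding alt_forms_def mem_Collect_eq
proof (intro conjI allI impI)
  fix xs :: "'a list" and i
  show "\<alpha> xs \<in> W" if "length xs = Suc k \<and> set xs \<subseteq> V"
  proof (cases xs)
    case (Cons v vs)
    then show ?thesis using alt_formsD(1)[OF ins, of v vs] that by (simp add: ins_def)
  qed (use that in simp)
  show "lin_on V (\<lambda>w. \<alpha> (xs[i := w]))" if "length xs = Suc k \<and> set xs \<subseteq> V \<and> i < Suc k"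
  proof (cases xs)
    case (Cons v vs)
    then show ?thesis using alt_formsD(2)[OF ins, of v vs] lin[of vs] that by (cases i) (auto simp: ins_def)
  qed (use that in simp)
  show "\<alpha> xs = 0" if xs: "length xs = Suc k \<and> set xs \<subseteq> V \<and> \<not> distinct xs"
  proof (cases xs)
    case (Cons v vs)
    have v: "v \<in> V" "set vs \<subseteq> V" "length vs = k" using xs Cons by auto
    show ?thesis
    proof (cases "v \<in> set vs")
      case True
      then obtain ys zs where vs: "vs = ys @ v # zs" by (auto simp: in_set_conv_decomp)
      have "ins v \<alpha> vs = (-1) ^ length ys *\<^sub>R ins v \<alpha> (v # ys @ zs)"
        using v vs by (auto intro!: alt_forms_move[OF ins[OF v(1)] V])
      also have "\<dots> = 0" using alt[of v "ys @ zs"] v vs by (simp add: ins_def)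
      finally show ?thesis using Cons by (simp add: ins_def)
    next
      case False
      then show ?thesis using alt_formsD(3)[OF ins[OF v(1)], of vs] v xs Cons by (simp add: ins_def)
    qed
  qed (use xs in simp)
  show "\<alpha> xs = 0" if "\<not> (length xs = Suc k \<and> set xs \<subseteq> V)"
    using out that .
qed

lemma alt_forms_uminus:
  assumes "\<alpha> \<in> alt_forms k V W" "subspace W"
  shows "- \<alpha> \<in> alt_forms k V W"
  unfolding alt_forms_def mem_Collect_eq
proof (intro conjI allI impI)
  fix xs :: "'a list" and i
  show "(- \<alpha>) xs \<in> W" if "length xs = k \<and> set xs \<subseteq> V"
    using alt_formsD(1)[OF assms(1), of xs] that assms(2) by (simp add: subspace_neg)
  show "lin_on V (\<lambda>w. (- \<alpha>) (xs[i := w]))" if "length xs = k \<and> set xs \<subseteq> V \<and> i < k"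
    using alt_formsD(2)[OF assms(1), of xs i] that by (simp add: lin_on_def)
  show "(- \<alpha>) xs = 0" if "length xs = k \<and> set xs \<subseteq> V \<and> \<not> distinct xs"
    using alt_formsD(3)[OF assms(1), of xs] that by simp
  show "(- \<alpha>) xs = 0" if "\<not> (length xs = k \<and> set xs \<subseteq> V)"
    using alt_formsD(4)[OF assms(1) that] by simp
qed

lemma ins_lin:
  assumes \<alpha>: "\<alpha> \<in> alt_forms (Suc k) V W" and V: "subspace V"
  shows "lin_on V (\<lambda>v. ins v \<alpha>)"
proof -
  have ne: "V \<noteq> {}" using subspace_0[OF V] by auto
  have "ins (v + w) \<alpha> xs = ins v \<alpha> xs + ins w \<alpha> xs \<and> ins (a *\<^sub>R v) \<alpha> xs = a *\<^sub>R ins v \<alpha> xs"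
    if "v \<in> V" "w \<in> V" for v w a xs
  proof (cases "length xs = k \<and> set xs \<subseteq> V")
    case True
    then show ?thesis using alt_forms_lin[OF \<alpha> _ _ ne, of xs] that by (auto simp: lin_on_def ins_def)
  next
    case False
    then have "ins u \<alpha> xs = 0" for u using alt_formsD(4)[OF \<alpha>, of "u # xs"] by (auto simp: ins_def)
    then show ?thesis by simp
  qed
  then show ?thesis unfolding lin_on_def by (auto simp: fun_eq_iff scaleR_fun_def)
qed

lemma alt_forms_fibres:
  assumes "\<alpha> \<in> alt_forms k V W" "subspace V" "lin_on V \<sigma>"
    and "\<And>v xs. v \<in> V \<Longrightarrow> \<sigma> v = 0 \<Longrightarrow> \<alpha> (v # xs) = 0"
    and "set xs \<subseteq> V" "set ys \<subseteq> V" "length xs = k" "map \<sigma> xs = map \<sigma> ys"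
  shows "\<alpha> xs = \<alpha> ys"
  using assms(1,4-8)
proof (induction k arbitrary: \<alpha> xs ys)
  case (Suc k)
  obtain v vs where v: "xs = v # vs" "v \<in> V" "set vs \<subseteq> V" "length vs = k"
    using Suc.prems(3,5) by (cases xs) auto
  obtain w ws where w: "ys = w # ws" "w \<in> V" "set ws \<subseteq> V" "\<sigma> v = \<sigma> w" "map \<sigma> vs = map \<sigma> ws"
    using Suc.prems(4,6) v by (cases ys) auto
  have vw: "v - w \<in> V" "\<sigma> (v - w) = 0"
    using v w assms(2) by (auto simp: subspace_diff lin_on_diff[OF assms(3,2)])
  have "lin_on V (\<lambda>v. \<alpha> (v # vs))"
    using alt_forms_lin[OF Suc.prems(1) v(4,3)] v(2) by auto
  from lin_on_diff[OF this assms(2) v(2) w(2)] have "\<alpha> (v # vs) = \<alpha> (w # vs)"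
    using Suc.prems(2)[OF vw] by simp
  moreover have "ins w \<alpha> vs = ins w \<alpha> ws"
  proof (rule Suc.IH[OF alt_forms_ins[OF Suc.prems(1) w(2)] _ v(3) w(3) v(4) w(5)])
    show "ins w \<alpha> (u # zs) = 0" if "u \<in> V" "\<sigma> u = 0" for u zs
      using alt_forms_swap[OF Suc.prems(1) assms(2), of w u zs] Suc.prems(2)[OF that] by (simp add: ins_def)
  qed
  ultimately show ?case by (simp add: v(1) w(1) ins_def)
qed simp

text \<open>Forms that are annihilated by the kernel of \<open>\<sigma>\<close> factor through \<open>\<sigma>\<close>. It is applied twice: to the evaluation of
  derivations at a point, and to the symbol.\<close>

lemma alt_forms_descend:
  assumes \<alpha>: "\<alpha> \<in> alt_forms k V W" and V: "subspace V" and W: "0 \<in> W" and \<sigma>: "lin_on V \<sigma>" "\<sigma> ` V = T"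
    and ker: "\<And>v xs. v \<in> V \<Longrightarrow> \<sigma> v = 0 \<Longrightarrow> \<alpha> (v # xs) = 0"
  obtains \<kappa> where "\<kappa> \<in> alt_forms k T W" "\<And>xs. length xs = k \<Longrightarrow> set xs \<subseteq> V \<Longrightarrow> \<alpha> xs = \<kappa> (map \<sigma> xs)"
proof -
  define g where "g t = (SOME v. v \<in> V \<and> \<sigma> v = t)" for t
  have g: "g t \<in> V" "\<sigma> (g t) = t" if "t \<in> T" for t
  proof -
    have "\<exists>v. v \<in> V \<and> \<sigma> v = t" using that \<sigma>(2) by auto
    from someI_ex[OF this] show "g t \<in> V" "\<sigma> (g t) = t" by (auto simp: g_def)
  qed
  have T: "subspace T"
  proof (rule subspaceI)
    show "0 \<in> T" using lin_on_0[OF \<sigma>(1) V] subspace_0[OF V] \<sigma>(2) by (metis imageI)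
    show "s + t \<in> T" if "s \<in> T" "t \<in> T" for s t
      using g[OF that(1)] g[OF that(2)] lin_on_addD[OF \<sigma>(1), of "g s" "g t"] \<sigma>(2) V by (metis imageI subspace_add)
    show "a *\<^sub>R t \<in> T" if "t \<in> T" for a t
      using g[OF that] lin_on_scaleD[OF \<sigma>(1), of "g t" a] \<sigma>(2) V by (metis imageI subspace_scale)
  qed
  define K where "K k \<alpha> xs = (if length xs = k \<and> set xs \<subseteq> T then \<alpha> (map g xs) else 0)" for k and \<alpha> :: "'a list \<Rightarrow> 'b" and xs
  have K: "\<alpha> xs = K k \<alpha> (map \<sigma> xs)"
    if "\<alpha> \<in> alt_forms k V W" "\<And>v xs. v \<in> V \<Longrightarrow> \<sigma> v = 0 \<Longrightarrow> \<alpha> (v # xs) = 0" "length xs = k" "set xs \<subseteq> V" for \<alpha> k xs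
  proof -
    have "set (map \<sigma> xs) \<subseteq> T" using that(4) \<sigma>(2) by auto
    moreover have "\<alpha> xs = \<alpha> (map g (map \<sigma> xs))"
    proof (rule alt_forms_fibres[OF that(1) V \<sigma>(1) that(2,4) _ that(3)])
      show "set (map g (map \<sigma> xs)) \<subseteq> V" using \<open>set (map \<sigma> xs) \<subseteq> T\<close> g(1) by auto
      show "map \<sigma> xs = map \<sigma> (map g (map \<sigma> xs))" using \<open>set (map \<sigma> xs) \<subseteq> T\<close> g(2) by auto
    qed
    ultimately show ?thesis using that(3) by (simp add: K_def)
  qed
  have "K k \<alpha> \<in> alt_forms k T W"
    if "\<alpha> \<in> alt_forms k V W" "\<And>v xs. v \<in> V \<Longrightarrow> \<sigma> v = 0 \<Longrightarrow> \<alpha> (v # xs) = 0" for k \<alpha>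
    using that
  proof (induction k arbitrary: \<alpha>)
    case 0
    then have "\<alpha> [] \<in> W" using alt_formsD(1)[OF 0(1), of "[]"] by simp
    then show ?case by (auto simp: alt_forms_def K_def)
  next
    case (Suc k)
    show ?case
    proof (rule alt_forms_SucI[OF T W])
      show "ins t (K (Suc k) \<alpha>) \<in> alt_forms k T W" if t: "t \<in> T" for t
      proof -
        have "K k (ins (g t) \<alpha>) \<in> alt_forms k T W"
        proof (rule Suc.IH[OF alt_forms_ins[OF Suc.prems(1) g(1)[OF t]]])
          show "ins (g t) \<alpha> (v # xs) = 0" if "v \<in> V" "\<sigma> v = 0" for v xs
            using alt_forms_swap[OF Suc.prems(1) V, of "g t" v xs] Suc.prems(2)[OF that] by (simp add: ins_def)
        qed
        moreover have "ins t (K (Suc k) \<alpha>) = K k (ins (g t) \<alpha>)"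
          using t by (auto simp: ins_def K_def)
        ultimately show ?thesis by simp
      qed
      show "lin_on T (\<lambda>t. K (Suc k) \<alpha> (t # xs))" if xs: "length xs = k" "set xs \<subseteq> T" for xs
      proof -
        have gx: "set (map g xs) \<subseteq> V" "map \<sigma> (map g xs) = xs"
          using xs(2) g by (auto intro!: map_idI)
        have eq: "K (Suc k) \<alpha> (\<sigma> v # xs) = \<alpha> (v # map g xs)" if "v \<in> V" for v
          using K[OF Suc.prems, of "v # map g xs"] that gx xs(1) by simp
        have lin: "lin_on V (\<lambda>v. \<alpha> (v # map g xs))"
          using alt_forms_lin[OF Suc.prems(1), of "map g xs"] gx xs(1) subspace_0[OF V] by auto
        show ?thesis
          unfolding lin_on_def
        proof (intro conjI ballI allI)
          fix s t and a :: real assume s: "s \<in> T"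
          show "K (Suc k) \<alpha> ((a *\<^sub>R s) # xs) = a *\<^sub>R K (Suc k) \<alpha> (s # xs)"
            using eq[of "a *\<^sub>R g s"] eq[of "g s"] g[OF s] lin_on_scaleD[OF \<sigma>(1), of "g s" a]
              lin_on_scaleD[OF lin, of "g s" a] V by (simp add: subspace_scale)
          assume t: "t \<in> T"
          show "K (Suc k) \<alpha> ((s + t) # xs) = K (Suc k) \<alpha> (s # xs) + K (Suc k) \<alpha> (t # xs)"
            using eq[of "g s + g t"] eq[of "g s"] eq[of "g t"] g[OF s] g[OF t] lin_on_addD[OF \<sigma>(1), of "g s" "g t"]
              lin_on_addD[OF lin, of "g s" "g t"] V by (simp add: subspace_add)
        qed
      qed
      show "K (Suc k) \<alpha> (t # t # xs) = 0" if "t \<in> T" "k = Suc (length xs)" "set xs \<subseteq> T" for t xs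
      proof -
        have "set (g t # g t # map g xs) \<subseteq> V" using that g(1) by auto
        then show ?thesis
          using alt_formsD(3)[OF Suc.prems(1), of "g t # g t # map g xs"] that by (simp add: K_def)
      qed
    qed (auto simp: K_def)
  qed
  from this[OF \<alpha> ker] K[OF \<alpha> ker] show ?thesis using that by blast
qed

section \<open>Forms on the gauge algebroid\<close>

context smooth_bundle
begin

lemma gauge_value: "D \<in> derivations E \<Longrightarrow> value_at x D \<in> gauge_fib E x"
  by (simp add: gauge_fib_def)

lemma gaugeE:
  assumes "\<delta> \<in> gauge_fib E x" obtains D where "D \<in> derivations E" "\<delta> = value_at x D"
  using assms by (auto simp: gauge_fib_def)

lemma gauge_listE:
  assumes "length \<delta>s = k" "set \<delta>s \<subseteq> gauge_fib E x"
  obtains Ds where "Ds \<in> der_lists k" "\<delta>s = map (value_at x) Ds"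
  using assms
proof (induction \<delta>s arbitrary: k thesis)
  case Nil
  then show ?case using Nil.prems(1)[of "[]"] by (simp add: der_lists_def)
next
  case (Cons \<delta> \<delta>s)
  obtain D where D: "D \<in> derivations E" "\<delta> = value_at x D" using Cons.prems(3) gaugeE by auto
  obtain Ds where Ds: "Ds \<in> der_lists (length \<delta>s)" "\<delta>s = map (value_at x) Ds"
    using Cons.IH[OF _ refl] Cons.prems(3) by auto
  show ?case using Cons.prems(1)[of "D # Ds"] D Ds Cons.prems(2) by (auto simp: der_lists_def)
qed

lemma map_value_gauge:
  "Ds \<in> der_lists k \<Longrightarrow> length (map (value_at x) Ds) = k \<and> set (map (value_at x) Ds) \<subseteq> gauge_fib E x"
  using gauge_value by (auto simp: der_lists_def)

definition on_ders :: "('a \<Rightarrow> ('a, 'v) form_at) \<Rightarrow> ('a, 'v) der list \<Rightarrow> 'a \<Rightarrow> 'v" where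
  "on_ders \<mu> Ds x = \<mu> x (map (value_at x) Ds)"

lemma OmegaD:
  assumes "\<mu> \<in> Omega E k"
  shows "\<mu> x \<in> alt_forms k (gauge_fib E x) (fib E x)" "Ds \<in> der_lists k \<Longrightarrow> on_ders \<mu> Ds \<in> sections E"
  using assms by (auto simp: Omega_def der_lists_def on_ders_def[abs_def])

lemma Omega_eqI:
  assumes "\<mu> \<in> Omega E k" "\<nu> \<in> Omega E k" "\<And>Ds x. Ds \<in> der_lists k \<Longrightarrow> on_ders \<mu> Ds x = on_ders \<nu> Ds x"
  shows "\<mu> = \<nu>"
proof (intro ext)
  fix x \<delta>s
  show "\<mu> x \<delta>s = \<nu> x \<delta>s"
  proof (cases "length \<delta>s = k \<and> set \<delta>s \<subseteq> gauge_fib E x")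
    case True
    then obtain Ds where Ds: "Ds \<in> der_lists k" "\<delta>s = map (value_at x) Ds" using gauge_listE by blast
    show ?thesis using assms(3)[OF Ds(1), of x] by (simp add: on_ders_def Ds(2))
  next
    case False
    then show ?thesis
      using alt_formsD(4)[OF OmegaD(1)[OF assms(1)]] alt_formsD(4)[OF OmegaD(1)[OF assms(2)]] by metis
  qed
qed

lemma on_ders_contr: "on_ders (contr D \<mu>) Ds = on_ders \<mu> (D # Ds)"
  by (auto simp: on_ders_def contr_def ins_def)

lemma contr_Omega:
  assumes "\<mu> \<in> Omega E (Suc k)" "D \<in> derivations E"
  shows "contr D \<mu> \<in> Omega E k"
  unfolding Omega_def mem_Collect_eq
proof (intro conjI allI impI)
  show "contr D \<mu> x \<in> alt_forms k (gauge_fib E x) (fib E x)" for x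
    unfolding contr_def by (rule alt_forms_ins[OF OmegaD(1)[OF assms(1)] gauge_value[OF assms(2)]])
  show "(\<lambda>x. contr D \<mu> x (map (value_at x) Ds)) \<in> sections E"
    if "length Ds = k \<and> set Ds \<subseteq> derivations E" for Ds
    using OmegaD(2)[OF assms(1), of "D # Ds"] that assms(2)
    by (simp add: contr_def ins_def on_ders_def[abs_def] der_lists_def)
qed

lemma tensorial_on_ders: "\<mu> \<in> Omega E k \<Longrightarrow> tensorial k (on_ders \<mu>)"
proof (induction k arbitrary: \<mu>)
  case 0
  then show ?case using OmegaD(2)[of \<mu> 0 "[]"] by (simp add: tensorial.simps(1) der_lists_def)
next
  case (Suc k)
  note al = OmegaD(1)[OF Suc.prems]
  show ?case
  proof (rule tensorial_SucI)
    show "tensorial k (\<lambda>Ds. on_ders \<mu> (D # Ds))" if "D \<in> derivations E" for D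
      using Suc.IH[OF contr_Omega[OF Suc.prems that]] by (simp add: on_ders_contr[abs_def])
    have lin: "lin_on (gauge_fib E x) (\<lambda>v. \<mu> x (v # map (value_at x) Ds))" if "Ds \<in> der_lists k" for Ds x
      using alt_forms_lin[OF al, of "map (value_at x) Ds" x] map_value_gauge[OF that, of x] subspace_0[OF gauge_subspace[of x]] by auto
    show "on_ders \<mu> ((D + R) # Ds) = on_ders \<mu> (D # Ds) + on_ders \<mu> (R # Ds)"
      if "D \<in> derivations E" "R \<in> derivations E" "Ds \<in> der_lists k" for D R Ds
      using lin_on_addD[OF lin[OF that(3)] gauge_value[OF that(1)] gauge_value[OF that(2)]]
      by (simp add: on_ders_def[abs_def] value_at_add plus_fun_def[of "\<lambda>x. \<mu> x (value_at x D # map (value_at x) Ds)"])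
    show "on_ders \<mu> (fscale f D # Ds) = (\<lambda>x. f x *\<^sub>R on_ders \<mu> (D # Ds) x)"
      if "f \<in> Cinf E" "D \<in> derivations E" "Ds \<in> der_lists k" for f D Ds
      using lin_on_scaleD[OF lin[OF that(3)] gauge_value[OF that(2)]] by (simp add: on_ders_def[abs_def] value_at_fscale)
    show "on_ders \<mu> (D # D # Ds) = 0"
      if "k = Suc k'" "D \<in> derivations E" "Ds \<in> der_lists k'" for D Ds k'
    proof
      fix x
      show "on_ders \<mu> (D # D # Ds) x = 0 x"
        using alt_formsD(3)[OF al, of "value_at x D # value_at x D # map (value_at x) Ds" x] that
          map_value_gauge[OF that(3), of x] gauge_value[OF that(2), of x]
        by (simp add: on_ders_def zero_fun_def)
    qed
  qed
qed

text \<open>Expand \<open>\<psi> D\<close> in a frame. Its coefficients vanish at \<open>x\<close>, since the values of the frame there are independent.\<close>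

lemma tensorial_local_0:
  assumes F: "tensorial (Suc k) F" and D: "D \<in> derivations E" "value_at x D = 0" and Ds: "Ds \<in> der_lists k"
  shows "F (D # Ds) x = 0"
proof -
  obtain Fs \<psi> where fr: "gauge_frame E Fs \<psi>" and nz: "\<psi> x \<noteq> 0"
    using gauge_frame_exists[ of x] by blast
  obtain c where c: "\<And>R. R \<in> set Fs \<Longrightarrow> c R \<in> Cinf E"
    "\<And>u x. \<psi> x *\<^sub>R D u x = (\<Sum>R\<in>set Fs. c R x *\<^sub>R R u x)"
    using fr D(1) unfolding gauge_frame_def by blast
  have Fs: "set Fs \<subseteq> derivations E" and \<psi>: "\<psi> \<in> Cinf E" and dis: "distinct (map (value_at x) Fs)"
    and ind: "independent (value_at x ` set Fs)"
    using fr nz by (auto simp: gauge_frame_def)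
  have inj: "inj_on (value_at x) (set Fs)" using dis by (simp add: distinct_map)
  have c0: "c R x = 0" if "R \<in> set Fs" for R
  proof -
    have "(\<Sum>R\<in>set Fs. c R x *\<^sub>R value_at x R) u = 0" for u
      using c(2)[of x u] fun_cong[OF D(2), of u]
      by (simp add: sum_fun_apply scaleR_fun_def) (simp add: value_at_def)
    then have "(\<Sum>R\<in>set Fs. c R x *\<^sub>R value_at x R) = 0" by (auto simp: zero_fun_def)
    then have "(\<Sum>v\<in>value_at x ` set Fs. c (inv_into (set Fs) (value_at x) v) x *\<^sub>R v) = 0"
      using inj by (simp add: sum.reindex)
    then have "c (inv_into (set Fs) (value_at x) (value_at x R)) x = 0"
      using independentD[OF ind, of "value_at x ` set Fs" "\<lambda>v. c (inv_into (set Fs) (value_at x) v) x" "value_at x R"] that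
      by simp
    then show ?thesis using inj that by simp
  qed
  have fin: "(\<Sum>R\<in>A. fscale (c R) R) \<in> derivations E \<and>
      F ((\<Sum>R\<in>A. fscale (c R) R) # Ds) = (\<lambda>x. \<Sum>R\<in>A. c R x *\<^sub>R F (R # Ds) x)" if "finite A" "A \<subseteq> set Fs" for A
    using that
  proof (induction A rule: finite_induct)
    case empty
    have "F (0 # Ds) = (\<lambda>x. 0)"
      by (rule trans[OF tensorial_zero[OF D(1) F Ds]]) (simp add: zero_fun_def)
    then show ?case
      unfolding sum.empty by (intro conjI der_closed(4))
  next
    case (insert R A)
    then have R: "R \<in> derivations E" "c R \<in> Cinf E" "fscale (c R) R \<in> derivations E"
      using Fs c(1) by (auto intro: der_closed)
    show ?case
      using insert R tensorialD(2)[OF F R(3) _ Ds, of "\<Sum>R\<in>A. fscale (c R) R"] tensorialD(3)[OF F R(2,1) Ds]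
      by (simp add: der_closed plus_fun_def[of "\<lambda>x. c R x *\<^sub>R F (R # Ds) x"] del: plus_fun_apply)
  qed
  have "fscale \<psi> D = (\<Sum>R\<in>set Fs. fscale (c R) R)"
    using c(2) by (intro ext) (simp add: fscale_def sum_fun_apply)
  then have "\<psi> x *\<^sub>R F (D # Ds) x = (\<Sum>R\<in>set Fs. c R x *\<^sub>R F (R # Ds) x)"
    using fin[of "set Fs"] tensorialD(3)[OF F \<psi> D(1) Ds] by simp (metis (no_types, lifting))
  then show ?thesis using nz c0 by simp
qed

lemma tensorial_alt:
  assumes "tensorial k F"
  shows "(\<lambda>Ds. if Ds \<in> der_lists k then F Ds x else 0) \<in> alt_forms k (derivations E) (fib E x)"
  using assms
proof (induction k arbitrary: F)
  case 0
  then have "F [] x \<in> fib E x" by (simp add: tensorial.simps(1) sections_fib)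
  then show ?case by (auto simp: alt_forms_def der_lists_def)
next
  case (Suc k)
  note F = tensorialD[OF Suc.prems]
  show ?case
  proof (rule alt_forms_SucI[OF derivations_subspace subspace_0[OF fib_subspace]])
    show "ins D (\<lambda>Ds. if Ds \<in> der_lists (Suc k) then F Ds x else 0) \<in> alt_forms k (derivations E) (fib E x)"
      if D: "D \<in> derivations E" for D
      using Suc.IH[OF F(1)[OF D]] D by (simp add: ins_def der_lists_Cons)
    show "lin_on (derivations E) (\<lambda>D. if D # Ds \<in> der_lists (Suc k) then F (D # Ds) x else 0)"
      if "length Ds = k" "set Ds \<subseteq> derivations E" for Ds
    proof -
      have Ds: "Ds \<in> der_lists k" using that by (simp add: der_lists_def)
      have "a *\<^sub>R D = fscale (\<lambda>x. a) D" for a and D :: "('a, 'v) der"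
        by (intro ext) (simp add: fscale_def scaleR_fun_def)
      then show ?thesis
        using F(2)[OF _ _ Ds] F(3)[OF Cinf_const[OF mfd] _ Ds] Ds
        by (simp add: lin_on_def der_lists_Cons der_closed Cinf_const[OF mfd])
    qed
  qed (use F(4) in \<open>auto simp: der_lists_def zero_fun_def\<close>)
qed

text \<open>At every point, the map is an alternating form on the real vector space of all derivations, and it descends along the
  evaluation at that point.\<close>

lemma tensorial_form:
  assumes F: "tensorial k F"
  obtains \<omega> where "\<omega> \<in> Omega E k" "\<And>Ds. Ds \<in> der_lists k \<Longrightarrow> on_ders \<omega> Ds = F Ds"
proof -
  have "\<exists>\<kappa>\<in>alt_forms k (gauge_fib E x) (fib E x). \<forall>Ds\<in>der_lists k. F Ds x = \<kappa> (map (value_at x) Ds)" for x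
  proof -
    have lin: "lin_on (derivations E) (value_at x)"
      by (simp add: lin_on_def value_at_add value_at_cscale)
    have im: "value_at x ` derivations E = gauge_fib E x" by (simp add: gauge_fib_def)
    have ker: "(if D # Ds \<in> der_lists k then F (D # Ds) x else 0) = 0"
      if "D \<in> derivations E" "value_at x D = 0" for D Ds
      using tensorial_local_0[OF _ that] F by (cases k) (auto simp: der_lists_Cons der_lists_def)
    obtain \<kappa> where "\<kappa> \<in> alt_forms k (gauge_fib E x) (fib E x)" "\<And>Ds. length Ds = k \<Longrightarrow> set Ds \<subseteq> derivations E \<Longrightarrow>
        (if Ds \<in> der_lists k then F Ds x else 0) = \<kappa> (map (value_at x) Ds)"
      using alt_forms_descend[OF tensorial_alt[OF F] derivations_subspace subspace_0[OF fib_subspace] lin im ker] by blast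
    then show ?thesis by (intro bexI[of _ \<kappa>]) (auto simp: der_lists_def)
  qed
  then obtain \<omega> where \<omega>: "\<And>x. \<omega> x \<in> alt_forms k (gauge_fib E x) (fib E x)"
    "\<And>x Ds. Ds \<in> der_lists k \<Longrightarrow> F Ds x = \<omega> x (map (value_at x) Ds)" by metis
  have ev: "on_ders \<omega> Ds = F Ds" if "Ds \<in> der_lists k" for Ds
    using \<omega>(2)[OF that] by (auto simp: on_ders_def)
  have "\<omega> \<in> Omega E k"
    unfolding Omega_def mem_Collect_eq
  proof (intro conjI allI impI \<omega>(1))
    fix Ds assume "length Ds = k \<and> set Ds \<subseteq> derivations E"
    then have Ds: "Ds \<in> der_lists k" by (simp add: der_lists_def)
    show "(\<lambda>x. \<omega> x (map (value_at x) Ds)) \<in> sections E"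
      using tensorial_section[OF F Ds] ev[OF Ds] by (simp add: on_ders_def[abs_def])
  qed
  with ev show ?thesis using that by blast
qed

lemma d_formula_koszul:
  assumes "\<mu> \<in> Omega E k" "Ds \<in> der_lists (Suc k)"
  shows "d_formula \<mu> Ds x = koszul (on_ders \<mu>) Ds x"
proof -
  have "d_formula \<mu> Ds x = koszul_sum (on_ders \<mu>) Ds x"
    by (simp add: d_formula_def koszul_sum_def sum_fun_apply scaleR_fun_def on_ders_def[abs_def] plus_fun_def)
  then show ?thesis using koszul_sum_koszul[ of Ds k "on_ders \<mu>"] assms tensorial_on_ders by simp
qed

lemma
  assumes \<mu>: "\<mu> \<in> Omega E k"
  shows dD_Omega: "dD E k \<mu> \<in> Omega E (Suc k)"
    and on_ders_dD: "Ds \<in> der_lists (Suc k) \<Longrightarrow> on_ders (dD E k \<mu>) Ds x = koszul (on_ders \<mu>) Ds x"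
proof -
  obtain \<omega> where \<omega>: "\<omega> \<in> Omega E (Suc k)"
    and "\<And>Ds. Ds \<in> der_lists (Suc k) \<Longrightarrow> on_ders \<omega> Ds = koszul (on_ders \<mu>) Ds"
    using tensorial_form[OF tensorial_koszul[OF tensorial_on_ders[OF \<mu>]]] by blast
  then have ev: "on_ders \<omega> Ds x = koszul (on_ders \<mu>) Ds x" if "Ds \<in> der_lists (Suc k)" for Ds x
    using that by simp
  have "dD E k \<mu> = \<omega>"
    unfolding dD_def
  proof (rule the_equality)
    show "\<omega> \<in> Omega E (Suc k) \<and> (\<forall>Ds. length Ds = Suc k \<and> set Ds \<subseteq> derivations E \<longrightarrow>
        (\<forall>x. \<omega> x (map (value_at x) Ds) = d_formula \<mu> Ds x))"
      using \<omega> ev d_formula_koszul[OF \<mu>] by (auto simp: on_ders_def der_lists_def)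
    fix \<nu> assume \<nu>: "\<nu> \<in> Omega E (Suc k) \<and> (\<forall>Ds. length Ds = Suc k \<and> set Ds \<subseteq> derivations E \<longrightarrow>
        (\<forall>x. \<nu> x (map (value_at x) Ds) = d_formula \<mu> Ds x))"
    have "on_ders \<nu> Ds x = on_ders \<omega> Ds x" if "Ds \<in> der_lists (Suc k)" for Ds x
      using that \<nu> ev[OF that, of x] d_formula_koszul[OF \<mu> that] by (auto simp: on_ders_def der_lists_def)
    then show "\<nu> = \<omega>" using Omega_eqI \<nu> \<omega> by blast
  qed
  then show "dD E k \<mu> \<in> Omega E (Suc k)"
    and "Ds \<in> der_lists (Suc k) \<Longrightarrow> on_ders (dD E k \<mu>) Ds x = koszul (on_ders \<mu>) Ds x"
    using \<omega> ev by auto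
qed

text \<open>Evaluated on \<open>R, Ds\<close>, the recursion for \<open>L\<^sub>D\<close> is Cartan's formula for \<open>\<iota>\<^bsub>[D,R]\<^esub>\<close>, and that for \<open>d\<close> brings in
  \<open>d\<mu>(D, R, Ds)\<close>.\<close>

lemma bracket_form:
  assumes \<mu>: "\<mu> \<in> Omega E (Suc (Suc m))" and D: "D \<in> derivations E" and R: "R \<in> derivations E"
  shows "lie_der E (Suc m) D (contr R \<mu>) - contr R (dD E (Suc m) (contr D \<mu>)) =
    contr (commutator D R) \<mu> + contr R (contr D (dD E (Suc (Suc m)) \<mu>))"
proof (intro ext)
  fix x \<delta>s
  have DR: "commutator D R \<in> derivations E" using D R by (rule der_closed)
  note o = contr_Omega[OF dD_Omega[OF contr_Omega[OF \<mu> R]] D] dD_Omega[OF contr_Omega[OF contr_Omega[OF \<mu> R] D]]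
    contr_Omega[OF dD_Omega[OF contr_Omega[OF \<mu> D]] R] contr_Omega[OF \<mu> DR]
    contr_Omega[OF contr_Omega[OF dD_Omega[OF \<mu>] D] R]
  show "(lie_der E (Suc m) D (contr R \<mu>) - contr R (dD E (Suc m) (contr D \<mu>))) x \<delta>s =
    (contr (commutator D R) \<mu> + contr R (contr D (dD E (Suc (Suc m)) \<mu>))) x \<delta>s"
  proof (cases "length \<delta>s = Suc m \<and> set \<delta>s \<subseteq> gauge_fib E x")
    case True
    then obtain Ds where Ds: "Ds \<in> der_lists (Suc m)" "\<delta>s = map (value_at x) Ds" using gauge_listE by blast
    note ev = on_ders_dD[OF \<mu>, of "D # R # Ds" x] on_ders_dD[OF contr_Omega[OF \<mu> R], of "D # Ds" x]
      on_ders_dD[OF contr_Omega[OF contr_Omega[OF \<mu> R] D], of Ds x] on_ders_dD[OF contr_Omega[OF \<mu> D], of "R # Ds" x]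
    have "on_ders (contr D (dD E (Suc m) (contr R \<mu>))) Ds x + on_ders (dD E m (contr D (contr R \<mu>))) Ds x
        - on_ders (contr R (dD E (Suc m) (contr D \<mu>))) Ds x
      = on_ders (contr (commutator D R) \<mu>) Ds x + on_ders (contr R (contr D (dD E (Suc (Suc m)) \<mu>))) Ds x"
      using Ds(1) D R by (simp add: on_ders_contr ev der_lists_Cons on_ders_contr[abs_def] koszul.simps(2) lie.simps(2))
    then show ?thesis
      by (simp add: on_ders_def Ds(2) lie_der_def)
  next
    case False
    note z = alt_formsD(4)[OF OmegaD(1) False]
    show ?thesis using z[OF o(1)] z[OF o(2)] z[OF o(3)] z[OF o(4)] z[OF o(5)] by (simp add: lie_der_def)
  qed
qed

text \<open>For closed \<open>\<mu>\<close>, the recursion \<open>\<iota>\<^sub>1 d = L\<^sub>1 - d \<iota>\<^sub>1\<close> leaves \<open>L\<^sub>1 \<mu> = d \<iota>\<^sub>1 \<mu>\<close>, and \<open>L\<^sub>1 \<mu> = \<mu>\<close>.\<close>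

lemma euler_homotopy:
  assumes \<mu>: "\<mu> \<in> Omega E (Suc n)" and closed: "dD E (Suc n) \<mu> = 0"
  shows "\<mu> = dD E n (contr euler \<mu>)"
proof (rule Omega_eqI[OF \<mu> dD_Omega[OF contr_Omega[OF \<mu> euler_derivation]]])
  fix Ds x assume Ds: "Ds \<in> der_lists (Suc n)"
  have "0 = on_ders (dD E (Suc n) \<mu>) (euler # Ds) x"
    unfolding closed by (simp add: on_ders_def zero_fun_def)
  also have "\<dots> = lie (on_ders \<mu>) euler Ds x - koszul (\<lambda>Ds. on_ders \<mu> (euler # Ds)) Ds x"
    using on_ders_dD[OF \<mu>, of "euler # Ds" x] Ds euler_derivation by (simp add: der_lists_Cons koszul.simps(2))
  also have "\<dots> = on_ders \<mu> Ds x - on_ders (dD E n (contr euler \<mu>)) Ds x"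
    using lie_euler[OF Ds tensorial_on_ders[OF \<mu>]] on_ders_dD[OF contr_Omega[OF \<mu> euler_derivation] Ds, of x]
    by (simp add: on_ders_contr[abs_def])
  finally show "on_ders \<mu> Ds x = on_ders (dD E n (contr euler \<mu>)) Ds x" by simp
qed

end

section \<open>The bundles \<open>J\<^sub>k E\<close>\<close>

context smooth_bundle
begin

lemma J_fib_alt: "\<alpha> \<in> J_fib E k x \<Longrightarrow> \<alpha> \<in> alt_forms k (gauge_fib E x) (fib E x)"
  by (simp add: J_fib_def)

lemma J_fibE:
  assumes "\<alpha> \<in> J_fib E (Suc k) x"
  obtains \<kappa> where "\<kappa> \<in> alt_forms k (tangent_space E x) (fib E x)"
    "\<And>\<Phi> \<delta>s. \<Phi> \<in> endos E x \<Longrightarrow> length \<delta>s = k \<Longrightarrow> set \<delta>s \<subseteq> gauge_fib E x \<Longrightarrow>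
      \<alpha> (endo_der E x \<Phi> # \<delta>s) = \<Phi> (\<kappa> (map (symbol E x) \<delta>s))"
  using assms by (auto simp: J_fib_def ins_def)

lemma J_fibI:
  assumes "\<alpha> \<in> alt_forms (Suc k) (gauge_fib E x) (fib E x)" "\<kappa> \<in> alt_forms k (tangent_space E x) (fib E x)"
    "\<And>\<Phi> \<delta>s. \<Phi> \<in> endos E x \<Longrightarrow> length \<delta>s = k \<Longrightarrow> set \<delta>s \<subseteq> gauge_fib E x \<Longrightarrow>
      \<alpha> (endo_der E x \<Phi> # \<delta>s) = \<Phi> (\<kappa> (map (symbol E x) \<delta>s))"
  shows "\<alpha> \<in> J_fib E (Suc k) x"
  using assms by (auto simp: J_fib_def ins_def)

lemma endos_minus: "\<Phi> \<in> endos E x \<Longrightarrow> e \<in> fib E x \<Longrightarrow> \<Phi> (- e) = - \<Phi> e"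
  using lin_on_scaleD[of "fib E x" \<Phi> e "-1"] by (simp add: endos_def)

lemma symbols_tangent: "set \<delta>s \<subseteq> gauge_fib E x \<Longrightarrow> set (map (symbol E x) \<delta>s) \<subseteq> tangent_space E x"
  using symbol_tangent by auto

text \<open>Moving \<open>\<Phi>\<close> past \<open>\<delta>\<close> costs a sign, so the form on tangent vectors that belongs to \<open>\<iota>\<^sub>\<delta> \<mu>\<close> is \<open>- \<iota>\<^bsub>\<sigma>(\<delta>)\<^esub> \<lambda>\<^sub>\<mu>\<close>.\<close>

lemma J_fib_ins:
  assumes \<alpha>: "\<alpha> \<in> J_fib E (Suc (Suc k)) x" and \<delta>: "\<delta> \<in> gauge_fib E x"
  shows "ins \<delta> \<alpha> \<in> J_fib E (Suc k) x"
proof -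
  obtain \<kappa> where \<kappa>: "\<kappa> \<in> alt_forms (Suc k) (tangent_space E x) (fib E x)"
    "\<And>\<Phi> \<delta>s. \<Phi> \<in> endos E x \<Longrightarrow> length \<delta>s = Suc k \<Longrightarrow> set \<delta>s \<subseteq> gauge_fib E x \<Longrightarrow>
      \<alpha> (endo_der E x \<Phi> # \<delta>s) = \<Phi> (\<kappa> (map (symbol E x) \<delta>s))"
    using J_fibE[OF \<alpha>] by blast
  show ?thesis
  proof (rule J_fibI[OF alt_forms_ins[OF J_fib_alt[OF \<alpha>] \<delta>]])
    show "- ins (symbol E x \<delta>) \<kappa> \<in> alt_forms k (tangent_space E x) (fib E x)"
      by (intro alt_forms_uminus alt_forms_ins[OF \<kappa>(1)] symbol_tangent \<delta> fib_subspace)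
    fix \<Phi> \<delta>s assume as: "\<Phi> \<in> endos E x" "length \<delta>s = k" "set \<delta>s \<subseteq> gauge_fib E x"
    have "\<kappa> (map (symbol E x) (\<delta> # \<delta>s)) \<in> fib E x"
      using as \<delta> symbols_tangent[of "\<delta> # \<delta>s" x] by (intro alt_formsD(1)[OF \<kappa>(1)]) auto
    then show "ins \<delta> \<alpha> (endo_der E x \<Phi> # \<delta>s) = \<Phi> ((- ins (symbol E x \<delta>) \<kappa>) (map (symbol E x) \<delta>s))"
      using alt_forms_swap[OF J_fib_alt[OF \<alpha>] gauge_subspace, of \<delta> "endo_der E x \<Phi>" \<delta>s] \<kappa>(2)[OF as(1), of "\<delta> # \<delta>s"] as \<delta>
      by (simp add: ins_def endos_minus)
  qed
qed

lemma Omega_JD: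
  assumes "\<mu> \<in> Omega_J E k"
  shows "\<mu> \<in> Omega E k" "\<mu> x \<in> J_fib E k x" "\<mu> x \<in> alt_forms k (gauge_fib E x) (fib E x)"
  using assms by (auto simp: Omega_J_def J_fib_def)

lemma contr_Omega_J:
  assumes "\<mu> \<in> Omega_J E (Suc (Suc k))" "D \<in> derivations E"
  shows "contr D \<mu> \<in> Omega_J E (Suc k)"
  using contr_Omega[OF Omega_JD(1)[OF assms(1)] assms(2)] J_fib_ins[OF Omega_JD(2)[OF assms(1)]] gauge_value[OF assms(2)]
  by (simp add: Omega_J_def contr_def)

section \<open>Graphs and isotropic subbundles\<close>

lemma mem_graph: "(\<delta>, \<alpha>) \<in> graph_B E \<mu> x \<longleftrightarrow> \<delta> \<in> gauge_fib E x \<and> \<alpha> = ins \<delta> (\<mu> x)"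
  by (auto simp: graph_B_def)

lemma graph_subspace:
  assumes "\<mu> \<in> Omega_J E (Suc k)" shows "subspace (graph_B E \<mu> x)"
proof -
  note lin = ins_lin[OF Omega_JD(3)[OF assms, of x] gauge_subspace]
  show ?thesis
  proof (rule subspaceI)
    show "0 \<in> graph_B E \<mu> x"
      using lin_on_0[OF lin gauge_subspace] subspace_0[OF gauge_subspace[of x]] by (simp add: zero_prod_def mem_graph)
  next
    fix e f assume "e \<in> graph_B E \<mu> x" "f \<in> graph_B E \<mu> x"
    then show "e + f \<in> graph_B E \<mu> x"
      using lin_on_addD[OF lin] subspace_add[OF gauge_subspace[of x]] by (cases e; cases f) (simp add: mem_graph)
  next
    fix e and a :: real assume "e \<in> graph_B E \<mu> x"
    then show "a *\<^sub>R e \<in> graph_B E \<mu> x"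
      using lin_on_scaleD[OF lin] subspace_scale[OF gauge_subspace[of x]] by (cases e) (simp add: mem_graph)
  qed
qed

text \<open>A local frame \<open>D\<^sub>i\<close> of \<open>\<D>E\<close> gives the local frame \<open>(D\<^sub>i, \<iota>\<^bsub>D\<^sub>i\<^esub> \<mu>)\<close> of the graph.\<close>

lemma graph_subbundle:
  assumes \<mu>: "\<mu> \<in> Omega_J E (Suc (Suc m))"
  shows "omni_subbundle E (Suc m) (graph_B E \<mu>)"
  unfolding omni_subbundle_def
proof (intro conjI allI)
  show "subspace (graph_B E \<mu> x)" for x by (rule graph_subspace[OF \<mu>])
  show "graph_B E \<mu> x \<subseteq> omni_fib E (Suc m) x" for x
    using J_fib_ins[OF Omega_JD(2)[OF \<mu>]] by (auto simp: graph_B_def omni_fib_def)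
  have "\<exists>U es. open U \<and> p \<in> U \<and> length es = dim (model E) + DIM('f) * DIM('f) \<and> set es \<subseteq> omni_sections E (Suc m) \<and>
      (\<forall>x\<in>U. distinct (map (omni_value x) es) \<and> independent (omni_value x ` set es) \<and>
         span (omni_value x ` set es) = graph_B E \<mu> x)" for p
  proof -
    obtain Fs \<psi> where fr: "gauge_frame E Fs \<psi>" and p: "\<psi> p \<noteq> 0" and len: "length Fs = dim (model E) + DIM('f) * DIM('f)"
      using gauge_frame_exists[ of p] by blast
    have Fs: "set Fs \<subseteq> derivations E" and \<psi>: "\<psi> \<in> Cinf E" using fr by (auto simp: gauge_frame_def)
    define U where "U = {x. \<psi> x \<noteq> 0}"
    define es where "es = map (\<lambda>D. (D, contr D \<mu>)) Fs"
    have "distinct (map (omni_value x) es) \<and> independent (omni_value x ` set es) \<and>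
         span (omni_value x ` set es) = graph_B E \<mu> x" if x: "x \<in> U" for x
    proof -
      have nz: "\<psi> x \<noteq> 0" using x by (simp add: U_def)
      define S where "S = value_at x ` set Fs"
      have dis: "distinct (map (value_at x) Fs)" and ind: "independent S"
        using fr nz by (auto simp: gauge_frame_def S_def)
      define g where "g \<delta> = (\<delta>, ins \<delta> (\<mu> x))" for \<delta>
      have inj: "inj g" by (auto simp: g_def inj_on_def)
      have lin: "lin_on (gauge_fib E x) g"
        using ins_lin[OF Omega_JD(3)[OF \<mu>, of x] gauge_subspace] by (auto simp: lin_on_def g_def)
      have S: "S \<subseteq> gauge_fib E x" using Fs gauge_value by (auto simp: S_def)
      have val: "omni_value x (D, contr D \<mu>) = g (value_at x D)" for D
        by (simp add: omni_value_def g_def contr_def)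
      have set_es: "omni_value x ` set es = g ` S"
        by (auto simp: es_def image_image val S_def)
      have "map (omni_value x) es = map g (map (value_at x) Fs)" by (simp add: es_def val)
      then have "distinct (map (omni_value x) es)"
        using dis inj by (simp add: distinct_map inj_on_subset[OF inj] del: map_map)
      moreover have "independent (g ` S)"
      proof (rule indexed_independent(2))
        show "finite S" by (simp add: S_def)
        fix c assume "(\<Sum>\<delta>\<in>S. c \<delta> *\<^sub>R g \<delta>) = 0"
        then have "fst (\<Sum>\<delta>\<in>S. c \<delta> *\<^sub>R g \<delta>) = 0" by simp
        then have "(\<Sum>\<delta>\<in>S. c \<delta> *\<^sub>R \<delta>) = 0" by (simp add: fst_sum g_def)
        then show "\<forall>\<delta>\<in>S. c \<delta> = 0" using independentD[OF ind, of S c] by (auto simp: S_def)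
      qed
      moreover have "span (g ` S) = graph_B E \<mu> x"
      proof
        show "span (g ` S) \<subseteq> graph_B E \<mu> x"
          by (rule span_minimal[OF _ graph_subspace[OF \<mu>]]) (use S in \<open>auto simp: g_def graph_B_def\<close>)
        show "graph_B E \<mu> x \<subseteq> span (g ` S)"
        proof
          fix e assume "e \<in> graph_B E \<mu> x"
          then obtain \<delta> where \<delta>: "\<delta> \<in> gauge_fib E x" "e = g \<delta>" by (auto simp: graph_B_def g_def)
          obtain D where D: "D \<in> derivations E" "\<delta> = value_at x D" using gaugeE[OF \<delta>(1)] by blast
          obtain c where c: "\<And>u x. \<psi> x *\<^sub>R D u x = (\<Sum>R\<in>set Fs. c R x *\<^sub>R R u x)"
            using fr D(1) unfolding gauge_frame_def by blast
          have "\<delta> = (\<Sum>R\<in>set Fs. (c R x / \<psi> x) *\<^sub>R value_at x R)"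
          proof
            fix u
            have "D u x = (1 / \<psi> x) *\<^sub>R (\<psi> x *\<^sub>R D u x)" using nz by simp
            also have "\<dots> = (\<Sum>R\<in>set Fs. (c R x / \<psi> x) *\<^sub>R R u x)"
              unfolding c by (simp add: scaleR_sum_right)
            finally show "\<delta> u = (\<Sum>R\<in>set Fs. (c R x / \<psi> x) *\<^sub>R value_at x R) u"
              by (simp add: D(2) sum_fun_apply scaleR_fun_def) (simp add: value_at_def)
          qed
          then have "e = (\<Sum>R\<in>set Fs. (c R x / \<psi> x) *\<^sub>R g (value_at x R))"
            unfolding \<delta>(2) using Fs gauge_value
            by (subst lin_on_sum[OF lin gauge_subspace, symmetric]) auto
          moreover have "(\<Sum>R\<in>set Fs. (c R x / \<psi> x) *\<^sub>R g (value_at x R)) \<in> span (g ` S)"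
            by (rule span_sum, rule span_scale, rule span_base) (simp add: S_def)
          ultimately show "e \<in> span (g ` S)" by (simp only:)
        qed
      qed
      ultimately show ?thesis by (simp add: set_es)
    qed
    moreover have "set es \<subseteq> omni_sections E (Suc m)"
      using Fs contr_Omega_J[OF \<mu>] by (auto simp: es_def omni_sections_def)
    moreover have "open U" unfolding U_def by (rule Cinf_open_support[OF mfd \<psi>])
    ultimately show ?thesis using p len by (intro exI[of _ U] exI[of _ es]) (auto simp: U_def es_def)
  qed
  then show "\<exists>r. \<forall>p. \<exists>U es. open U \<and> p \<in> U \<and> length es = r \<and> set es \<subseteq> omni_sections E (Suc m) \<and>
      (\<forall>x\<in>U. distinct (map (omni_value x) es) \<and> independent (omni_value x ` set es) \<and>
         span (omni_value x ` set es) = graph_B E \<mu> x)" by blast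
qed

lemma pairing_zero_iff:
  "omni_pairing (\<delta>, \<alpha>) (\<epsilon>, \<beta>) = 0 \<longleftrightarrow> (\<forall>xs. \<alpha> (\<epsilon> # xs) = - \<beta> (\<delta> # xs))"
proof -
  have "omni_pairing (\<delta>, \<alpha>) (\<epsilon>, \<beta>) = 0 \<longleftrightarrow> ins \<delta> \<beta> + ins \<epsilon> \<alpha> = 0"
    by (simp add: omni_pairing_def)
  also have "\<dots> \<longleftrightarrow> (\<forall>xs. \<alpha> (\<epsilon> # xs) = - \<beta> (\<delta> # xs))"
    by (auto simp: fun_eq_iff ins_def eq_neg_iff_add_eq_0 add.commute)
  finally show ?thesis .
qed

text \<open>Pairing \<open>(\<delta>, \<alpha>)\<close> with the elements of the graph determines \<open>\<alpha>\<close> on all nonempty lists of arguments, and forms of degree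
  \<open>n \<ge> 1\<close> vanish on the empty one.\<close>

lemma graph_maximal:
  assumes \<mu>: "\<mu> \<in> Omega_J E (Suc (Suc m))"
  shows "maximal_isotropic_subbundle E (Suc m) (graph_B E \<mu>)"
  unfolding maximal_isotropic_subbundle_def
proof (intro conjI allI impI)
  note swap = alt_forms_swap[OF Omega_JD(3)[OF \<mu>] gauge_subspace]
  show "isotropic_subbundle E (Suc m) (graph_B E \<mu>)"
    unfolding isotropic_subbundle_def
  proof (intro conjI graph_subbundle[OF \<mu>] allI ballI)
    fix x e f assume "e \<in> graph_B E \<mu> x" "f \<in> graph_B E \<mu> x"
    then obtain \<delta> \<epsilon> where e: "e = (\<delta>, ins \<delta> (\<mu> x))" "f = (\<epsilon>, ins \<epsilon> (\<mu> x))" by (auto simp: graph_B_def)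
    show "omni_pairing e f = 0"
      unfolding e pairing_zero_iff ins_def by (intro allI swap)
  qed
  fix L assume L: "isotropic_subbundle E (Suc m) L \<and> (\<forall>x. graph_B E \<mu> x \<subseteq> L x)"
  have "L x \<subseteq> graph_B E \<mu> x" for x
  proof
    fix e assume e: "e \<in> L x"
    obtain \<delta> \<alpha> where \<delta>\<alpha>: "e = (\<delta>, \<alpha>)" by (cases e)
    have "L x \<subseteq> omni_fib E (Suc m) x" using L by (simp add: isotropic_subbundle_def omni_subbundle_def)
    then have \<delta>: "\<delta> \<in> gauge_fib E x" and \<alpha>: "\<alpha> \<in> alt_forms (Suc m) (gauge_fib E x) (fib E x)"
      using e \<delta>\<alpha> J_fib_alt by (auto simp: omni_fib_def)
    have "\<alpha> xs = ins \<delta> (\<mu> x) xs" for xs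
    proof (cases "length xs = Suc m \<and> set xs \<subseteq> gauge_fib E x")
      case True
      then obtain \<epsilon> zs where xs: "xs = \<epsilon> # zs" "\<epsilon> \<in> gauge_fib E x" by (cases xs) auto
      then have "(\<epsilon>, ins \<epsilon> (\<mu> x)) \<in> L x" using L by (auto simp: graph_B_def)
      then have "omni_pairing (\<delta>, \<alpha>) (\<epsilon>, ins \<epsilon> (\<mu> x)) = 0"
        using L e \<delta>\<alpha> unfolding isotropic_subbundle_def by blast
      then have "\<alpha> (\<epsilon> # zs) = - ins \<epsilon> (\<mu> x) (\<delta> # zs)" unfolding pairing_zero_iff by blast
      then show ?thesis using swap[of x \<epsilon> \<delta> zs] by (simp add: xs ins_def)
    next
      case False
      then show ?thesis using alt_formsD(4)[OF \<alpha> False] alt_formsD(4)[OF Omega_JD(3)[OF \<mu>], of "\<delta> # xs" x]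
        by (auto simp: ins_def)
    qed
    then have "\<alpha> = ins \<delta> (\<mu> x)" by blast
    then show "e \<in> graph_B E \<mu> x" using \<delta> by (auto simp: \<delta>\<alpha> graph_B_def)
  qed
  then show "L = graph_B E \<mu>" using L by (intro ext) blast
qed

text \<open>Over \<open>\<delta>\<close> there is a unique \<open>(\<delta>, B \<delta>) \<in> L\<close>, and isotropy makes \<open>\<mu>(\<delta>, \<dots>) = (B \<delta>)(\<dots>)\<close> alternating. All \<open>B \<delta>\<close> lie in
  \<open>J\<^sub>n E\<close>, and from this one has to find the form \<open>\<lambda>\<^sub>\<mu>\<close> on tangent vectors, of degree \<open>n\<close>: it is \<open>\<mu>(1, \<dots>)\<close>, which descends
  because it vanishes on endomorphisms.\<close>

lemma isotropic_is_graph: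
  assumes L: "isotropic_subbundle E (Suc m) L" and proj: "projects_isomorphically E (Suc m) L"
  shows "\<exists>\<mu>\<in>Omega_J E (Suc (Suc m)). L = graph_B E \<mu>"
proof -
  have bij: "bij_betw fst (L x) (gauge_fib E x)" for x using proj by (simp add: projects_isomorphically_def)
  have sub: "subspace (L x)" and fibL: "L x \<subseteq> omni_fib E (Suc m) x" for x
    using L by (auto simp: isotropic_subbundle_def omni_subbundle_def)
  define B where "B x \<delta> = (SOME \<alpha>. (\<delta>, \<alpha>) \<in> L x)" for x \<delta>
  have B: "(\<delta>, B x \<delta>) \<in> L x" if "\<delta> \<in> gauge_fib E x" for x \<delta>
  proof -
    have "\<delta> \<in> fst ` L x" using that bij[of x] by (simp add: bij_betw_def)
    then have "\<exists>\<alpha>. (\<delta>, \<alpha>) \<in> L x" by force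
    then show ?thesis unfolding B_def by (rule someI_ex)
  qed
  have uniq: "\<alpha> = B x \<delta>" "\<delta> \<in> gauge_fib E x" if "(\<delta>, \<alpha>) \<in> L x" for x \<delta> \<alpha>
  proof -
    show \<delta>: "\<delta> \<in> gauge_fib E x" using fibL[of x] that by (auto simp: omni_fib_def)
    have "(\<delta>, \<alpha>) = (\<delta>, B x \<delta>)"
      using bij[of x] that B[OF \<delta>] by (intro inj_onD[of fst "L x"]) (auto simp: bij_betw_def)
    then show "\<alpha> = B x \<delta>" by simp
  qed
  have BJ: "B x \<delta> \<in> J_fib E (Suc m) x" if "\<delta> \<in> gauge_fib E x" for x \<delta>
    using B[OF that] fibL[of x] by (auto simp: omni_fib_def)
  note Balt = J_fib_alt[OF BJ]
  have Bswap: "B x \<delta> (\<epsilon> # xs) = - B x \<epsilon> (\<delta> # xs)" if "\<delta> \<in> gauge_fib E x" "\<epsilon> \<in> gauge_fib E x" for x \<delta> \<epsilon> xs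
    using L B[OF that(1)] B[OF that(2)] pairing_zero_iff unfolding isotropic_subbundle_def by blast
  define \<mu> where "\<mu> x \<delta>s = (case \<delta>s of [] \<Rightarrow> 0 | \<delta> # zs \<Rightarrow> if \<delta> \<in> gauge_fib E x then B x \<delta> zs else 0)" for x \<delta>s
  have ins\<mu>: "ins \<delta> (\<mu> x) = B x \<delta>" if "\<delta> \<in> gauge_fib E x" for x \<delta>
    using that by (simp add: ins_def \<mu>_def)
  have alt: "\<mu> x \<in> alt_forms (Suc (Suc m)) (gauge_fib E x) (fib E x)" for x
  proof (rule alt_forms_SucI[OF gauge_subspace subspace_0[OF fib_subspace]])
    show "ins \<delta> (\<mu> x) \<in> alt_forms (Suc m) (gauge_fib E x) (fib E x)" if "\<delta> \<in> gauge_fib E x" for \<delta>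
      unfolding ins\<mu>[OF that] by (rule Balt[OF that])
    show "lin_on (gauge_fib E x) (\<lambda>\<delta>. \<mu> x (\<delta> # xs))" for xs
      unfolding lin_on_def
    proof (intro conjI ballI allI)
      fix \<delta> \<epsilon> and a :: real assume \<delta>: "\<delta> \<in> gauge_fib E x"
      have "(a *\<^sub>R \<delta>, a *\<^sub>R B x \<delta>) \<in> L x" using subspace_scale[OF sub B[OF \<delta>], of a] by simp
      from uniq(1)[OF this, symmetric] show "\<mu> x ((a *\<^sub>R \<delta>) # xs) = a *\<^sub>R \<mu> x (\<delta> # xs)"
        using \<delta> subspace_scale[OF gauge_subspace \<delta>, of a] by (simp add: \<mu>_def scaleR_fun_def)
      assume \<epsilon>: "\<epsilon> \<in> gauge_fib E x"
      have "(\<delta> + \<epsilon>, B x \<delta> + B x \<epsilon>) \<in> L x" using subspace_add[OF sub B[OF \<delta>] B[OF \<epsilon>]] by simp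
      from uniq(1)[OF this, symmetric] show "\<mu> x ((\<delta> + \<epsilon>) # xs) = \<mu> x (\<delta> # xs) + \<mu> x (\<epsilon> # xs)"
        using \<delta> \<epsilon> subspace_add[OF gauge_subspace \<delta> \<epsilon>] by (simp add: \<mu>_def)
    qed
    show "\<mu> x (\<delta> # \<delta> # xs) = 0" if "\<delta> \<in> gauge_fib E x" for \<delta> xs
    proof -
      have "2 *\<^sub>R B x \<delta> (\<delta> # xs) = 0"
        using Bswap[OF that that, of xs] by (simp add: scaleR_2 eq_neg_iff_add_eq_0)
      then show ?thesis using that by (simp add: \<mu>_def)
    qed
    show "\<mu> x xs = 0" if "\<not> (length xs = Suc (Suc m) \<and> set xs \<subseteq> gauge_fib E x)" for xs
    proof (cases xs)
      case (Cons \<delta> zs)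
      then show ?thesis using alt_formsD(4)[OF Balt, of \<delta> x zs] that by (auto simp: \<mu>_def)
    qed (simp add: \<mu>_def)
  qed
  have "\<mu> \<in> Omega E (Suc (Suc m))"
    unfolding Omega_def mem_Collect_eq
  proof (intro conjI allI impI alt)
    fix Ds assume Ds: "length Ds = Suc (Suc m) \<and> set Ds \<subseteq> derivations E"
    then obtain D Rs where D: "Ds = D # Rs" "D \<in> derivations E" "length Rs = Suc m \<and> set Rs \<subseteq> derivations E"
      by (cases Ds) auto
    obtain \<alpha> where \<alpha>: "(D, \<alpha>) \<in> sub_sections E (Suc m) L" using proj D(2) by (auto simp: projects_isomorphically_def)
    then have "(value_at x D, \<alpha> x) \<in> L x" for x by (simp add: sub_sections_def omni_value_def)
    from uniq(1)[OF this] have "\<mu> x (map (value_at x) Ds) = \<alpha> x (map (value_at x) Rs)" for x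
      using gauge_value[OF D(2)] by (simp add: \<mu>_def D(1))
    moreover have "\<alpha> \<in> Omega E (Suc m)" using \<alpha> by (simp add: sub_sections_def omni_sections_def Omega_J_def)
    ultimately show "(\<lambda>x. \<mu> x (map (value_at x) Ds)) \<in> sections E"
      using D(3) by (simp add: Omega_def)
  qed
  moreover have "\<mu> x \<in> J_fib E (Suc (Suc m)) x" for x
  proof -
    note swap = alt_forms_swap[OF alt gauge_subspace]
    define Id where "Id = endo_der E x (\<lambda>e. e)"
    have Id: "Id \<in> gauge_fib E x"
      unfolding Id_def endo_der_id by (rule gauge_value[OF euler_derivation])
    \<comment> \<open>Because the arguments after \<open>\<Phi>\<close> contain some \<open>\<delta>\<close>, the property defining \<open>J\<^sub>n E\<close> can be used for \<open>B \<delta>\<close>.\<close>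
    have factor: "\<mu> x (endo_der E x \<Phi> # \<delta>s) = \<Phi> (\<mu> x (Id # \<delta>s))"
      if \<Phi>: "\<Phi> \<in> endos E x" and \<delta>s: "length \<delta>s = Suc m" "set \<delta>s \<subseteq> gauge_fib E x" for \<Phi> \<delta>s
    proof -
      obtain \<delta> zs where zs: "\<delta>s = \<delta> # zs" "\<delta> \<in> gauge_fib E x" "length zs = m" "set zs \<subseteq> gauge_fib E x"
        using \<delta>s by (cases \<delta>s) auto
      obtain \<kappa> where \<kappa>: "\<kappa> \<in> alt_forms m (tangent_space E x) (fib E x)"
        "\<And>\<Phi> \<delta>s. \<Phi> \<in> endos E x \<Longrightarrow> length \<delta>s = m \<Longrightarrow> set \<delta>s \<subseteq> gauge_fib E x \<Longrightarrow>
          B x \<delta> (endo_der E x \<Phi> # \<delta>s) = \<Phi> (\<kappa> (map (symbol E x) \<delta>s))"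
        using J_fibE[OF BJ[OF zs(2)]] by blast
      define e where "e = \<kappa> (map (symbol E x) zs)"
      have e: "e \<in> fib E x"
        unfolding e_def using zs symbols_tangent[of zs x] by (intro alt_formsD(1)[OF \<kappa>(1)]) auto
      have id: "(\<lambda>e. e) \<in> endos E x" by (auto simp: endos_def lin_on_def)
      have "\<mu> x (endo_der E x \<Psi> # \<delta>s) = - \<Psi> e" if "\<Psi> \<in> endos E x" for \<Psi>
        using swap[of x "endo_der E x \<Psi>" \<delta> zs] \<kappa>(2)[OF that zs(3,4)] zs(1,2) by (simp add: \<mu>_def[of x "\<delta> # _"] e_def)
      from this[OF \<Phi>] this[OF id] show ?thesis using endos_minus[OF \<Phi> e] by (simp add: Id_def)
    qed
    have zero: "\<Phi> 0 = 0" if "\<Phi> \<in> endos E x" for \<Phi>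
      using lin_on_0[OF _ fib_subspace] that by (auto simp: endos_def)
    \<comment> \<open>A \<open>\<delta>\<close> with symbol \<open>0\<close> is an endomorphism \<open>\<Phi>\<close>, and \<open>\<mu>(1, \<Phi>, \<dots>) = - \<Phi>(\<mu>(1, 1, \<dots>)) = 0\<close>.\<close>
    have ker: "ins Id (\<mu> x) (\<delta> # zs) = 0" if \<delta>: "\<delta> \<in> gauge_fib E x" "symbol E x \<delta> = 0" for \<delta> zs
    proof (cases "length zs = m \<and> set zs \<subseteq> gauge_fib E x")
      case True
      obtain \<Phi> where \<Phi>: "\<Phi> \<in> endos E x" "\<delta> = endo_der E x \<Phi>" using kernel_symbol[OF \<delta>] by blast
      have "\<mu> x (Id # \<delta> # zs) = - \<mu> x (\<delta> # Id # zs)" by (rule swap)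
      also have "\<mu> x (\<delta> # Id # zs) = \<Phi> (\<mu> x (Id # Id # zs))"
        unfolding \<Phi>(2) using True Id by (intro factor \<Phi>(1)) auto
      also have "\<mu> x (Id # Id # zs) = 0" using alt_formsD(3)[OF alt, of "Id # Id # zs" x] True Id by auto
      finally show ?thesis using zero[OF \<Phi>(1)] by (simp add: ins_def)
    next
      case False
      then show ?thesis using alt_formsD(4)[OF alt, of "Id # \<delta> # zs" x] by (auto simp: ins_def)
    qed
    have surj: "symbol E x ` gauge_fib E x = tangent_space E x"
    proof
      show "symbol E x ` gauge_fib E x \<subseteq> tangent_space E x" using symbol_tangent by auto
      obtain B \<beta> y P s \<omega> where lf: "local_frame E B \<beta> y P s \<omega>" and nz: "\<beta> x \<noteq> 0"
        using local_frame_exists[ of x] by blast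
      show "tangent_space E x \<subseteq> symbol E x ` gauge_fib E x"
        using local_frame.symbol_surjective[OF lf nz] by (metis imageI subsetI)
    qed
    obtain \<kappa> where \<kappa>: "\<kappa> \<in> alt_forms (Suc m) (tangent_space E x) (fib E x)"
      "\<And>\<delta>s. length \<delta>s = Suc m \<Longrightarrow> set \<delta>s \<subseteq> gauge_fib E x \<Longrightarrow> ins Id (\<mu> x) \<delta>s = \<kappa> (map (symbol E x) \<delta>s)"
      using alt_forms_descend[OF alt_forms_ins[OF alt Id] gauge_subspace subspace_0[OF fib_subspace] symbol_lin surj ker] by blast
    show ?thesis
    proof (rule J_fibI[OF alt \<kappa>(1)])
      fix \<Phi> \<delta>s assume as: "\<Phi> \<in> endos E x" "length \<delta>s = Suc m" "set \<delta>s \<subseteq> gauge_fib E x"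
      show "\<mu> x (endo_der E x \<Phi> # \<delta>s) = \<Phi> (\<kappa> (map (symbol E x) \<delta>s))"
        using factor[OF as] \<kappa>(2)[OF as(2,3)] by (simp add: ins_def)
    qed
  qed
  moreover have "L = graph_B E \<mu>"
  proof
    fix x
    have "(\<delta>, \<alpha>) \<in> L x \<longleftrightarrow> (\<delta>, \<alpha>) \<in> graph_B E \<mu> x" for \<delta> \<alpha>
      using uniq[of \<delta> \<alpha> x] B[of \<delta> x] ins\<mu>[of \<delta> x] by (auto simp: mem_graph)
    then show "L x = graph_B E \<mu> x" by auto
  qed
  ultimately show ?thesis by (auto simp: Omega_J_def)
qed

lemma sub_sections_graph:
  assumes \<mu>: "\<mu> \<in> Omega_J E (Suc (Suc m))"
  shows "(D, \<alpha>) \<in> sub_sections E (Suc m) (graph_B E \<mu>) \<longleftrightarrow> D \<in> derivations E \<and> \<alpha> = contr D \<mu>"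
proof
  assume "(D, \<alpha>) \<in> sub_sections E (Suc m) (graph_B E \<mu>)"
  then show "D \<in> derivations E \<and> \<alpha> = contr D \<mu>"
    by (auto simp: sub_sections_def omni_sections_def omni_value_def graph_B_def contr_def)
next
  assume "D \<in> derivations E \<and> \<alpha> = contr D \<mu>"
  then show "(D, \<alpha>) \<in> sub_sections E (Suc m) (graph_B E \<mu>)"
    using contr_Omega_J[OF \<mu>, of D] gauge_value[ of D]
    by (auto simp: sub_sections_def omni_sections_def omni_value_def graph_B_def contr_def)
qed

text \<open>Sections of the graph are the pairs \<open>(D, \<iota>\<^sub>D \<mu>)\<close>, and their brackets are sections of the graph up to \<open>\<iota>\<^sub>R \<iota>\<^sub>D d\<mu>\<close>.\<close>

lemma involutive_iff_closed:
  assumes \<mu>: "\<mu> \<in> Omega_J E (Suc (Suc m))"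
  shows "involutive E (Suc m) (graph_B E \<mu>) \<longleftrightarrow> dD E (Suc (Suc m)) \<mu> = 0"
proof -
  define \<omega> where "\<omega> = dD E (Suc (Suc m)) \<mu>"
  have \<omega>: "\<omega> x \<in> alt_forms (Suc (Suc (Suc m))) (gauge_fib E x) (fib E x)" for x
    unfolding \<omega>_def by (rule OmegaD(1)[OF dD_Omega[OF Omega_JD(1)[OF \<mu>]]])
  have br: "omni_bracket E (Suc m) (D, contr D \<mu>) (R, contr R \<mu>) =
      (commutator D R, contr (commutator D R) \<mu> + contr R (contr D \<omega>))"
    if "D \<in> derivations E" "R \<in> derivations E" for D R
    unfolding omni_bracket_def \<omega>_def using bracket_form[OF Omega_JD(1)[OF \<mu>] that] by simp
  have "involutive E (Suc m) (graph_B E \<mu>) \<longleftrightarrow>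
      (\<forall>D\<in>derivations E. \<forall>R\<in>derivations E. contr R (contr D \<omega>) = 0)"
  proof -
    have "omni_bracket E (Suc m) (D, contr D \<mu>) (R, contr R \<mu>) \<in> sub_sections E (Suc m) (graph_B E \<mu>)
        \<longleftrightarrow> contr R (contr D \<omega>) = 0" if "D \<in> derivations E" "R \<in> derivations E" for D R
      unfolding br[OF that] sub_sections_graph[OF \<mu>] using derivations_commutator[OF that] by simp
    then show ?thesis
      unfolding involutive_def split_paired_all Ball_def split_paired_All sub_sections_graph[OF \<mu>] by auto
  qed
  also have "\<dots> \<longleftrightarrow> \<omega> = 0"
  proof
    assume *: "\<forall>D\<in>derivations E. \<forall>R\<in>derivations E. contr R (contr D \<omega>) = 0"
    show "\<omega> = 0"
    proof (intro ext)
      fix x \<delta>s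
      show "\<omega> x \<delta>s = 0 x \<delta>s"
      proof (cases "length \<delta>s = Suc (Suc (Suc m)) \<and> set \<delta>s \<subseteq> gauge_fib E x")
        case True
        then obtain \<delta> \<epsilon> zs where zs: "\<delta>s = \<delta> # \<epsilon> # zs" "\<delta> \<in> gauge_fib E x" "\<epsilon> \<in> gauge_fib E x"
          by (cases \<delta>s; cases "tl \<delta>s") auto
        obtain D where D: "D \<in> derivations E" "\<delta> = value_at x D" using gaugeE[OF zs(2)] by blast
        obtain R where R: "R \<in> derivations E" "\<epsilon> = value_at x R" using gaugeE[OF zs(3)] by blast
        have "contr R (contr D \<omega>) x zs = 0" using * D(1) R(1) by simp
        then show ?thesis by (simp add: contr_def ins_def zs(1) D(2) R(2))
      next
        case False
        then show ?thesis using alt_formsD(4)[OF \<omega> False] by simp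
      qed
    qed
  next
    assume "\<omega> = 0"
    then show "\<forall>D\<in>derivations E. \<forall>R\<in>derivations E. contr R (contr D \<omega>) = 0"
      by (auto simp: contr_def ins_def fun_eq_iff)
  qed
  finally show ?thesis unfolding \<omega>_def .
qed

end

section \<open>Graphs of forms as higher Dirac-Jacobi structures\<close>

theorem theorem3p3:
  fixes E :: "('a::{t2_space,second_countable_topology}, 'm::euclidean_space, 'v::real_vector,
      'f::euclidean_space) vbundle"
    and n :: nat
    and \<mu> :: "'a \<Rightarrow> ('a, 'v) form_at"
  assumes "vector_bundle E"
    and "n \<ge> 1"
    and "\<mu> \<in> Omega_J E (n + 1)"
  shows "maximal_isotropic_subbundle E n (graph_B E \<mu>) \<and>
    (\<forall>L. isotropic_subbundle E n L \<and> projects_isomorphically E n L \<longrightarrow>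
       (\<exists>\<mu>'\<in>Omega_J E (n + 1). L = graph_B E \<mu>')) \<and>
    (involutive E n (graph_B E \<mu>) \<longleftrightarrow> dD E (n + 1) \<mu> = 0) \<and>
    (involutive E n (graph_B E \<mu>) \<longleftrightarrow> higher_dirac_jacobi E n (graph_B E \<mu>)) \<and>
    (dD E (n + 1) \<mu> = 0 \<longrightarrow> (\<exists>\<mu>''\<in>Omega_J E n. \<mu> = dD E n \<mu>''))"
proof -
  obtain m where n: "n = Suc m" using assms(2) by (cases n) auto
  have \<mu>: "\<mu> \<in> Omega_J E (Suc (Suc m))" using assms(3) by (simp add: n)
  interpret smooth_bundle E by unfold_locales (rule assms(1))
  have "\<exists>\<mu>''\<in>Omega_J E n. \<mu> = dD E n \<mu>''" if "dD E (n + 1) \<mu> = 0"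
    using euler_homotopy[OF Omega_JD(1)[OF \<mu>]] contr_Omega_J[OF \<mu> euler_derivation] that
    unfolding n by auto
  moreover have "maximal_isotropic_subbundle E n (graph_B E \<mu>)"
    unfolding n by (rule graph_maximal[OF \<mu>])
  moreover have "\<forall>L. isotropic_subbundle E n L \<and> projects_isomorphically E n L \<longrightarrow>
       (\<exists>\<mu>'\<in>Omega_J E (n + 1). L = graph_B E \<mu>')"
    using isotropic_is_graph[ of m] unfolding n by auto
  moreover have "involutive E n (graph_B E \<mu>) \<longleftrightarrow> dD E (n + 1) \<mu> = 0"
    using involutive_iff_closed[OF \<mu>] unfolding n by simp
  ultimately show ?thesis by (auto simp: higher_dirac_jacobi_def)
qed

end
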